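(* Let $H<\mathrm{Sym}(d)$ be transitive, $F=F_m$ the free group on $x_1,\ldots,x_m$, and let $\phi\in\mathrm{Hom}(F,W(H))\cong W(H)^m$ be random with the product Haar measure; $F$ acts on $T$ via $\phi$. Let $\Delta<F$ be a non-cyclic subgroup and $K\in\mathbb{N}$. Then there is a random variable $N=N(K)\in\mathbb{N}$ and, for every $\Delta$-orbit $Z\subset L(N)$, random variables: a vertex $v=v(Z)\in Z$ and $K$ elements $\alpha_1(Z),\ldots,\alpha_K(Z)\in\Delta_{v(Z)}$, such that the automorphisms $\beta(\phi(\alpha_k(Z)),v(Z))$, $1\le k\le K$, are $K$ independent Haar-random elements of $W(H)$.
   Context: $T=T_d$ is the rooted $d$-ary tree, $L(n)$ its $n$-th level; automorphisms act on the right. For $g\in\mathrm{Aut}(T)$ and vertex $v$, $\beta(g,v)=\tau_v^{-1}g\tau_{v^g}$, where $\tau_v$ identifies the subtree of descendants of $v$ with $T$ by deleting the first $|v|$ letters; $\overline{\beta(g,v)}\in\mathrm{Sym}(d)$ is its action on the first level. $W(H)=\{g\in\mathrm{Aut}(T):\overline{\beta(g,v)}\in H\ \forall v\}$, a compact group with Haar probability measure. $\Delta_v$ is the stabilizer of $v$ in $\Delta$. A random variable means a measurable function of $\phi$ defined almost everywhere. *)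

theory Defs
  imports "HOL-Probability.Probability" "HOL-Algebra.Algebra"
begin

section \<open>The rooted tree and the groups W(H)\<close>

text \<open>
  The alphabet is a finite type \<open>'d\<close>, so \<open>d = CARD('d)\<close>. Vertices of \<open>T\<close> are the words over
  \<open>'d\<close>; the children of \<open>v\<close> are the words \<open>v @ [x]\<close>.
\<close>

definition tree_level :: "nat \<Rightarrow> 'd list set" where
  "tree_level n = {v. length v = n}"

definition is_child :: "'d list \<Rightarrow> 'd list \<Rightarrow> bool" where
  "is_child v w \<longleftrightarrow> (\<exists>x. w = v @ [x])"

definition tree_aut :: "('d list \<Rightarrow> 'd list) set" where
  "tree_aut = {g. bij g \<and> g [] = [] \<and> (\<forall>v w. is_child (g v) (g w) \<longleftrightarrow> is_child v w)}"

text \<open>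
  \<open>section_at g v\<close> is \<open>\<beta>(g,v) = \<tau>\<^sub>v\<^sup>-\<^sup>1 g \<tau>\<^bsub>v^g\<^esub>\<close>. Everything acts on the right, so this first
  prepends \<open>v\<close>, then applies \<open>g\<close>, then deletes the first \<open>\<bar>v\<bar>\<close> letters (\<open>g\<close> preserves levels).
\<close>

definition section_at :: "('d list \<Rightarrow> 'd list) \<Rightarrow> 'd list \<Rightarrow> 'd list \<Rightarrow> 'd list" where
  "section_at g v = (\<lambda>u. drop (length v) (g (v @ u)))"

definition root_perm :: "('d list \<Rightarrow> 'd list) \<Rightarrow> 'd \<Rightarrow> 'd" where
  "root_perm g = (\<lambda>x. hd (g [x]))"

definition W_set :: "('d \<Rightarrow> 'd) set \<Rightarrow> ('d list \<Rightarrow> 'd list) set" where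
  "W_set H = {g \<in> tree_aut. \<forall>v. root_perm (section_at g v) \<in> H}"

text \<open>The product \<open>g h\<close> means first \<open>g\<close>, then \<open>h\<close> (right action).\<close>

definition W_group :: "('d \<Rightarrow> 'd) set \<Rightarrow> ('d list \<Rightarrow> 'd list) monoid" where
  "W_group H = \<lparr>carrier = W_set H, mult = (\<lambda>g h. h \<circ> g), one = id\<rparr>"

text \<open>The topology of pointwise convergence, the vertex set being discrete.\<close>

definition W_topology :: "('d \<Rightarrow> 'd) set \<Rightarrow> ('d list \<Rightarrow> 'd list) topology" where
  "W_topology H =
     subtopology (product_topology (\<lambda>_. discrete_topology UNIV) UNIV) (W_set H)"

text \<open>
  A Haar probability measure on a compact second countable group: a left invariant Borel
  probability measure. It exists and is unique; regularity is automatic, and left invariance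
  implies right invariance.
\<close>

definition haar_prob :: "('g, 'x) monoid_scheme \<Rightarrow> 'g topology \<Rightarrow> 'g measure \<Rightarrow> bool" where
  "haar_prob G T \<mu> \<longleftrightarrow>
     prob_space \<mu> \<and> space \<mu> = carrier G \<and>
     sets \<mu> = sigma_sets (carrier G) {U. openin T U} \<and>
     (\<forall>g\<in>carrier G. \<forall>A\<in>sets \<mu>. g <#\<^bsub>G\<^esub> A \<in> sets \<mu> \<and> emeasure \<mu> (g <#\<^bsub>G\<^esub> A) = emeasure \<mu> A)"

section \<open>The free group\<close>

text \<open>
  The free group on generators indexed by \<open>{..<m}\<close>, as reduced words; the letter \<open>(i, True)\<close> is the
  generator with index \<open>i\<close> and \<open>(i, False)\<close> its inverse.
\<close>

type_synonym letter = "nat \<times> bool"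

definition inv_letter :: "letter \<Rightarrow> letter" where
  "inv_letter a = (fst a, \<not> snd a)"

definition reduced_word :: "letter list \<Rightarrow> bool" where
  "reduced_word w \<longleftrightarrow> successively (\<lambda>a b. b \<noteq> inv_letter a) w"

fun push_letter :: "letter \<Rightarrow> letter list \<Rightarrow> letter list" where
  "push_letter a [] = [a]"
| "push_letter a (b # w) = (if b = inv_letter a then w else a # b # w)"

definition free_group :: "nat \<Rightarrow> letter list monoid" where
  "free_group m =
     \<lparr>carrier = {w. fst ` set w \<subseteq> {..<m} \<and> reduced_word w}, mult = foldr push_letter, one = []\<rparr>"

definition eval_letter :: "('g, 'x) monoid_scheme \<Rightarrow> (nat \<Rightarrow> 'g) \<Rightarrow> letter \<Rightarrow> 'g" where
  "eval_letter G g a = (if snd a then g (fst a) else inv\<^bsub>G\<^esub> (g (fst a)))"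

text \<open>
  The homomorphism \<open>\<phi>\<close> from the free group to \<open>G\<close> with \<open>\<phi>(x\<^sub>i) = g i\<close>; this is the identification
  of \<open>Hom(F\<^sub>m, G)\<close> with \<open>G\<^sup>m\<close>, see \<open>free_hom_hom\<close>, \<open>free_hom_gen\<close> and \<open>free_hom_unique\<close>.
\<close>

definition free_hom :: "('g, 'x) monoid_scheme \<Rightarrow> (nat \<Rightarrow> 'g) \<Rightarrow> letter list \<Rightarrow> 'g" where
  "free_hom G g w = foldr (\<lambda>a y. eval_letter G g a \<otimes>\<^bsub>G\<^esub> y) w \<one>\<^bsub>G\<^esub>"

lemma inv_letter_inv [simp]: "inv_letter (inv_letter a) = a"
  by (simp add: inv_letter_def)

lemma fst_inv_letter [simp]: "fst (inv_letter a) = fst a"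
  by (simp add: inv_letter_def)

lemma reduced_Nil [simp]: "reduced_word []"
  by (simp add: reduced_word_def)

lemma reduced_ConsD: "reduced_word (a # w) \<Longrightarrow> reduced_word w"
  by (cases w) (auto simp: reduced_word_def)

lemma reduced_push: "reduced_word w \<Longrightarrow> reduced_word (push_letter a w)"
  by (cases w) (auto simp: reduced_word_def dest: reduced_ConsD[unfolded reduced_word_def])

lemma set_push: "fst ` set (push_letter a w) \<subseteq> insert (fst a) (fst ` set w)"
  by (cases w) auto

lemma push_reduced: "reduced_word (a # w) \<Longrightarrow> push_letter a w = a # w"
  by (cases w) (auto simp: reduced_word_def)

lemma push_push_inv: "reduced_word w \<Longrightarrow> push_letter a (push_letter (inv_letter a) w) = w"
proof (cases w)
  case (Cons b w')
  assume r: "reduced_word w"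
  show ?thesis
  proof (cases "b = a")
    case True
    then show ?thesis using Cons r push_reduced[of a w'] by simp
  qed (use Cons in auto)
qed auto

lemma reduced_foldr: "reduced_word v \<Longrightarrow> reduced_word (foldr push_letter u v)"
  by (induction u) (auto intro: reduced_push)

lemma set_foldr: "fst ` set (foldr push_letter u v) \<subseteq> fst ` set u \<union> fst ` set v"
proof (induction u)
  case (Cons a u)
  have "fst ` set (foldr push_letter (a # u) v) \<subseteq> insert (fst a) (fst ` set (foldr push_letter u v))"
    using set_push[of a "foldr push_letter u v"] by simp
  also have "\<dots> \<subseteq> insert (fst a) (fst ` set u \<union> fst ` set v)"
    using Cons.IH by blast
  finally show ?case by simp
qed auto

lemma foldr_push_push:
  assumes "reduced_word w"
  shows "foldr push_letter (push_letter a t) w = push_letter a (foldr push_letter t w)"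
proof (cases t)
  case (Cons b t')
  show ?thesis
  proof (cases "b = inv_letter a")
    case True
    then show ?thesis
      using Cons push_push_inv[OF reduced_foldr[OF assms], of a t'] by simp
  qed (use Cons in auto)
qed auto

lemma foldr_push_assoc:
  "reduced_word w \<Longrightarrow>
     foldr push_letter (foldr push_letter u v) w = foldr push_letter u (foldr push_letter v w)"
  by (induction u) (auto simp: foldr_push_push)

lemma foldr_push_inverse: "foldr push_letter (rev (map inv_letter u)) u = []"
  by (induction u) auto

lemma reduced_rev_inv: "reduced_word u \<Longrightarrow> reduced_word (rev (map inv_letter u))"
proof (induction u)
  case (Cons a u)
  have 1: "reduced_word (rev (map inv_letter u))"
    using Cons reduced_ConsD by blast
  have 2: "u \<noteq> [] \<Longrightarrow> hd u \<noteq> inv_letter a"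
    using Cons.prems by (cases u) (auto simp: reduced_word_def)
  have 3: "u \<noteq> [] \<Longrightarrow> last (rev (map inv_letter u)) = inv_letter (hd u)"
    by (cases u) auto
  show ?case
    using 1 2 3 unfolding reduced_word_def
    by (auto simp: successively_append_iff)
qed simp

lemma group_free_group: "group (free_group m)"
proof (rule groupI)
  fix x y assume "x \<in> carrier (free_group m)" "y \<in> carrier (free_group m)"
  then have xy: "fst ` set x \<union> fst ` set y \<subseteq> {..<m}" "reduced_word y"
    by (auto simp: free_group_def)
  then show "x \<otimes>\<^bsub>free_group m\<^esub> y \<in> carrier (free_group m)"
    using subset_trans[OF set_foldr xy(1)] by (simp add: free_group_def reduced_foldr)
next
  fix x assume "x \<in> carrier (free_group m)"
  then show "\<exists>y\<in>carrier (free_group m). y \<otimes>\<^bsub>free_group m\<^esub> x = \<one>\<^bsub>free_group m\<^esub>"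
    by (intro bexI[of _ "rev (map inv_letter x)"])
       (auto simp: free_group_def foldr_push_inverse reduced_rev_inv)
qed (auto simp: free_group_def foldr_push_assoc)

lemma eval_letter_closed:
  assumes "group G" "g \<in> {..<m} \<rightarrow> carrier G" "fst a < m"
  shows "eval_letter G g a \<in> carrier G"
  using assms by (auto simp: eval_letter_def intro!: group.inv_closed)

lemma free_hom_Nil: "free_hom G g [] = \<one>\<^bsub>G\<^esub>"
  by (simp add: free_hom_def)

lemma free_hom_Cons: "free_hom G g (a # w) = eval_letter G g a \<otimes>\<^bsub>G\<^esub> free_hom G g w"
  by (simp add: free_hom_def)

lemma free_hom_closed:
  assumes "group G" "g \<in> {..<m} \<rightarrow> carrier G" "fst ` set w \<subseteq> {..<m}"
  shows "free_hom G g w \<in> carrier G"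
  using assms(3)
proof (induction w)
  case Nil
  then show ?case using assms(1) by (simp add: free_hom_Nil group.is_monoid monoid.one_closed)
next
  case (Cons a w)
  then show ?case using eval_letter_closed[OF assms(1,2), of a] assms(1)
    by (auto simp: free_hom_Cons intro!: monoid.m_closed group.is_monoid)
qed

lemma free_hom_push:
  assumes G: "group G" and g: "g \<in> {..<m} \<rightarrow> carrier G" and "fst a < m" "fst ` set w \<subseteq> {..<m}"
  shows "free_hom G g (push_letter a w) = eval_letter G g a \<otimes>\<^bsub>G\<^esub> free_hom G g w"
proof (cases w)
  case (Cons b w')
  interpret group G by fact
  have w': "free_hom G g w' \<in> carrier G"
    using free_hom_closed[OF G g, of w'] assms(4) Cons by auto
  have ga: "g (fst a) \<in> carrier G" using g assms(3) by auto
  show ?thesis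
  proof (cases "b = inv_letter a")
    case True
    then have "eval_letter G g a \<otimes>\<^bsub>G\<^esub> eval_letter G g b = \<one>\<^bsub>G\<^esub>"
      using ga by (auto simp: eval_letter_def inv_letter_def)
    then show ?thesis
      using Cons True w' eval_letter_closed[OF G g, of a] eval_letter_closed[OF G g, of b] assms(3)
      by (auto simp: free_hom_Cons m_assoc[symmetric])
  qed (use Cons in \<open>auto simp: free_hom_Cons\<close>)
qed (auto simp: free_hom_Cons)

lemma free_hom_hom:
  assumes G: "group G" and g: "g \<in> {..<m} \<rightarrow> carrier G"
  shows "free_hom G g \<in> hom (free_group m) G"
proof (rule homI)
  interpret group G by fact
  fix x assume "x \<in> carrier (free_group m)"
  then show "free_hom G g x \<in> carrier G"
    using free_hom_closed[OF G g] by (auto simp: free_group_def)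
next
  interpret group G by fact
  fix x y assume xy: "x \<in> carrier (free_group m)" "y \<in> carrier (free_group m)"
  then have x: "fst ` set x \<subseteq> {..<m}" and y: "fst ` set y \<subseteq> {..<m}"
    by (auto simp: free_group_def)
  have "free_hom G g (foldr push_letter x y) = free_hom G g x \<otimes>\<^bsub>G\<^esub> free_hom G g y"
    using x
  proof (induction x)
    case Nil
    then show ?case using free_hom_closed[OF G g y] by (simp add: free_hom_Nil)
  next
    case (Cons a x)
    have "fst ` set (foldr push_letter x y) \<subseteq> {..<m}"
      by (rule subset_trans[OF set_foldr]) (use Cons.prems y in auto)
    then show ?case
      using Cons free_hom_push[OF G g, of a "foldr push_letter x y"]
        free_hom_closed[OF G g y] free_hom_closed[OF G g, of x] eval_letter_closed[OF G g, of a]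
      by (auto simp: free_hom_Cons m_assoc)
  qed
  then show "free_hom G g (x \<otimes>\<^bsub>free_group m\<^esub> y) = free_hom G g x \<otimes>\<^bsub>G\<^esub> free_hom G g y"
    by (simp add: free_group_def)
qed

lemma free_hom_gen:
  assumes "group G" "g \<in> {..<m} \<rightarrow> carrier G" "i < m"
  shows "free_hom G g [(i, True)] = g i"
proof -
  interpret group G by fact
  have "g i \<in> carrier G" using assms(2,3) by auto
  then show ?thesis by (simp add: free_hom_def eval_letter_def)
qed

lemma free_hom_unique:
  assumes G: "group G" and f: "f \<in> hom (free_group m) G" and w: "w \<in> carrier (free_group m)"
  shows "f w = free_hom G (\<lambda>i. f [(i, True)]) w"
proof -
  let ?F = "free_group m"
  interpret group_hom ?F G f
    using G f group_free_group by (simp add: group_hom_def group_hom_axioms_def)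
  have letter: "f [a] = eval_letter G (\<lambda>i. f [(i, True)]) a" if "fst a < m" for a
  proof (cases "snd a")
    case False
    have c: "[a] \<in> carrier ?F" "[(fst a, True)] \<in> carrier ?F"
      using that by (auto simp: free_group_def reduced_word_def)
    have "[a] \<otimes>\<^bsub>?F\<^esub> [(fst a, True)] = \<one>\<^bsub>?F\<^esub>"
      using False by (auto simp: free_group_def inv_letter_def)
    then have "inv\<^bsub>?F\<^esub> [(fst a, True)] = [a]"
      using c G.inv_equality by blast
    then show ?thesis using False c hom_inv[of "[(fst a, True)]"]
      by (simp add: eval_letter_def)
  qed (auto simp: eval_letter_def prod_eq_iff intro!: arg_cong[where f = f])
  show ?thesis
    using w
  proof (induction w)
    case Nil
    then show ?case using hom_one by (simp add: free_group_def free_hom_Nil)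
  next
    case (Cons a w)
    have "a # w = [a] \<otimes>\<^bsub>?F\<^esub> w"
      using Cons.prems push_reduced by (auto simp: free_group_def)
    moreover have "w \<in> carrier ?F" "[a] \<in> carrier ?F"
      using Cons.prems reduced_ConsD[of a w] by (auto simp: free_group_def reduced_word_def)
    ultimately have "f (a # w) = f [a] \<otimes>\<^bsub>G\<^esub> f w" by simp
    moreover have "fst a < m" using Cons.prems by (auto simp: free_group_def)
    ultimately show ?case using Cons.IH \<open>w \<in> carrier ?F\<close> letter by (simp add: free_hom_Cons)
  qed
qed

lemma tree_aut_length:
  assumes "g \<in> tree_aut" shows "length (g v) = length v"
proof (induction v rule: rev_induct)
  case (snoc x v)
  have "is_child (g v) (g (v @ [x]))" using assms by (auto simp: tree_aut_def is_child_def)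
  then show ?case using snoc by (auto simp: is_child_def)
qed (use assms in \<open>auto simp: tree_aut_def\<close>)

lemma tree_aut_take:
  assumes "g \<in> tree_aut" shows "take (length v) (g (v @ u)) = g v"
proof (induction u rule: rev_induct)
  case Nil
  then show ?case by (simp add: tree_aut_length[OF assms])
next
  case (snoc x u)
  have "is_child (g (v @ u)) (g ((v @ u) @ [x]))"
    using assms unfolding tree_aut_def is_child_def by blast
  then show ?case using snoc tree_aut_length[OF assms, of "v @ u"] by (auto simp: is_child_def)
qed

lemma tree_aut_append:
  assumes "g \<in> tree_aut" shows "g (v @ u) = g v @ section_at g v u"
  using append_take_drop_id[of "length v" "g (v @ u)"]
  by (simp add: tree_aut_take[OF assms] section_at_def)

lemma tree_aut_snoc:
  assumes "g \<in> tree_aut" shows "g (v @ [x]) = g v @ [root_perm (section_at g v) x]"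
proof -
  have "length (section_at g v [x]) = 1"
    by (simp add: section_at_def tree_aut_length[OF assms])
  then have "section_at g v [x] = [root_perm (section_at g v) x]"
    by (auto simp: root_perm_def length_Suc_conv)
  then show ?thesis using tree_aut_append[OF assms] by metis
qed

lemma tree_aut_comp: "g \<in> tree_aut \<Longrightarrow> h \<in> tree_aut \<Longrightarrow> h \<circ> g \<in> tree_aut"
  by (auto simp: tree_aut_def intro: bij_comp)

lemma tree_aut_inv:
  assumes g: "g \<in> tree_aut" shows "inv_into UNIV g \<in> tree_aut"
proof -
  have b: "bij g" and 0: "g [] = []"
    and c: "\<And>v w. is_child (g v) (g w) \<longleftrightarrow> is_child v w"
    using g by (auto simp: tree_aut_def)
  have s: "g (inv_into UNIV g v) = v" for v using b by (simp add: bij_is_surj surj_f_inv_f)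
  have "is_child (inv_into UNIV g v) (inv_into UNIV g w) \<longleftrightarrow> is_child v w" for v w
    using c[of "inv_into UNIV g v" "inv_into UNIV g w"] by (simp add: s)
  moreover have "inv_into UNIV g [] = []" using b 0 by (metis bij_inv_eq_iff)
  ultimately show ?thesis using b by (simp add: tree_aut_def bij_imp_bij_inv)
qed

lemma root_perm_section_comp:
  assumes "g \<in> tree_aut" "h \<in> tree_aut"
  shows "root_perm (section_at (h \<circ> g) v)
       = root_perm (section_at h (g v)) \<circ> root_perm (section_at g v)"
proof
  fix x
  have "(h \<circ> g) (v @ [x]) = (h \<circ> g) v @ [root_perm (section_at (h \<circ> g) v) x]"
    by (rule tree_aut_snoc[OF tree_aut_comp[OF assms]])
  moreover have "(h \<circ> g) (v @ [x])
      = h (g v) @ [root_perm (section_at h (g v)) (root_perm (section_at g v) x)]"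
    by (simp add: tree_aut_snoc[OF assms(1)] tree_aut_snoc[OF assms(2)])
  ultimately show "root_perm (section_at (h \<circ> g) v) x
       = (root_perm (section_at h (g v)) \<circ> root_perm (section_at g v)) x"
    by simp
qed

lemma group_W_group:
  fixes H :: "('d::finite \<Rightarrow> 'd) set"
  assumes H: "subgroup H (BijGroup UNIV)"
  shows "group (W_group H)"
proof -
  let ?S = "BijGroup (UNIV :: 'd set)"
  have Hbij: "h \<in> H \<Longrightarrow> bij h" for h
    using subgroup.mem_carrier[OF H] by (auto simp: BijGroup_def Bij_def)
  have carr: "h \<in> Bij UNIV" if "h \<in> H" for h
    using subgroup.mem_carrier[OF H that] by (simp add: BijGroup_def)
  have comp: "h \<circ> k \<in> H" if "h \<in> H" "k \<in> H" for h k
    using subgroup.m_closed[OF H that] carr[OF that(1)] carr[OF that(2)]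
    by (simp add: BijGroup_def compose_def comp_def restrict_def)
  have one: "id \<in> H"
    using subgroup.one_closed[OF H] by (simp add: BijGroup_def id_def restrict_def)
  have hinv: "inv_into UNIV h \<in> H" if "h \<in> H" for h
  proof -
    have "inv\<^bsub>?S\<^esub> h = inv_into UNIV h"
      using inv_BijGroup[OF carr[OF that]] by (simp add: restrict_def)
    then show ?thesis using subgroup.m_inv_closed[OF H that] by simp
  qed
  have id_aut: "id \<in> tree_aut" by (simp add: tree_aut_def)
  have id_root: "root_perm (section_at id v) = (id :: 'd \<Rightarrow> 'd)" for v
    by (auto simp: root_perm_def section_at_def)
  show ?thesis
  proof (rule groupI)
    fix x y assume "x \<in> carrier (W_group H)" "y \<in> carrier (W_group H)"
    then show "x \<otimes>\<^bsub>W_group H\<^esub> y \<in> carrier (W_group H)"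
      by (auto simp: W_group_def W_set_def tree_aut_comp root_perm_section_comp intro: comp)
  next
    fix x assume "x \<in> carrier (W_group H)"
    then have x: "x \<in> tree_aut" "\<And>v. root_perm (section_at x v) \<in> H"
      by (auto simp: W_group_def W_set_def)
    let ?y = "inv_into UNIV x"
    have y: "?y \<in> tree_aut" using tree_aut_inv[OF x(1)] .
    have xy: "x \<circ> ?y = id" and yx: "?y \<circ> x = id"
      using x(1) by (auto simp: tree_aut_def bij_is_surj bij_is_inj surj_f_inv_f)
    have "root_perm (section_at ?y v) \<in> H" for v
    proof -
      let ?p = "root_perm (section_at x (?y v))" and ?q = "root_perm (section_at ?y v)"
      have "?p \<circ> ?q = id"
        using root_perm_section_comp[OF y x(1), of v] by (simp add: xy id_root)
      then have "?q = inv_into UNIV ?p"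
        using Hbij[OF x(2), of "?y v"]
        by (metis bij_is_inj comp_assoc comp_id fun.map_id0 id_comp inv_o_cancel)
      then show ?thesis using hinv[OF x(2)] by simp
    qed
    then show "\<exists>y\<in>carrier (W_group H). y \<otimes>\<^bsub>W_group H\<^esub> x = \<one>\<^bsub>W_group H\<^esub>"
      using y xy by (intro bexI[of _ ?y]) (auto simp: W_group_def W_set_def)
  qed (auto simp: W_group_def W_set_def id_aut id_root one comp_assoc)
qed

end

theory Submission
  imports Defs
begin

text \<open>
  Fix a level \<open>n\<close> on which all short reduced words act without fixed points, and consider the graph
  whose vertices are the pairs (coset of \<open>\<Delta>\<close>, vertex of level \<open>n\<close>) near \<open>{\<Delta>} \<times> Z\<close>; closed paths based
  at \<open>(\<Delta>, v)\<close> represent elements of \<open>\<Delta>\<^sub>v\<close>. Two elements of \<open>\<Delta>\<close> without common powers prevent large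
  vertex sets with small edge boundary. Hence inside a large vertex set with small boundary, minimal
  with this property, one may pick \<open>K\<close> edges with the same label that are far apart and join all
  their end points without passing over them. This gives loops \<open>\<alpha>\<^sub>k = w1\<^sub>k x w2\<^sub>k\<close> at a common \<open>v\<close>
  such that the \<open>k\<close>-th edge is crossed exactly once by \<open>\<alpha>\<^sub>k\<close> and never by the other loops. Given the
  action on level \<open>n\<close>, the sections of the generators at level \<open>n\<close> are independent Haar elements,
  and the section of \<open>\<alpha>\<^sub>k\<close> contains one that occurs nowhere else; therefore the sections of the
  \<open>\<alpha>\<^sub>k\<close> are independent and Haar distributed.

  A suitable level exists almost surely: the vertices fixed by a cyclically reduced word that is
  fixed-point free for its shorter subwords have Haar distributed sections, and a Haar element of
  \<open>W(H)\<close> almost surely has no fixed vertices far down, by the extinction of critical branching processes.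
\<close>

section \<open>Loops through private edges\<close>

text \<open>What has to be private is an edge of level \<open>n\<close>, since the section of a
  generator depends on the vertex of the level and not on the coset. Cutting an edge therefore cuts
  its whole fibre in \<open>VX\<close>, and the difficulty is to show that a large set stays
  connected enough after \<open>K\<close> such cuts. The constants encode this. A fibre has at most
  \<open>P\<close> vertices, so \<open>K\<close> fibres carry at most \<open>B\<close> oriented
  edges. A set with boundary at most \<open>B\<close> has at most \<open>M\<close> or more than
  \<open>Q\<close> vertices, so a minimal one with more than \<open>M\<close> vertices has more than
  \<open>Q\<close>. Walks of length below \<open>r0\<close> along powers of \<open>c\<close> visit
  more than \<open>M\<close> vertices. More than \<open>V\<close> points of \<open>B0\<close>
  suffice to choose \<open>K\<close> edges at mutual distance above \<open>r0\<close> and equally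
  far from the boundary. If the cut separated two ends, one side would have boundary at most
  \<open>B\<close>, hence at most \<open>M\<close> vertices, although it contains such a walk. None
  of the constants depends on the level, so the level can be taken after the word length
  \<open>R\<close> is fixed.\<close>

definition inv_word :: "letter list \<Rightarrow> letter list" where
  "inv_word w = rev (map inv_letter w)"

definition words_upto :: "letter set \<Rightarrow> nat \<Rightarrow> letter list set" where
  "words_upto L n = {w. set w \<subseteq> L \<and> length w \<le> n}"

lemma finite_words_upto: "finite L \<Longrightarrow> finite (words_upto L n)"
  unfolding words_upto_def by (rule finite_lists_length_le)

lemma length_inv_word [simp]: "length (inv_word w) = length w"
  by (simp add: inv_word_def)

lemma inv_word_Nil [simp]: "inv_word [] = []"
  by (simp add: inv_word_def)

lemma inv_word_append [simp]: "inv_word (u @ v) = inv_word v @ inv_word u"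
  by (simp add: inv_word_def)

lemma inv_word_Cons: "inv_word (a # v) = inv_word v @ [inv_letter a]"
  by (simp add: inv_word_def)

lemma inv_word_inv [simp]: "inv_word (inv_word w) = w"
  by (induction w) (auto simp: inv_word_def)

lemma reduced_inv_word: "reduced_word w \<Longrightarrow> reduced_word (inv_word w)"
  unfolding inv_word_def by (rule reduced_rev_inv)

lemma reduced_append_iff:
  "reduced_word (u @ v) \<longleftrightarrow> reduced_word u \<and> reduced_word v \<and>
     (u \<noteq> [] \<longrightarrow> v \<noteq> [] \<longrightarrow> hd v \<noteq> inv_letter (last u))"
  unfolding reduced_word_def by (auto simp: successively_append_iff)

lemma reduced_Cons_iff:
  "reduced_word (a # v) \<longleftrightarrow> reduced_word v \<and> (v \<noteq> [] \<longrightarrow> hd v \<noteq> inv_letter a)"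
  unfolding reduced_word_def by (cases v) auto

lemma reduced_takeI: "reduced_word w \<Longrightarrow> reduced_word (take k w)"
  by (metis append_take_drop_id reduced_append_iff)

section \<open>Right actions of words by invertible letters\<close>

locale letter_action =
  fixes L :: "letter set" and za :: "letter \<Rightarrow> 'z \<Rightarrow> 'z"
  assumes inv_L: "a \<in> L \<Longrightarrow> inv_letter a \<in> L"
    and za_inv: "a \<in> L \<Longrightarrow> za (inv_letter a) (za a z) = z"
begin

lemma za_inv': "a \<in> L \<Longrightarrow> za a (za (inv_letter a) z) = z"
  using za_inv[OF inv_L, of a z] by simp

lemma set_inv_word: "set w \<subseteq> L \<Longrightarrow> set (inv_word w) \<subseteq> L"
  using inv_L by (auto simp: inv_word_def)

lemma fold_inv_word: "set w \<subseteq> L \<Longrightarrow> fold za (inv_word w) (fold za w z) = z"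
  by (induction w arbitrary: z) (auto simp: inv_word_Cons za_inv)

lemma fold_inv_word': "set w \<subseteq> L \<Longrightarrow> fold za w (fold za (inv_word w) z) = z"
  using fold_inv_word[OF set_inv_word, of w z] by simp

lemma inv_word_words: "w \<in> words_upto L n \<Longrightarrow> inv_word w \<in> words_upto L n"
  using set_inv_word by (auto simp: words_upto_def)

lemma fold_eq_iff: "set w \<subseteq> L \<Longrightarrow> fold za w z = fold za w z' \<longleftrightarrow> z = z'"
  by (metis fold_inv_word)

end

text \<open>In the application \<open>'z\<close> consists of pairs (coset of \<open>\<Delta>\<close>, vertex), \<open>pr\<close> is the second projection,
  \<open>B0 = {\<Delta>} \<times> Y\<close> and \<open>Y\<close> is an orbit of \<open>\<Delta>\<close> on a level. The graph is \<open>VX\<close> with an edge \<open>(z, l)\<close> from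
  \<open>z\<close> to \<open>za l z\<close> for every letter \<open>l\<close>.\<close>

locale fibred_action = Z: letter_action L za + Y: letter_action L la
  for L and za :: "letter \<Rightarrow> 'z \<Rightarrow> 'z" and la :: "letter \<Rightarrow> 'y \<Rightarrow> 'y" +
  fixes pr :: "'z \<Rightarrow> 'y" and Y :: "'y set" and B0 :: "'z set" and f c b :: "letter list"
    and K R Q :: nat and P \<rho> B M0 M r0 V :: nat and a :: "letter list"
  assumes a_def: "a = f @ c @ inv_word f"
    and \<rho>_def: "\<rho> = length a + length b"
    and P_def: "P = card (words_upto L \<rho>)"
    and B_def: "B = 2 * K * P"
    and M0_def: "M0 = (length a * B) * (length b * B)"
    and M_def: "M = P * (M0 + \<rho> * B)"
    and r0_def: "r0 = (M + 2) * length c + length f + 2"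
    and V_def: "V = length f * B + (B + K) * card (words_upto L r0)"
    and fin_L: "finite L"
    and pr_za: "l \<in> L \<Longrightarrow> pr (za l z) = la l (pr z)"
    and la_Y: "l \<in> L \<Longrightarrow> y \<in> Y \<Longrightarrow> la l y \<in> Y"
    and girth: "y \<in> Y \<Longrightarrow> reduced_word w \<Longrightarrow> w \<noteq> [] \<Longrightarrow> set w \<subseteq> L \<Longrightarrow> length w \<le> R \<Longrightarrow> fold la w y \<noteq> y"
    and indep: "y \<in> Y \<Longrightarrow> i \<le> Q \<Longrightarrow> j \<le> Q \<Longrightarrow> i \<noteq> 0 \<or> j \<noteq> 0 \<Longrightarrow>
      (fold la a ^^ i) y \<noteq> (fold la b ^^ j) y \<and> (fold la b ^^ j) ((fold la a ^^ i) y) \<noteq> y"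
    and B0: "finite B0" "B0 \<noteq> {}" "inj_on pr B0" "pr ` B0 \<subseteq> Y"
    and B0_a: "fold za a ` B0 \<subseteq> B0" and B0_b: "fold za b ` B0 \<subseteq> B0"
    and letters: "set f \<subseteq> L" "set c \<subseteq> L" "set b \<subseteq> L"
    and c: "c \<noteq> []" "reduced_word (c @ c)" "reduced_word (f @ c)"
    and Q: "M + P * (V + \<rho> * B) \<le> Q" and R: "r0 + 2 \<le> R"
begin

text \<open>The neighbourhood of \<open>B0\<close> of radius \<open>\<rho>\<close>, large enough
  that walks along \<open>a\<close> and along \<open>b\<close> from \<open>B0\<close> do not leave
  it.\<close>

definition VX :: "'z set" where
  "VX = {fold za p z | p z. p \<in> words_upto L \<rho> \<and> z \<in> B0}"

text \<open>Oriented boundary edges relative to \<open>VX\<close>: edges that leave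
  \<open>VX\<close> do not count, so \<open>VX\<close> itself has empty boundary.\<close>

definition bd :: "'z set \<Rightarrow> ('z \<times> letter) set" where
  "bd A = {(z, l). l \<in> L \<and> z \<in> A \<and> za l z \<in> VX - A}"

definition inX :: "letter list \<Rightarrow> 'z \<Rightarrow> bool" where
  "inX w z \<longleftrightarrow> (\<forall>k\<le>length w. fold za (take k w) z \<in> VX)"

lemma set_a: "set a \<subseteq> L"
  using letters Z.set_inv_word[of f] by (auto simp: a_def)

lemma pr_fold: "set w \<subseteq> L \<Longrightarrow> pr (fold za w z) = fold la w (pr z)"
  by (induction w arbitrary: z) (auto simp: pr_za)

lemma fold_Y: "set w \<subseteq> L \<Longrightarrow> y \<in> Y \<Longrightarrow> fold la w y \<in> Y"
  by (induction w arbitrary: y) (auto simp: la_Y)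

lemma finite_X: "finite VX"
proof -
  have "VX = (\<lambda>(p, z). fold za p z) ` (words_upto L \<rho> \<times> B0)" by (auto simp: VX_def)
  then show ?thesis using B0(1) finite_words_upto[OF fin_L] by simp
qed

lemma pr_X: "z \<in> VX \<Longrightarrow> pr z \<in> Y"
  using B0(4) by (auto simp: VX_def pr_fold words_upto_def intro!: fold_Y)

lemma B0_X: "B0 \<subseteq> VX"
proof
  fix z assume "z \<in> B0"
  then have "fold za [] z \<in> VX" unfolding VX_def words_upto_def by fastforce
  then show "z \<in> VX" by simp
qed

lemma X_wordI: "z \<in> B0 \<Longrightarrow> set p \<subseteq> L \<Longrightarrow> length p \<le> \<rho> \<Longrightarrow> fold za p z \<in> VX"
  unfolding VX_def words_upto_def by blast

lemma inX_base: "z \<in> B0 \<Longrightarrow> set p \<subseteq> L \<Longrightarrow> length p \<le> \<rho> \<Longrightarrow> inX p z"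
  unfolding inX_def by (auto intro!: X_wordI dest: in_set_takeD)

text \<open>The reversed walk passes through the end points of the prefixes of \<open>p\<close>, and
  all of these lie in \<open>VX\<close>.\<close>

lemma inX_reverse:
  assumes "z \<in> B0" "set p \<subseteq> L" "length p \<le> \<rho>"
  shows "inX (inv_word p) (fold za p z)"
  unfolding inX_def
proof (intro allI impI)
  fix k assume k: "k \<le> length (inv_word p)"
  define q where "q = drop (length p - k) p"
  have p: "p = take (length p - k) p @ q" by (simp add: q_def)
  have "inv_word p = inv_word q @ inv_word (take (length p - k) p)"
    using arg_cong[OF p, of inv_word] by (simp only: inv_word_append)
  moreover have "length (inv_word q) = k" using k by (simp add: q_def)
  ultimately have t: "take k (inv_word p) = inv_word q" by simp
  have "set q \<subseteq> L" using assms(2) by (auto simp: q_def dest: in_set_dropD)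
  moreover have "fold za p z = fold za q (fold za (take (length p - k) p) z)"
    using arg_cong[OF p, of "\<lambda>p. fold za p z"] by (simp only: fold_append comp_apply)
  ultimately have "fold za (take k (inv_word p)) (fold za p z) = fold za (take (length p - k) p) z"
    by (simp only: t Z.fold_inv_word)
  moreover have "fold za (take (length p - k) p) z \<in> VX"
    using assms by (intro X_wordI) (auto dest: in_set_takeD)
  ultimately show "fold za (take k (inv_word p)) (fold za p z) \<in> VX" by simp
qed

section \<open>Sets with few boundary edges\<close>

lemma finite_bd: "A \<subseteq> VX \<Longrightarrow> finite (bd A)"
  by (rule finite_subset[of _ "VX \<times> L"]) (auto simp: bd_def finite_X fin_L)

text \<open>A walk that ends outside \<open>A\<close> has a first step out of \<open>A\<close>. The
  position of this step in \<open>w\<close> and the boundary edge it uses determine the starting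
  point.\<close>

lemma walk_exit:
  assumes A: "A \<subseteq> VX" and w: "set w \<subseteq> L"
  shows "card {z \<in> A. inX w z \<and> fold za w z \<notin> A} \<le> length w * card (bd A)"
proof -
  let ?E = "{z \<in> A. inX w z \<and> fold za w z \<notin> A}"
  let ?g = "\<lambda>k d. fold za (inv_word (take k w)) (fst d)"
  have sub: "?E \<subseteq> (\<Union>k<length w. ?g k ` bd A)"
  proof
    fix z assume z: "z \<in> ?E"
    define j where "j = (LEAST j. fold za (take j w) z \<notin> A)"
    have ex: "fold za (take (length w) w) z \<notin> A" using z by simp
    have j: "fold za (take j w) z \<notin> A" unfolding j_def by (rule LeastI[of _ "length w"]) (use ex in simp)
    have jl: "j \<le> length w" unfolding j_def by (rule Least_le) (use ex in simp)
    have "j \<noteq> 0" using j z by (auto intro: gr0I)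
    then obtain k where k: "j = Suc k" by (cases j) auto
    have kA: "fold za (take k w) z \<in> A"
      using not_less_Least[of k "\<lambda>j. fold za (take j w) z \<notin> A"] k by (auto simp: j_def)
    have kl: "k < length w" using jl k by simp
    have "fold za (take j w) z = za (w ! k) (fold za (take k w) z)"
      using kl k by (simp add: take_Suc_conv_app_nth)
    moreover have "fold za (take j w) z \<in> VX" using z jl by (auto simp: inX_def)
    moreover have "w ! k \<in> L" using w kl by auto
    ultimately have d: "(fold za (take k w) z, w ! k) \<in> bd A"
      using j kA by (auto simp: bd_def)
    have "set (take k w) \<subseteq> L" using w by (auto dest: in_set_takeD)
    then have "z = ?g k (fold za (take k w) z, w ! k)" by (simp add: Z.fold_inv_word)
    then show "z \<in> (\<Union>k<length w. ?g k ` bd A)" using d kl by blast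
  qed
  have "card ?E \<le> card (\<Union>k<length w. ?g k ` bd A)"
    by (rule card_mono[OF _ sub]) (auto intro: finite_bd[OF A])
  also have "\<dots> \<le> (\<Sum>k<length w. card (?g k ` bd A))" by (rule card_UN_le) simp
  also have "\<dots> \<le> (\<Sum>k<length w. card (bd A))"
    by (rule sum_mono) (rule card_image_le[OF finite_bd[OF A]])
  finally show ?thesis by simp
qed

text \<open>Every vertex is led back to \<open>B0\<close> inside \<open>VX\<close> by the inverse of
  one of \<open>P\<close> words. For each word the walk ends in \<open>A \<inter> B0\<close>, and
  then its end determines the vertex, or it ends outside \<open>A\<close>, and then
  \<open>walk_exit\<close> counts the vertex.\<close>

lemma card_le_base:
  assumes A: "A \<subseteq> VX" and "card (bd A) \<le> B"
  shows "card A \<le> P * (card (A \<inter> B0) + \<rho> * B)"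
proof -
  let ?W = "words_upto L \<rho>"
  let ?G = "\<lambda>p. fold za p ` (A \<inter> B0) \<union> {z \<in> A. inX (inv_word p) z \<and> fold za (inv_word p) z \<notin> A}"
  have finA: "finite A" using A finite_X finite_subset by blast
  have sub: "A \<subseteq> (\<Union>p\<in>?W. ?G p)"
  proof
    fix z assume z: "z \<in> A"
    then obtain p z0 where p: "p \<in> ?W" "z0 \<in> B0" "z = fold za p z0" using A by (auto simp: VX_def)
    then have pl: "set p \<subseteq> L" "length p \<le> \<rho>" by (auto simp: words_upto_def)
    have "fold za (inv_word p) z = z0" using p pl by (simp add: Z.fold_inv_word)
    moreover have "inX (inv_word p) z" using inX_reverse[OF p(2) pl] p(3) by simp
    ultimately have "z \<in> ?G p" using p z by auto
    then show "z \<in> (\<Union>p\<in>?W. ?G p)" using p by blast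
  qed
  have "card A \<le> card (\<Union>p\<in>?W. ?G p)"
    by (rule card_mono[OF _ sub]) (use finA finite_words_upto[OF fin_L] in auto)
  also have "\<dots> \<le> (\<Sum>p\<in>?W. card (?G p))" by (rule card_UN_le[OF finite_words_upto[OF fin_L]])
  also have "\<dots> \<le> (\<Sum>p\<in>?W. card (A \<inter> B0) + \<rho> * B)"
  proof (rule sum_mono)
    fix p assume "p \<in> ?W"
    then have p: "set (inv_word p) \<subseteq> L" "length p \<le> \<rho>"
      using Z.set_inv_word by (auto simp: words_upto_def)
    have "card {z \<in> A. inX (inv_word p) z \<and> fold za (inv_word p) z \<notin> A} \<le> length p * card (bd A)"
      using walk_exit[OF A p(1)] by simp
    also have "\<dots> \<le> \<rho> * B" using p assms(2) by (intro mult_le_mono)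
    finally have 2: "card {z \<in> A. inX (inv_word p) z \<and> fold za (inv_word p) z \<notin> A} \<le> \<rho> * B" .
    have "card (?G p) \<le> card (fold za p ` (A \<inter> B0)) +
        card {z \<in> A. inX (inv_word p) z \<and> fold za (inv_word p) z \<notin> A}" by (rule card_Un_le)
    also have "\<dots> \<le> card (A \<inter> B0) + \<rho> * B"
      using 2 by (intro add_mono card_image_le) (use finA in auto)
    finally show "card (?G p) \<le> card (A \<inter> B0) + \<rho> * B" .
  qed
  finally show ?thesis by (simp add: P_def)
qed

lemma B0_pow_a: "z \<in> B0 \<Longrightarrow> (fold za a ^^ i) z \<in> B0"
  using B0_a by (induction i) auto

lemma B0_pow_b: "z \<in> B0 \<Longrightarrow> (fold za b ^^ i) z \<in> B0"
  using B0_b by (induction i) auto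

lemma pr_pow: "set w \<subseteq> L \<Longrightarrow> pr ((fold za w ^^ i) z) = (fold la w ^^ i) (pr z)"
  by (induction i) (auto simp: pr_fold)

lemma pow_inj: "set w \<subseteq> L \<Longrightarrow> (fold za w ^^ i) z = (fold za w ^^ i) z' \<Longrightarrow> z = z'"
  by (induction i) (auto simp: Z.fold_eq_iff)

lemma pow_diff:
  assumes "set w \<subseteq> L" "(fold za w ^^ i) z = (fold za w ^^ j) z'" "j \<le> i"
  shows "z' = (fold za w ^^ (i - j)) z"
proof -
  have "(fold za w ^^ j) ((fold za w ^^ (i - j)) z) = (fold za w ^^ j) z'"
    using assms(2,3) funpow_add[of j "i - j" "fold za w"] by simp
  then show ?thesis using pow_inj[OF assms(1)] by metis
qed

text \<open>By \<open>indep\<close> with one exponent equal to 0, the \<open>Q + 1\<close> points of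
  the orbit are distinct, so they do not all fit into \<open>A\<close>. The point before the first
  exit is still in \<open>B0\<close>, because \<open>B0\<close> is invariant.\<close>

lemma exit_exists:
  assumes A: "A \<subseteq> VX" "card A \<le> Q" and w: "w = a \<or> w = b" and z: "z \<in> A \<inter> B0"
  obtains i where "i < Q" "(fold za w ^^ i) z \<in> A \<inter> B0" "(fold za w ^^ Suc i) z \<notin> A"
proof -
  have wL: "set w \<subseteq> L" using w set_a letters(3) by auto
  have inB: "(fold za w ^^ i) z \<in> B0" for i using w z B0_pow_a B0_pow_b by auto
  have inj: "inj_on (\<lambda>i. (fold za w ^^ i) z) {..Q}"
  proof (rule inj_onI)
    have *: "i = j" if "j \<le> i" "i \<le> Q" "(fold za w ^^ i) z = (fold za w ^^ j) z" for i j
    proof (rule ccontr)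
      assume "i \<noteq> j"
      then have ij: "i - j \<noteq> 0" "i - j \<le> Q" using that by auto
      have "z = (fold za w ^^ (i - j)) z" using pow_diff[OF wL that(3,1)] .
      then have "(fold la w ^^ (i - j)) (pr z) = pr z" using pr_pow[OF wL] by metis
      moreover have "pr z \<in> Y" using z A pr_X by auto
      ultimately show False using indep[of "pr z" "i - j" 0] indep[of "pr z" 0 "i - j"] ij w by auto
    qed
    fix i j assume ij: "i \<in> {..Q}" "j \<in> {..Q}" "(fold za w ^^ i) z = (fold za w ^^ j) z"
    show "i = j"
    proof (cases "j \<le> i")
      case True
      then show ?thesis using *[OF _ _ ij(3)] ij by blast
    next
      case False
      then show ?thesis using *[OF _ _ ij(3)[symmetric]] ij by (metis atMost_iff nat_le_linear)
    qed
  qed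
  have finA: "finite A" using A finite_X finite_subset by blast
  have "\<not> (\<lambda>i. (fold za w ^^ i) z) ` {..Q} \<subseteq> A"
  proof
    assume "(\<lambda>i. (fold za w ^^ i) z) ` {..Q} \<subseteq> A"
    then have "card {..Q} \<le> card A" by (rule card_inj_on_le[OF inj _ finA])
    then show False using A(2) by simp
  qed
  then obtain k where k: "k \<le> Q" "(fold za w ^^ k) z \<notin> A" by auto
  define j where "j = (LEAST j. (fold za w ^^ j) z \<notin> A)"
  have j: "(fold za w ^^ j) z \<notin> A" unfolding j_def by (rule LeastI[of _ k]) (rule k)
  have jk: "j \<le> k" unfolding j_def by (rule Least_le) (rule k)
  have "j \<noteq> 0" using j z by (auto intro: gr0I)
  then obtain i where i: "j = Suc i" by (cases j) auto
  have "(fold za w ^^ i) z \<in> A"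
    using not_less_Least[of i "\<lambda>j. (fold za w ^^ j) z \<notin> A"] i by (auto simp: j_def)
  then show thesis using that[of i] i j jk k inB by auto
qed

lemma card_exits:
  assumes A: "A \<subseteq> VX" "card (bd A) \<le> B" and w: "w = a \<or> w = b"
  shows "card {z \<in> A \<inter> B0. fold za w z \<notin> A} \<le> length w * B"
proof -
  have wL: "set w \<subseteq> L" "length w \<le> \<rho>" using w set_a letters(3) by (auto simp: \<rho>_def)
  have finA: "finite A" using A finite_X finite_subset by blast
  have "card {z \<in> A \<inter> B0. fold za w z \<notin> A} \<le> card {z \<in> A. inX w z \<and> fold za w z \<notin> A}"
    using inX_base[OF _ wL] by (intro card_mono) (auto simp: finA)
  also have "\<dots> \<le> length w * card (bd A)" by (rule walk_exit[OF A(1) wL(1)])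
  also have "\<dots> \<le> length w * B" using A(2) by simp
  finally show ?thesis .
qed

text \<open>A set with few boundary edges is a union of few \<open>a\<close>-arcs and of few \<open>b\<close>-arcs; since \<open>a\<close> and
  \<open>b\<close> have no common powers, an \<open>a\<close>-arc and a \<open>b\<close>-arc meet in at most one point.\<close>

lemma card_small:
  assumes A: "A \<subseteq> VX" "card A \<le> Q" "card (bd A) \<le> B"
  shows "card A \<le> M"
proof -
  let ?D = "A \<inter> B0"
  let ?Ea = "{z \<in> ?D. fold za a z \<notin> A}" and ?Eb = "{z \<in> ?D. fold za b z \<notin> A}"
  have "\<forall>z. \<exists>i. z \<in> ?D \<longrightarrow> i < Q \<and> (fold za a ^^ i) z \<in> ?D \<and> (fold za a ^^ Suc i) z \<notin> A"
    using exit_exists[OF A(1,2), of a] by (metis (no_types, lifting))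
  then obtain ia where ia: "\<And>z. z \<in> ?D \<Longrightarrow> ia z < Q \<and> (fold za a ^^ ia z) z \<in> ?D \<and> (fold za a ^^ Suc (ia z)) z \<notin> A"
    by metis
  have "\<forall>z. \<exists>i. z \<in> ?D \<longrightarrow> i < Q \<and> (fold za b ^^ i) z \<in> ?D \<and> (fold za b ^^ Suc i) z \<notin> A"
    using exit_exists[OF A(1,2), of b] by (metis (no_types, lifting))
  then obtain ib where ib: "\<And>z. z \<in> ?D \<Longrightarrow> ib z < Q \<and> (fold za b ^^ ib z) z \<in> ?D \<and> (fold za b ^^ Suc (ib z)) z \<notin> A"
    by metis
  \<comment> \<open>A point is sent to an exit point on its forward \<open>a\<close>-orbit and to
    one on its forward \<open>b\<close>-orbit; there are at most \<open>M0\<close> such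
    pairs.\<close>
  let ?g = "\<lambda>z. ((fold za a ^^ ia z) z, (fold za b ^^ ib z) z)"
  have finA: "finite A" using A finite_X finite_subset by blast
  have inj: "inj_on ?g ?D"
  proof (rule inj_onI)
    \<comment> \<open>Points with equal exit points differ by a power of \<open>a\<close> and by a
      power of \<open>b\<close>. The two inequalities of \<open>indep\<close> rule this out, one
      when both powers lead from \<open>z\<close> to \<open>z'\<close>, the other when the power of
      \<open>b\<close> leads back.\<close>
    have *: "z = z'" if z: "z \<in> ?D" "z' \<in> ?D" and e: "?g z = ?g z'" and le: "ia z' \<le> ia z" for z z'
    proof (rule ccontr)
      assume ne: "z \<noteq> z'"
      have y: "pr z \<in> Y" using z A pr_X by auto
      have lt: "ia z < Q" "ib z < Q" "ia z' < Q" "ib z' < Q" using ia ib z by auto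
      define i where "i = ia z - ia z'"
      have 1: "z' = (fold za a ^^ i) z" unfolding i_def using pow_diff[OF set_a _ le] e by simp
      have i0: "i \<noteq> 0" using 1 ne by (cases i) auto
      have iQ: "i \<le> Q" using lt by (simp add: i_def)
      show False
      proof (cases "ib z' \<le> ib z")
        case True
        then have "z' = (fold za b ^^ (ib z - ib z')) z" using pow_diff[OF letters(3) _ True] e by simp
        then have "(fold la a ^^ i) (pr z) = (fold la b ^^ (ib z - ib z')) (pr z)"
          using 1 pr_pow[OF set_a] pr_pow[OF letters(3)] by metis
        then show False using indep[OF y iQ, of "ib z - ib z'"] i0 lt by auto
      next
        case False
        then have "z = (fold za b ^^ (ib z' - ib z)) z'" using pow_diff[OF letters(3), of "ib z'" z' "ib z" z] e by simp
        then have "(fold la b ^^ (ib z' - ib z)) ((fold la a ^^ i) (pr z)) = pr z"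
          using 1 pr_pow[OF set_a] pr_pow[OF letters(3)] by metis
        then show False using indep[OF y iQ, of "ib z' - ib z"] i0 lt by auto
      qed
    qed
    fix z z' assume "z \<in> ?D" "z' \<in> ?D" "?g z = ?g z'"
    then show "z = z'" using *[of z z'] *[of z' z] by (cases "ia z' \<le> ia z") auto
  qed
  have "?g ` ?D \<subseteq> ?Ea \<times> ?Eb" using ia ib by auto
  then have "card ?D \<le> card (?Ea \<times> ?Eb)"
    by (rule card_inj_on_le[OF inj]) (use finA in auto)
  also have "\<dots> \<le> M0"
    unfolding card_cartesian_product M0_def
    using card_exits[OF A(1,3), of a] card_exits[OF A(1,3), of b] by (intro mult_le_mono) auto
  finally have "P * (card ?D + \<rho> * B) \<le> M" unfolding M_def by simp
  then show ?thesis using card_le_base[OF A(1,3)] by linarith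
qed

text \<open>Powers of \<open>a\<close> never lead from \<open>B0\<close> out of \<open>VX\<close>,
  whereas by \<open>exit_exists\<close> they do lead out of any set of at most \<open>Q\<close>
  vertices that meets \<open>B0\<close>.\<close>

lemma card_X: "Q < card VX"
proof (rule ccontr)
  assume "\<not> Q < card VX"
  then have le: "card VX \<le> Q" by (simp only: not_less)
  obtain z where z: "z \<in> B0" using B0(2) by (meson ex_in_conv)
  have zX: "z \<in> VX \<inter> B0" using z B0_X by (meson IntI subsetD)
  show False
  proof (rule exit_exists[OF subset_refl le _ zX])
    show "a = a \<or> a = b" by (rule disjI1) (rule refl)
  next
    fix i assume "(fold za a ^^ Suc i) z \<notin> VX"
    then show False using B0_pow_a[OF z, of "Suc i"] B0_X by (meson subsetD)
  qed
qed

text \<open>\<open>VX\<close> is a candidate because its boundary is empty. The minimum is taken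
  over sets with more than \<open>M\<close> vertices, and \<open>card_small\<close> raises this
  bound to \<open>Q\<close>.\<close>

lemma obtain_minimal:
  obtains A where "A \<subseteq> VX" "card (bd A) \<le> B" "Q < card A"
    "\<And>A'. A' \<subset> A \<Longrightarrow> card (bd A') \<le> B \<Longrightarrow> card A' \<le> M"
proof -
  let ?P = "\<lambda>A. A \<subseteq> VX \<and> card (bd A) \<le> B \<and> M < card A"
  have "bd VX = {}" by (simp add: bd_def)
  then have "card (bd VX) \<le> B" by simp
  moreover have "M < card VX" using card_X Q by linarith
  ultimately have PX: "?P VX" by blast
  obtain A where A: "?P A" "\<And>A'. ?P A' \<Longrightarrow> card A \<le> card A'"
    using ex_has_least_nat[of ?P VX card, OF PX] by (elim exE conjE) blast
  have "Q < card A" using card_small[of A] A(1) by force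
  moreover have "card A' \<le> M" if "A' \<subset> A" "card (bd A') \<le> B" for A'
  proof (rule ccontr)
    assume "\<not> card A' \<le> M"
    then have "card A \<le> card A'" using A that by auto
    moreover have "card A' < card A"
      using that A(1) finite_X by (meson finite_subset psubset_card_mono)
    ultimately show False by simp
  qed
  ultimately show thesis using that A(1) by blast
qed

text \<open>Once one of the \<open>P\<close> words is given, the starting point in \<open>B0\<close>
  is determined by its projection, as \<open>pr\<close> is injective on \<open>B0\<close>.\<close>

lemma card_fibre: "card {z \<in> VX. pr z = y} \<le> P"
proof -
  have "{z \<in> VX. pr z = y} \<subseteq> (\<lambda>p. fold za p (inv_into B0 pr (fold la (inv_word p) y))) ` words_upto L \<rho>"
  proof
    fix z assume z: "z \<in> {z \<in> VX. pr z = y}"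
    then obtain p z0 where p: "p \<in> words_upto L \<rho>" "z0 \<in> B0" "z = fold za p z0" by (auto simp: VX_def)
    have pl: "set p \<subseteq> L" using p by (auto simp: words_upto_def)
    have "fold la (inv_word p) y = pr z0" using z p pl by (auto simp: pr_fold Y.fold_inv_word)
    then have "inv_into B0 pr (fold la (inv_word p) y) = z0" using p B0(3) by simp
    then show "z \<in> (\<lambda>p. fold za p (inv_into B0 pr (fold la (inv_word p) y))) ` words_upto L \<rho>" using p by blast
  qed
  then have "card {z \<in> VX. pr z = y} \<le> card ((\<lambda>p. fold za p (inv_into B0 pr (fold la (inv_word p) y))) ` words_upto L \<rho>)"
    by (rule card_mono[rotated]) (simp add: finite_words_upto[OF fin_L])
  also have "\<dots> \<le> P" unfolding P_def by (rule card_image_le[OF finite_words_upto[OF fin_L]])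
  finally show ?thesis .
qed

end

text \<open>The walk from \<open>u\<close> along \<open>w\<close> does not cross the edge from \<open>y\<close> to \<open>la x y\<close> in either direction.\<close>

fun avoids :: "(letter \<Rightarrow> 'y \<Rightarrow> 'y) \<Rightarrow> letter \<Rightarrow> 'y \<Rightarrow> letter list \<Rightarrow> 'y \<Rightarrow> bool" where
  "avoids la x y [] u \<longleftrightarrow> True"
| "avoids la x y (l # w) u \<longleftrightarrow>
     \<not> (l = x \<and> u = y) \<and> \<not> (l = inv_letter x \<and> la l u = y) \<and> avoids la x y w (la l u)"

section \<open>Powers of words and a greedy selection\<close>

definition word_pow :: "nat \<Rightarrow> letter list \<Rightarrow> letter list" where
  "word_pow n w = concat (replicate n w)"

lemma word_pow_0 [simp]: "word_pow 0 w = []"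
  and word_pow_Suc: "word_pow (Suc n) w = w @ word_pow n w"
  by (simp_all add: word_pow_def)

lemma word_pow_Suc': "word_pow (Suc n) w = word_pow n w @ w"
  by (induction n) (simp_all add: word_pow_Suc)

lemma length_word_pow [simp]: "length (word_pow n w) = n * length w"
  by (induction n) (simp_all add: word_pow_Suc)

lemma set_word_pow: "set (word_pow n w) \<subseteq> set w"
  by (induction n) (simp_all add: word_pow_Suc)

lemma fold_word_pow: "fold g (word_pow n w) z = (fold g w ^^ n) z"
  by (induction n arbitrary: z) (simp_all add: word_pow_Suc funpow_swap1)

lemma inv_word_pow: "inv_word (word_pow n w) = word_pow n (inv_word w)"
proof (induction n)
  case (Suc n)
  then show ?case by (subst word_pow_Suc, subst word_pow_Suc') simp
qed simp

lemma reduced_word_pow: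
  assumes "reduced_word (w @ w)"
  shows "reduced_word (word_pow n w)"
proof (cases "w = []")
  case True
  then have "word_pow n w = []" using set_word_pow[of n w] by simp
  then show ?thesis by simp
next
  case False
  show ?thesis
  proof (induction n)
    case (Suc n)
    then show ?case using assms False
      by (cases n) (auto simp: word_pow_Suc reduced_append_iff)
  qed simp
qed

text \<open>Greedy choice: each point already chosen rules out at most \<open>n\<close> points of
  \<open>S\<close>.\<close>

lemma choose_separated:
  assumes fin: "finite S" and n: "\<And>y. y \<in> S \<Longrightarrow> card {y' \<in> S. near y y'} \<le> n"
    and sym: "\<And>y y'. near y y' \<Longrightarrow> near y' y" and "K * n < card S"
  shows "\<exists>ys :: nat \<Rightarrow> 'a. (\<forall>k<K. ys k \<in> S) \<and> (\<forall>j<K. \<forall>k<K. j \<noteq> k \<longrightarrow> \<not> near (ys j) (ys k))"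
  using assms(4)
proof (induction K)
  case (Suc K)
  then have "K * n < card S" by simp
  with Suc.IH obtain ys where ys: "\<forall>k<K. ys k \<in> S"
    "\<forall>j<K. \<forall>k<K. j \<noteq> k \<longrightarrow> \<not> near (ys j) (ys k)" by blast
  let ?U = "\<Union>k<K. {y' \<in> S. near (ys k) y'}"
  have "card ?U \<le> (\<Sum>k<K. card {y' \<in> S. near (ys k) y'})" by (rule card_UN_le) simp
  also have "\<dots> \<le> (\<Sum>k<K. n)" by (rule sum_mono) (use n ys in auto)
  also have "\<dots> < card S" using \<open>K * n < card S\<close> by simp
  finally have "card ?U < card S" .
  then have "\<not> S \<subseteq> ?U" using card_mono[of ?U S] fin by (metis (no_types, lifting) finite_UN_I
    finite_lessThan finite_subset linorder_not_less mem_Collect_eq subsetI)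
  then obtain y where y: "y \<in> S" "y \<notin> ?U" by blast
  define ys' where "ys' = ys(K := y)"
  have 1: "\<forall>k<Suc K. ys' k \<in> S" using ys y by (auto simp: ys'_def less_Suc_eq)
  have nn: "\<not> near (ys k) y \<and> \<not> near y (ys k)" if "k < K" for k
    using y that sym[of y "ys k"] by blast
  have 2: "\<forall>j<Suc K. \<forall>k<Suc K. j \<noteq> k \<longrightarrow> \<not> near (ys' j) (ys' k)"
    using ys(2) nn by (auto simp: ys'_def less_Suc_eq)
  show ?case using 1 2 by blast
qed simp

section \<open>Walks along powers of the cyclically reduced core\<close>

context fibred_action
begin

lemma inX_append: "inX (u @ v) z \<longleftrightarrow> inX u z \<and> inX v (fold za u z)"
proof
  assume h: "inX (u @ v) z"
  have 1: "fold za (take k u) z \<in> VX" if "k \<le> length u" for k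
    using h[unfolded inX_def, rule_format, of k] that by simp
  have 2: "fold za (take k v) (fold za u z) \<in> VX" if "k \<le> length v" for k
    using h[unfolded inX_def, rule_format, of "length u + k"] that by simp
  show "inX u z \<and> inX v (fold za u z)" unfolding inX_def using 1 2 by blast
next
  assume h: "inX u z \<and> inX v (fold za u z)"
  show "inX (u @ v) z"
    unfolding inX_def
  proof (intro allI impI)
    fix k assume k: "k \<le> length (u @ v)"
    show "fold za (take k (u @ v)) z \<in> VX"
    proof (cases "k \<le> length u")
      case True
      then show ?thesis using h by (simp add: inX_def)
    next
      case False
      then show ?thesis using h[THEN conjunct2, unfolded inX_def, rule_format, of "k - length u"] k
        by simp
    qed
  qed
qed

text \<open>On \<open>Bf\<close> the word \<open>c\<close> acts as \<open>a\<close> does on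
  \<open>B0\<close>. Powers of \<open>c\<close> are reduced, which those of \<open>a\<close> are not
  in general, so \<open>girth\<close> applies directly to walks along them.\<close>

definition Bf :: "'z set" where "Bf = fold za f ` B0"

lemma fold_a: "fold za f (fold za a z) = fold za c (fold za f z)"
  by (simp add: a_def Z.fold_inv_word'[OF letters(1)])

lemma Bf_c:
  assumes "z \<in> Bf"
  shows "inX c z" "fold za c z \<in> Bf"
proof -
  obtain u where u: "u \<in> B0" "z = fold za f u" using assms by (auto simp: Bf_def)
  have "inX (f @ c) u" by (rule inX_base[OF u(1)]) (use letters in \<open>auto simp: \<rho>_def a_def\<close>)
  then show "inX c z" using u by (simp add: inX_append)
  have "fold za c z = fold za f (fold za a u)" using u fold_a by simp
  moreover have "fold za a u \<in> B0" using B0_a u by blast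
  ultimately show "fold za c z \<in> Bf" by (auto simp: Bf_def)
qed

text \<open>An injective map of a finite set into itself is onto, so every point of
  \<open>Bf\<close> is reached by \<open>c\<close> from a point of \<open>Bf\<close>.\<close>

lemma Bf_inv_c:
  assumes "z \<in> Bf"
  shows "inX (inv_word c) z" "fold za (inv_word c) z \<in> Bf"
proof -
  have finB: "finite Bf" using B0(1) by (simp add: Bf_def)
  have "fold za c ` Bf = Bf"
    by (rule endo_inj_surj[OF finB]) (use Bf_c in \<open>auto intro!: inj_onI simp: Z.fold_eq_iff[OF letters(2)]\<close>)
  then obtain z' where z': "z' \<in> Bf" "z = fold za c z'" using assms by blast
  then obtain u where u: "u \<in> B0" "z' = fold za f u" by (auto simp: Bf_def)
  have "inX (inv_word (f @ c)) (fold za (f @ c) u)"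
    by (rule inX_reverse[OF u(1)]) (use letters in \<open>auto simp: \<rho>_def a_def\<close>)
  then show "inX (inv_word c) z" using u z' by (simp add: inX_append)
  show "fold za (inv_word c) z \<in> Bf" using z' by (simp add: Z.fold_inv_word[OF letters(2)])
qed

lemma Bf_pow_c: "z \<in> Bf \<Longrightarrow> inX (word_pow n c) z \<and> fold za (word_pow n c) z \<in> Bf"
proof (induction n arbitrary: z)
  \<comment> \<open>Even the empty walk requires its starting point to lie in
    \<open>VX\<close>.\<close>
  case 0
  then obtain u where "u \<in> B0" "z = fold za f u" by (auto simp: Bf_def)
  then have "inX f u" by (intro inX_base) (use letters in \<open>auto simp: \<rho>_def a_def\<close>)
  then have "z \<in> VX" using \<open>z = fold za f u\<close> unfolding inX_def by (metis order.refl take_all)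
  then show ?case using 0 by (simp add: inX_def)
next
  case (Suc n)
  then show ?case using Bf_c by (simp add: word_pow_Suc inX_append)
qed

lemma Bf_pow_inv_c: "z \<in> Bf \<Longrightarrow> inX (word_pow n (inv_word c)) z \<and> fold za (word_pow n (inv_word c)) z \<in> Bf"
proof (induction n arbitrary: z)
  case 0
  then show ?case using Bf_pow_c[of z 0] by simp
next
  case (Suc n)
  then show ?case using Bf_inv_c by (simp add: word_pow_Suc inX_append)
qed

lemma Bf_inv_f: "z \<in> Bf \<Longrightarrow> inX (inv_word f) z \<and> fold za (inv_word f) z \<in> B0"
  unfolding Bf_def using inX_reverse[of _ f] letters(1)
  by (auto simp: \<rho>_def a_def Z.fold_inv_word)

text \<open>A coincidence would close up a power of \<open>w\<close>, a non-empty reduced word of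
  length at most \<open>(M + 1) * length c\<close>, against \<open>girth\<close>. It is used for
  \<open>c\<close> and for its inverse.\<close>

lemma pow_distinct:
  assumes z: "z \<in> VX" and w: "reduced_word (w @ w)" "w \<noteq> []" "set w \<subseteq> L" "length w = length c"
  shows "inj_on (\<lambda>i. fold za (word_pow i w) z) {..M + 1}"
proof (rule inj_onI)
  have *: "i = j" if ij: "j \<le> i" "i \<le> M + 1" and e: "fold za (word_pow i w) z = fold za (word_pow j w) z" for i j
  proof (rule ccontr)
    assume "i \<noteq> j"
    then have d: "0 < i - j" "i - j \<le> M + 1" using ij by auto
    have "z = (fold za w ^^ (i - j)) z" using pow_diff[OF w(3) e[unfolded fold_word_pow] ij(1)] .
    then have "pr z = pr (fold za (word_pow (i - j) w) z)" by (simp add: fold_word_pow)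
    moreover have wL: "set (word_pow (i - j) w) \<subseteq> L" using set_word_pow w(3) by blast
    ultimately have "fold la (word_pow (i - j) w) (pr z) = pr z" by (simp add: pr_fold)
    moreover have "word_pow (i - j) w \<noteq> []"
      using d w(2) by (cases "i - j") (auto simp: word_pow_Suc)
    moreover have "length (word_pow (i - j) w) \<le> R"
    proof -
      have "(i - j) * length c \<le> (M + 1) * length c" using d by (intro mult_le_mono) auto
      then show ?thesis using R w(4) by (simp add: r0_def)
    qed
    ultimately show False using girth[OF pr_X[OF z] reduced_word_pow[OF w(1)]] wL by blast
  qed
  fix i j assume "i \<in> {..M + 1}" "j \<in> {..M + 1}" "fold za (word_pow i w) z = fold za (word_pow j w) z"
  then show "i = j" using *[of i j] *[of j i] by (metis atMost_iff nat_le_linear)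
qed

end

text \<open>The chosen edges start at \<open>zs k\<close> and carry the first letter of
  \<open>c\<close>. Distances are measured in \<open>Y\<close> and not upstairs, because an edge
  counts as crossed as soon as its projection is.\<close>

locale fibred_cut = fibred_action +
  fixes A :: "'a set" and zs :: "nat \<Rightarrow> 'a"
  assumes A: "A \<subseteq> VX" "card (bd A) \<le> B" "Q < card A"
    and A_min: "\<And>A'. A' \<subset> A \<Longrightarrow> card (bd A') \<le> B \<Longrightarrow> card A' \<le> M"
    and zs: "\<And>k. k < K \<Longrightarrow> zs k \<in> A \<inter> Bf"
    and far_bd: "\<And>k d w. k < K \<Longrightarrow> d \<in> bd A \<Longrightarrow> w \<in> words_upto L r0 \<Longrightarrow> fold la w (pr (zs k)) \<noteq> pr (fst d)"
    and far: "\<And>j k w. j < K \<Longrightarrow> k < K \<Longrightarrow> j \<noteq> k \<Longrightarrow> w \<in> words_upto L r0 \<Longrightarrow> fold la w (pr (zs j)) \<noteq> pr (zs k)"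
begin

definition x :: letter where "x = hd c"

text \<open>The full preimage in \<open>VX\<close> of the \<open>K\<close> chosen edges of
  \<open>Y\<close>, in both orientations.\<close>

definition S :: "('a \<times> letter) set" where
  "S = {(z, l). l \<in> L \<and> z \<in> VX \<and> za l z \<in> VX \<and>
        (\<exists>k<K. (l = x \<and> pr z = pr (zs k)) \<or> (l = inv_letter x \<and> pr (za l z) = pr (zs k)))}"

definition rel :: "('a \<times> 'a) set" where
  "rel = {(z, za l z) | z l. l \<in> L \<and> z \<in> A \<and> za l z \<in> A \<and> (z, l) \<notin> S}"

lemma x_L: "x \<in> L"
  using letters(2) c(1) by (auto simp: x_def)

lemma finite_A: "finite A"
  using A(1) finite_X finite_subset by blast

lemma S_sym: "(z, l) \<in> S \<Longrightarrow> (za l z, inv_letter l) \<in> S"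
  by (auto simp: S_def Z.za_inv Z.inv_L)

lemma rel_sym: "sym rel"
proof (rule symI)
  fix z z' assume "(z, z') \<in> rel"
  then obtain l where l: "l \<in> L" "z \<in> A" "z' = za l z" "z' \<in> A" "(z, l) \<notin> S"
    by (auto simp: rel_def)
  have "(z', inv_letter l) \<notin> S" using S_sym[of z' "inv_letter l"] l by (auto simp: Z.za_inv)
  moreover have "z = za (inv_letter l) z'" using l by (simp add: Z.za_inv)
  ultimately show "(z', z) \<in> rel" using l Z.inv_L unfolding rel_def by blast
qed

lemma rel_A: "(z, z') \<in> rel\<^sup>* \<Longrightarrow> z \<in> A \<Longrightarrow> z' \<in> A"
  by (induction rule: rtrancl_induct) (auto simp: rel_def)

text \<open>There are \<open>K\<close> fibres of at most \<open>P\<close> vertices, and every vertex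
  of a fibre accounts for the two orientations of one edge. This is the origin of
  \<open>B\<close>.\<close>

lemma card_S: "card S \<le> B" and finite_S: "finite S"
proof -
  let ?F = "\<lambda>k. {z \<in> VX. pr z = pr (zs k)}"
  let ?U = "\<lambda>k. (\<lambda>z. (z, x)) ` ?F k \<union> (\<lambda>z. (za x z, inv_letter x)) ` ?F k"
  have sub: "S \<subseteq> (\<Union>k<K. ?U k)"
  proof
    fix d assume "d \<in> S"
    then obtain z l k where d: "d = (z, l)" "l \<in> L" "z \<in> VX" "za l z \<in> VX" "k < K"
      "(l = x \<and> pr z = pr (zs k)) \<or> (l = inv_letter x \<and> pr (za l z) = pr (zs k))"
      by (auto simp: S_def)
    have "d \<in> ?U k" using d(6)
    proof
      assume "l = inv_letter x \<and> pr (za l z) = pr (zs k)"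
      then have l: "l = inv_letter x" and p: "pr (za l z) = pr (zs k)" by auto
      have "z = za x (za l z)" using Z.za_inv'[OF x_L] l by simp
      then have "d = (za x (za l z), inv_letter x)" using d(1) l by simp
      moreover have "za l z \<in> ?F k" using d p by simp
      ultimately show ?thesis by blast
    qed (use d in auto)
    then show "d \<in> (\<Union>k<K. ?U k)" using d(5) by blast
  qed
  have finF: "finite (?F k)" for k using finite_X by simp
  then have finU: "finite (\<Union>k<K. ?U k)" by simp
  then show "finite S" using sub finite_subset by blast
  have "card S \<le> card (\<Union>k<K. ?U k)" by (rule card_mono[OF finU sub])
  also have "\<dots> \<le> (\<Sum>k<K. card (?U k))" by (rule card_UN_le) simp
  also have "\<dots> \<le> (\<Sum>k<K. P + P)"
  proof (rule sum_mono)
    fix k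
    have "card (?U k) \<le> card ((\<lambda>z. (z, x)) ` ?F k) + card ((\<lambda>z. (za x z, inv_letter x)) ` ?F k)"
      by (rule card_Un_le)
    also have "\<dots> \<le> P + P"
      by (intro add_mono order.trans[OF card_image_le[OF finF] card_fibre])
    finally show "card (?U k) \<le> P + P" .
  qed
  also have "\<dots> = B" by (simp add: B_def)
  finally show "card S \<le> B" .
qed

text \<open>An edge that leaves one part and is not in \<open>bd A\<close> runs between the two
  parts, hence belongs to \<open>S\<close>. The two boundaries are disjoint, having their sources in
  different parts, so \<open>bd A\<close> and \<open>S\<close> enter the sum only once.\<close>

lemma bd_split:
  assumes C: "C \<subseteq> A" "rel `` C \<subseteq> C"
  shows "card (bd C) + card (bd (A - C)) \<le> 2 * B"
proof -
  have 1: "bd C \<subseteq> bd A \<union> S"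
  proof
    fix d assume "d \<in> bd C"
    then obtain z l where d: "d = (z, l)" "l \<in> L" "z \<in> C" "za l z \<in> VX" "za l z \<notin> C"
      by (auto simp: bd_def)
    show "d \<in> bd A \<union> S"
    proof (cases "za l z \<in> A")
      case True
      then have "(z, l) \<in> S" using d C unfolding rel_def by blast
      then show ?thesis using d by simp
    next
      case False
      then show ?thesis using d C by (auto simp: bd_def)
    qed
  qed
  have 2: "bd (A - C) \<subseteq> bd A \<union> S"
  proof
    fix d assume "d \<in> bd (A - C)"
    then obtain z l where d: "d = (z, l)" "l \<in> L" "z \<in> A" "z \<notin> C" "za l z \<in> VX" "za l z \<notin> A - C"
      by (auto simp: bd_def)
    show "d \<in> bd A \<union> S"
    proof (cases "za l z \<in> A")
      case True
      have "(z, l) \<in> S"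
      proof (rule ccontr)
        assume "(z, l) \<notin> S"
        then have "(z, za l z) \<in> rel" using d True unfolding rel_def by blast
        then have "(za l z, z) \<in> rel" using rel_sym by (meson symD)
        then show False using d C True by blast
      qed
      then show ?thesis using d by simp
    next
      case False
      then show ?thesis using d by (auto simp: bd_def)
    qed
  qed
  have disj: "bd C \<inter> bd (A - C) = {}" by (auto simp: bd_def)
  have fin: "finite (bd A)" by (rule finite_bd[OF A(1)])
  have "card (bd C) + card (bd (A - C)) = card (bd C \<union> bd (A - C))"
    by (rule card_Un_disjoint[symmetric, OF finite_bd finite_bd disj]) (use A(1) C in auto)
  also have "\<dots> \<le> card (bd A \<union> S)"
    by (rule card_mono) (use 1 2 fin finite_S in auto)
  also have "\<dots> \<le> card (bd A) + card S" by (rule card_Un_le)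
  also have "\<dots> \<le> 2 * B" using A(2) card_S by simp
  finally show ?thesis .
qed

text \<open>\<open>l\<close> is the letter read when the chosen edge is crossed towards its end
  \<open>z\<close>; a walk from \<open>z\<close> that extends \<open>l\<close> to a reduced word
  does not turn back over the edge.\<close>

definition is_end :: "nat \<Rightarrow> letter \<Rightarrow> 'a \<Rightarrow> bool" where
  "is_end k l z \<longleftrightarrow> k < K \<and> ((l = inv_letter x \<and> z = zs k) \<or> (l = x \<and> z = za x (zs k)))"

text \<open>Otherwise the chosen edge would be a boundary edge, at distance 0 from
  \<open>zs k\<close>.\<close>

lemma x_zs_A: assumes "k < K" shows "za x (zs k) \<in> A"
proof (rule ccontr)
  assume n: "za x (zs k) \<notin> A"
  have z: "zs k \<in> A" "zs k \<in> Bf" using zs[OF assms] by auto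
  have "inX ([x] @ tl c) (zs k)" using Bf_c(1)[OF z(2)] c(1) by (simp add: x_def)
  then have "inX [x] (zs k)" using inX_append by blast
  then have "za x (zs k) \<in> VX" by (auto simp: inX_def)
  then have "(zs k, x) \<in> bd A" using z n x_L by (simp add: bd_def)
  then show False using far_bd[OF assms, of "(zs k, x)" "[]"] by (simp add: words_upto_def)
qed

text \<open>Since \<open>Y\<close> has large girth, a short reduced walk that starts with a chosen edge cannot meet
  that edge again, nor another edge of its fibre, nor (by the choice of the \<open>zs k\<close>) the boundary
  or another chosen fibre.\<close>

lemma stay:
  assumes e: "is_end k l z" and p: "reduced_word (l # p)" "set p \<subseteq> L" "length p + 1 \<le> r0" "inX p z"
    and i: "i \<le> length p"
  shows "(z, fold za (take i p) z) \<in> rel\<^sup>*"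
  using i
proof (induction i)
  case (Suc i)
  let ?q = "take i p" and ?m = "p ! i"
  let ?w = "fold za ?q z"
  have k: "k < K" using e by (simp add: is_end_def)
  have lL: "l \<in> L" using e x_L Z.inv_L[OF x_L] by (auto simp: is_end_def)
  have IH: "(z, ?w) \<in> rel\<^sup>*" using Suc by simp
  have "z \<in> A" using e zs[OF k] x_zs_A[OF k] by (auto simp: is_end_def)
  then have wA: "?w \<in> A" using IH rel_A by blast
  have mL: "?m \<in> L" using p(2) Suc.prems by auto
  have tk: "take (Suc i) p = ?q @ [?m]" using Suc.prems by (simp add: take_Suc_conv_app_nth)
  have step: "fold za (take (Suc i) p) z = za ?m ?w" by (simp add: tk)
  have wX: "za ?m ?w \<in> VX" using p(4) Suc.prems step by (metis inX_def)
  have qL: "set ?q \<subseteq> L" using p(2) by (auto dest: in_set_takeD)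
  have red: "reduced_word (l # ?q @ [?m])"
    using reduced_takeI[OF p(1), of "Suc (Suc i)"] tk by simp
  \<comment> \<open>The word leading from \<open>zs k\<close> to \<open>z\<close>: both kinds of end
    are treated by measuring all distances from \<open>zs k\<close>.\<close>
  define w0 where "w0 = (if l = inv_letter x \<and> z = zs k then [] else [x])"
  have w0: "pr z = fold la w0 (pr (zs k))" "set w0 \<subseteq> L" "length w0 \<le> 1"
    using e x_L by (auto simp: w0_def is_end_def pr_za)
  have y: "pr (zs k) \<in> Y" using zs[OF k] A(1) pr_X by auto
  have prw: "pr ?w = fold la (w0 @ ?q) (pr (zs k))" using w0(1) qL by (simp add: pr_fold)
  have prw': "pr (za ?m ?w) = fold la (w0 @ ?q @ [?m]) (pr (zs k))" using prw mL by (simp add: pr_za)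
  have red0: "reduced_word (w0 @ ?q @ [?m])"
  proof (cases "l = inv_letter x \<and> z = zs k")
    case True
    then show ?thesis using reduced_ConsD[OF red] by (simp add: w0_def)
  next
    case False
    then have "l = x" using e by (auto simp: is_end_def)
    moreover have "w0 = [x]" unfolding w0_def by (rule if_not_P[OF False])
    ultimately show ?thesis using red by simp
  qed
  have words: "w0 @ ?q \<in> words_upto L r0" "w0 @ ?q @ [?m] \<in> words_upto L r0"
    using w0 qL mL p(3) Suc.prems by (auto simp: words_upto_def)
  have nbd: "(?w, ?m) \<notin> bd A" using far_bd[OF k _ words(1), of "(?w, ?m)"] prw by auto
  then have wA': "za ?m ?w \<in> A" using wA wX mL by (simp add: bd_def)
  have closed: "q' = []" if "fold la q' (pr (zs k)) = pr (zs k)" "reduced_word q'" "q' \<in> words_upto L r0" for q'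
    using girth[OF y that(2)] that R by (auto simp: words_upto_def)
  have "(?w, ?m) \<notin> S"
  proof
    assume "(?w, ?m) \<in> S"
    then obtain j where j: "j < K" "(?m = x \<and> pr ?w = pr (zs j)) \<or> (?m = inv_letter x \<and> pr (za ?m ?w) = pr (zs j))"
      by (auto simp: S_def)
    \<comment> \<open>Both ends of the edge project to points within \<open>r0\<close> of
      \<open>pr (zs k)\<close>, so the chosen fibre that is met can only be the one over
      \<open>pr (zs k)\<close>.\<close>
    have jk: "j = k"
      using j far[OF k j(1) _ words(1)] far[OF k j(1) _ words(2)] prw prw' by metis
    from j(2) show False
    proof
      \<comment> \<open>Meeting the edge forwards closes the walk made so far; it is then empty, and
        the forbidden turn from \<open>inv_letter x\<close> to \<open>x\<close> remains. Meeting it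
        backwards, the second case, closes a reduced walk that is not empty.\<close>
      assume h: "?m = x \<and> pr ?w = pr (zs j)"
      have "reduced_word (w0 @ ?q)" using red0 by (metis append_assoc reduced_append_iff)
      then have nil: "w0 @ ?q = []" using closed[of "w0 @ ?q"] h jk prw words(1) by simp
      then have "l = inv_letter x" using e by (auto simp: w0_def is_end_def split: if_splits)
      moreover have "reduced_word [l, ?m]" using red append_is_Nil_conv[THEN iffD1, OF nil]
        by (simp only: append_Nil)
      ultimately show False using h by (simp add: reduced_Cons_iff)
    next
      assume "?m = inv_letter x \<and> pr (za ?m ?w) = pr (zs j)"
      then have "fold la (w0 @ ?q @ [?m]) (pr (zs k)) = pr (zs k)"
        using prw' jk by metis
      then show False using closed[OF _ red0 words(2)] by blast
    qed
  qed
  then have "(?w, za ?m ?w) \<in> rel" using wA wA' mL unfolding rel_def by blast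
  then show ?case using IH step by simp
qed simp

text \<open>From \<open>zs k\<close> the powers of \<open>inv_word c\<close>, and from the other end
  the rest of \<open>c\<close> followed by powers of \<open>c\<close>, lead away from the edge. By
  \<open>stay\<close> these walks remain in the component, and by \<open>pow_distinct\<close> they
  provide \<open>M + 1\<close> different vertices.\<close>

lemma comp_large:
  assumes e: "is_end k l z"
  shows "M < card (rel\<^sup>* `` {z})"
proof -
  have k: "k < K" using e by (simp add: is_end_def)
  have zk: "zs k \<in> A" "zs k \<in> Bf" "zs k \<in> VX" using zs[OF k] A(1) by auto
  have zA: "z \<in> A" using e zs[OF k] x_zs_A[OF k] by (auto simp: is_end_def)
  have fin: "finite (rel\<^sup>* `` {z})"
    by (rule finite_subset[OF _ finite_A]) (use rel_A zA in blast)
  have cc: "c = x # tl c" using c(1) by (simp add: x_def)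
  have main: "M < card (rel\<^sup>* `` {z})"
    if g: "inj_on g {..M}" "\<And>i. i \<le> M \<Longrightarrow> (z, g i) \<in> rel\<^sup>*" for g :: "nat \<Rightarrow> 'a"
  proof -
    have "card {..M} \<le> card (rel\<^sup>* `` {z})"
      by (rule card_inj_on_le[OF g(1) _ fin]) (use g(2) in auto)
    then show ?thesis by simp
  qed
  show ?thesis
  proof (cases "l = inv_letter x \<and> z = zs k")
    case True
    let ?c = "inv_word c"
    have cL: "set ?c \<subseteq> L" using Z.set_inv_word[OF letters(2)] .
    have rc: "reduced_word (?c @ ?c)" using reduced_inv_word[OF c(2)] by simp
    have cn: "?c \<noteq> []" using c(1) by (simp add: inv_word_def)
    have "hd ?c = inv_letter (last c)" using c(1) by (simp add: inv_word_def hd_rev last_map)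
    \<comment> \<open>Here \<open>c\<close> has to be cyclically reduced: the walk backwards must
      not start with \<open>x\<close>.\<close>
    moreover have "x \<noteq> inv_letter (last c)" using c(1,2) by (auto simp: reduced_append_iff x_def)
    ultimately have hdc: "hd ?c \<noteq> x" by auto
    have red: "reduced_word (l # word_pow n ?c)" for n
      using reduced_word_pow[OF rc, of n] True hdc cn
      by (cases n) (auto simp: reduced_Cons_iff word_pow_Suc)
    show ?thesis
    proof (rule main[of "\<lambda>i. fold za (word_pow i ?c) z"])
      show "inj_on (\<lambda>i. fold za (word_pow i ?c) z) {..M}"
        using pow_distinct[of z ?c] rc cn cL zk True by (auto intro: inj_on_subset)
      fix i assume i: "i \<le> M"
      have "i * length c \<le> (M + 1) * length c" using i by (intro mult_le_mono) auto
      then have "length (word_pow i ?c) + 1 \<le> r0" by (simp add: r0_def)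
      then show "(z, fold za (word_pow i ?c) z) \<in> rel\<^sup>*"
        using stay[OF e red[of i], of "length (word_pow i ?c)"] Bf_pow_inv_c[OF zk(2), of i] True
          set_word_pow[of i ?c] cL by auto
    qed
  next
    case False
    then have lz: "l = x" "z = za x (zs k)" using e by (auto simp: is_end_def)
    have f: "fold za (tl c @ word_pow i c) z = fold za (word_pow (Suc i) c) (zs k)" for i
      using lz cc by (metis (no_types, lifting) append_Cons fold_simps(2) word_pow_Suc)
    show ?thesis
    proof (rule main[of "\<lambda>i. fold za (tl c @ word_pow i c) z"])
      have inj: "inj_on (\<lambda>i. fold za (word_pow i c) (zs k)) {..M + 1}"
        by (rule pow_distinct[OF zk(3) c(2,1) letters(2) refl])
      show "inj_on (\<lambda>i. fold za (tl c @ word_pow i c) z) {..M}"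
      proof (rule inj_onI)
        fix i j assume ij: "i \<in> {..M}" "j \<in> {..M}"
          "fold za (tl c @ word_pow i c) z = fold za (tl c @ word_pow j c) z"
        then have "fold za (word_pow (Suc i) c) (zs k) = fold za (word_pow (Suc j) c) (zs k)"
          by (simp only: f)
        then show "i = j" using inj_onD[OF inj, of "Suc i" "Suc j"] ij by simp
      qed
      fix i assume i: "i \<le> M"
      let ?p = "tl c @ word_pow i c"
      have xp: "x # ?p = word_pow (Suc i) c" using cc by (metis append_Cons word_pow_Suc)
      have red: "reduced_word (l # ?p)" using xp lz reduced_word_pow[OF c(2)] by simp
      have "(i + 1) * length c \<le> (M + 1) * length c" using i by (intro mult_le_mono) auto
      moreover have "length ?p + 1 = (i + 1) * length c" using c(1) by (cases c) auto
      moreover have "(M + 1) * length c \<le> r0" by (simp add: r0_def)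
      ultimately have len: "length ?p + 1 \<le> r0" by linarith
      have "inX ([x] @ ?p) (zs k)" using Bf_pow_c[OF zk(2), of "Suc i"] xp by simp
      then have "inX ?p (fold za [x] (zs k))" using inX_append[of "[x]" ?p] by blast
      then have "inX ?p z" using lz by simp
      moreover have "set ?p \<subseteq> L" using letters(2) set_word_pow[of i c] by (auto dest: list.set_sel(2)[OF c(1)])
      ultimately show "(z, fold za ?p z) \<in> rel\<^sup>*"
        using stay[OF e red _ len, of "length ?p"] by simp
    qed
  qed
qed

text \<open>By \<open>bd_split\<close> one of the two sides has boundary at most \<open>B\<close>.
  It is a proper subset of \<open>A\<close> and contains the component of an end, so its size
  contradicts the minimality of \<open>A\<close>.\<close>

lemma ends_connected:
  assumes e: "is_end k l z" and e': "is_end k' l' z'"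
  shows "(z, z') \<in> rel\<^sup>*"
proof (rule ccontr)
  assume n: "(z, z') \<notin> rel\<^sup>*"
  let ?C = "rel\<^sup>* `` {z}" and ?C' = "rel\<^sup>* `` {z'}"
  have k: "k < K" "k' < K" using e e' by (auto simp: is_end_def)
  have zA: "z \<in> A" "z' \<in> A" using e e' zs x_zs_A k by (auto simp: is_end_def)
  have C: "?C \<subseteq> A" using rel_A zA by blast
  have "rel `` ?C \<subseteq> ?C" by (meson Image_singleton_iff ImageE rtrancl.rtrancl_into_rtrancl subsetI)
  then have "card (bd ?C) + card (bd (A - ?C)) \<le> 2 * B" using bd_split[OF C] by blast
  then consider "card (bd ?C) \<le> B" | "card (bd (A - ?C)) \<le> B" by linarith
  then show False
  proof cases
    case 1
    have "?C \<subset> A" using C zA n by blast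
    then show False using A_min[OF _ 1] comp_large[OF e] by simp
  next
    case 2
    have "A - ?C \<subset> A" using zA by blast
    then have "card (A - ?C) \<le> M" using A_min 2 by blast
    moreover have "?C' \<subseteq> A - ?C"
    proof
      fix u assume u: "u \<in> ?C'"
      then have "u \<in> A" using rel_A zA by blast
      moreover have "u \<notin> ?C"
      proof
        assume "u \<in> ?C"
        moreover have "(u, z') \<in> rel\<^sup>*" using u rel_sym by (metis Image_singleton_iff sym_rtrancl symD)
        ultimately show False using n by (meson Image_singleton_iff rtrancl_trans)
      qed
      ultimately show "u \<in> A - ?C" by blast
    qed
    then have "card ?C' \<le> card (A - ?C)" by (rule card_mono[rotated]) (simp add: finite_A)
    ultimately show False using comp_large[OF e'] by simp
  qed
qed

text \<open>As \<open>S\<close> is a full preimage, a path of \<open>VX\<close> that avoids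
  \<open>S\<close> projects to a walk that avoids the chosen edges of \<open>Y\<close>.\<close>

lemma rel_word:
  assumes "(z, z') \<in> rel\<^sup>*"
  shows "\<exists>w. set w \<subseteq> L \<and> fold za w z = z' \<and> (\<forall>j<K. avoids la x (pr (zs j)) w (pr z))"
  using assms
proof (induction rule: converse_rtrancl_induct)
  case base
  show ?case by (intro exI[of _ "[]"]) simp
next
  case (step z u)
  then obtain w where w: "set w \<subseteq> L" "fold za w u = z'" "\<forall>j<K. avoids la x (pr (zs j)) w (pr u)" by blast
  obtain l where l: "l \<in> L" "z \<in> A" "u = za l z" "u \<in> A" "(z, l) \<notin> S"
    using step(1) by (auto simp: rel_def)
  have "z \<in> VX" "u \<in> VX" using l A(1) by auto
  then have "\<forall>j<K. \<not> (l = x \<and> pr z = pr (zs j)) \<and> \<not> (l = inv_letter x \<and> la l (pr z) = pr (zs j))"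
    using l(1,3,5) by (auto simp: S_def pr_za)
  then have "\<forall>j<K. avoids la x (pr (zs j)) (l # w) (pr z)" using w(3) l by (simp add: pr_za)
  then show ?case using w l by (intro exI[of _ "l # w"]) simp
qed

text \<open>The common base point has to lie in \<open>B0\<close>, while the chosen edges start in
  \<open>Bf\<close>. The way back along \<open>f\<close> from \<open>zs 0\<close> stays in the
  component and ends in \<open>B0\<close>.\<close>

lemma loops:
  assumes K: "0 < K"
  shows "\<exists>z0\<in>B0. \<exists>w1 w2. \<forall>k<K. set (w1 k) \<subseteq> L \<and> set (w2 k) \<subseteq> L \<and>
     fold za (w1 k) z0 = zs k \<and> fold za (w2 k) (za x (zs k)) = z0 \<and>
     (\<forall>j<K. avoids la x (pr (zs j)) (w1 k) (pr z0) \<and> avoids la x (pr (zs j)) (w2 k) (la x (pr (zs k))))"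
proof -
  have e0: "is_end 0 (inv_letter x) (zs 0)" using K by (simp add: is_end_def)
  have z0: "zs 0 \<in> Bf" using zs[OF K] by simp
  define u where "u = fold za (inv_word f) (zs 0)"
  have uB: "u \<in> B0" using Bf_inv_f[OF z0] by (simp add: u_def)
  \<comment> \<open>As \<open>f @ c\<close> is reduced, the way back along \<open>f\<close> does not
    begin by crossing the edge at \<open>zs 0\<close>.\<close>
  have "reduced_word (f @ [x])"
    using c(1,3) by (auto simp: reduced_append_iff x_def reduced_Cons_iff)
  then have red: "reduced_word (inv_letter x # inv_word f)"
    using reduced_inv_word[of "f @ [x]"] by (simp add: inv_word_def)
  have u: "(zs 0, u) \<in> rel\<^sup>*"
    using stay[OF e0 red, of "length f"] Bf_inv_f[OF z0] Z.set_inv_word[OF letters(1)]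
    by (simp add: u_def r0_def)
  then have u': "(u, zs 0) \<in> rel\<^sup>*" using rel_sym by (metis sym_rtrancl symD)
  have "\<forall>k. \<exists>w. k < K \<longrightarrow> set w \<subseteq> L \<and> fold za w u = zs k \<and> (\<forall>j<K. avoids la x (pr (zs j)) w (pr u))"
  proof
    fix k
    show "\<exists>w. k < K \<longrightarrow> set w \<subseteq> L \<and> fold za w u = zs k \<and> (\<forall>j<K. avoids la x (pr (zs j)) w (pr u))"
    proof (cases "k < K")
      case True
      then have "is_end k (inv_letter x) (zs k)" by (simp add: is_end_def)
      then have "(u, zs k) \<in> rel\<^sup>*" using u' ends_connected[OF e0] by (meson rtrancl_trans)
      then show ?thesis using rel_word by blast
    qed simp
  qed
  then obtain w1 where w1: "\<And>k. k < K \<Longrightarrow> set (w1 k) \<subseteq> L \<and> fold za (w1 k) u = zs k \<and>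
    (\<forall>j<K. avoids la x (pr (zs j)) (w1 k) (pr u))" by metis
  have "\<forall>k. \<exists>w. k < K \<longrightarrow> set w \<subseteq> L \<and> fold za w (za x (zs k)) = u \<and>
    (\<forall>j<K. avoids la x (pr (zs j)) w (la x (pr (zs k))))"
  proof
    fix k
    show "\<exists>w. k < K \<longrightarrow> set w \<subseteq> L \<and> fold za w (za x (zs k)) = u \<and>
      (\<forall>j<K. avoids la x (pr (zs j)) w (la x (pr (zs k))))"
    proof (cases "k < K")
      case True
      then have "is_end k x (za x (zs k))" by (simp add: is_end_def)
      then have "(za x (zs k), u) \<in> rel\<^sup>*" using u ends_connected[OF _ e0] by (meson rtrancl_trans)
      then show ?thesis using rel_word pr_za[OF x_L] by metis
    qed simp
  qed
  then obtain w2 where w2: "\<And>k. k < K \<Longrightarrow> set (w2 k) \<subseteq> L \<and> fold za (w2 k) (za x (zs k)) = u \<and>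
    (\<forall>j<K. avoids la x (pr (zs j)) (w2 k) (la x (pr (zs k))))" by metis
  show ?thesis
    by (rule bexI[OF _ uB], rule exI[of _ w1], rule exI[of _ w2]) (simp add: w1 w2)
qed

end

section \<open>Choice of the edges and of the loops\<close>

context fibred_action
begin

text \<open>More than \<open>V\<close> points of \<open>A\<close> lie in \<open>B0\<close>. Those
  from which \<open>f\<close> leads out of \<open>A\<close> are discarded, then those whose
  translate by \<open>f\<close> is within \<open>r0\<close> of the boundary, and more than
  \<open>K * card (words_upto L r0)\<close> points are left for the greedy choice.\<close>

theorem independent_loops:
  "\<exists>z0\<in>B0. \<exists>x ys w1 w2. x \<in> L \<and> inj_on ys {..<K} \<and>
     (\<forall>k<K. set (w1 k) \<subseteq> L \<and> set (w2 k) \<subseteq> L \<and> fold za (w1 k @ x # w2 k) z0 = z0 \<and>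
       ys k = fold la (w1 k) (pr z0) \<and>
       (\<forall>j<K. avoids la x (ys j) (w1 k) (pr z0) \<and> avoids la x (ys j) (w2 k) (la x (ys k))))"
proof (cases "K = 0")
  \<comment> \<open>The base point is found from \<open>zs 0\<close>, so the absence of edges is a
    case of its own.\<close>
  case True
  have x: "hd c \<in> L" using c(1) letters(2) by (meson hd_in_set subsetD)
  obtain z where "z \<in> B0" using B0(2) by blast
  then show ?thesis using True x by (intro bexI[of _ z] exI[of _ "hd c"]) auto
next
  case False
  obtain A where A: "A \<subseteq> VX" "card (bd A) \<le> B" "Q < card A"
    and min: "\<And>A'. A' \<subset> A \<Longrightarrow> card (bd A') \<le> B \<Longrightarrow> card A' \<le> M"
    using obtain_minimal by blast
  have finA: "finite A" using A(1) finite_X finite_subset by blast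
  have "P * (V + \<rho> * B) < P * (card (A \<inter> B0) + \<rho> * B)"
    using card_le_base[OF A(1,2)] A(3) Q by linarith
  then have V: "V < card (A \<inter> B0)" by simp
  let ?W = "words_upto L r0" and ?n = "card (words_upto L r0)"
  have finW: "finite ?W" by (rule finite_words_upto[OF fin_L])
  let ?D = "{u \<in> A \<inter> B0. fold za f u \<in> A}"
  let ?Y = "(\<lambda>u. pr (fold za f u)) ` ?D"
  let ?bad = "\<Union>w\<in>?W. (\<lambda>d. fold la (inv_word w) (pr (fst d))) ` bd A"
  have "card {u \<in> A \<inter> B0. fold za f u \<notin> A} \<le> card {z \<in> A. inX f z \<and> fold za f z \<notin> A}"
    by (rule card_mono) (use finA inX_base[of _ f] letters(1) in \<open>auto simp: \<rho>_def a_def\<close>)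
  also have "\<dots> \<le> length f * B"
    using walk_exit[OF A(1) letters(1)] A(2) by (meson le_trans mult_le_mono2)
  finally have ex: "card {u \<in> A \<inter> B0. fold za f u \<notin> A} \<le> length f * B" .
  have "card (A \<inter> B0) = card (?D \<union> {u \<in> A \<inter> B0. fold za f u \<notin> A})"
    by (rule arg_cong[of _ _ card]) blast
  also have "\<dots> \<le> card ?D + card {u \<in> A \<inter> B0. fold za f u \<notin> A}" by (rule card_Un_le)
  finally have "card (A \<inter> B0) \<le> card ?D + card {u \<in> A \<inter> B0. fold za f u \<notin> A}" .
  then have D: "(B + K) * ?n < card ?D" using ex V unfolding V_def by linarith
  \<comment> \<open>Distances are taken in \<open>Y\<close>; injectivity of \<open>pr\<close> on
    \<open>B0\<close> preserves the number of points there.\<close>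
  have injD: "inj_on (\<lambda>u. pr (fold za f u)) ?D"
  proof (rule inj_onI)
    fix u v assume uv: "u \<in> ?D" "v \<in> ?D" "pr (fold za f u) = pr (fold za f v)"
    then have "fold la f (pr u) = fold la f (pr v)" by (simp add: pr_fold letters(1))
    then have "pr u = pr v" by (simp add: Y.fold_eq_iff[OF letters(1)])
    then show "u = v" using B0(3) uv by (auto dest: inj_onD)
  qed
  have cY: "(B + K) * ?n < card ?Y" using D card_image[OF injD] by simp
  have "card ?bad \<le> (\<Sum>w\<in>?W. card ((\<lambda>d. fold la (inv_word w) (pr (fst d))) ` bd A))"
    by (rule card_UN_le[OF finW])
  also have "\<dots> \<le> (\<Sum>w\<in>?W. B)"
    by (intro sum_mono order.trans[OF card_image_le[OF finite_bd[OF A(1)]] A(2)])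
  finally have bad: "card ?bad \<le> B * ?n" by (simp add: mult.commute)
  have fbad: "finite ?bad" using finW finite_bd[OF A(1)] by simp
  have "card ?Y - card ?bad \<le> card (?Y - ?bad)" by (rule diff_card_le_card_Diff[OF fbad])
  then have cS: "K * ?n < card (?Y - ?bad)" using cY bad by (simp add: add_mult_distrib)
  define T where "T = ?Y - ?bad"
  have finT: "finite T" and cT: "K * ?n < card T" using finA cS by (simp_all add: T_def)
  let ?near = "\<lambda>y y'. \<exists>w\<in>?W. fold la w y = y'"
  have sep: "\<exists>ys. (\<forall>k<K. ys k \<in> T) \<and> (\<forall>j<K. \<forall>k<K. j \<noteq> k \<longrightarrow> \<not> ?near (ys j) (ys k))"
  proof (rule choose_separated[where S = "T" and near = ?near and n = ?n and K = K])
    show "finite T" by (rule finT)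
    show "K * ?n < card T" by (rule cT)
    fix y
    have "{y' \<in> T. ?near y y'} \<subseteq> (\<lambda>w. fold la w y) ` ?W" by blast
    then have "card {y' \<in> T. ?near y y'} \<le> card ((\<lambda>w. fold la w y) ` ?W)"
      by (rule card_mono[rotated]) (simp add: finW)
    also have "\<dots> \<le> ?n" by (rule card_image_le[OF finW])
    finally show "card {y' \<in> T. ?near y y'} \<le> ?n" .
  next
    fix y y' assume "?near y y'"
    then obtain w where w: "w \<in> ?W" "fold la w y = y'" by blast
    then have "fold la (inv_word w) y' = y" by (auto simp: words_upto_def Y.fold_inv_word)
    then show "?near y' y" using Y.inv_word_words[OF w(1)] by blast
  qed
  then obtain ys where ys: "\<forall>k<K. ys k \<in> T"
    "\<forall>j<K. \<forall>k<K. j \<noteq> k \<longrightarrow> \<not> ?near (ys j) (ys k)" by blast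
  have "\<forall>k. \<exists>u. k < K \<longrightarrow> u \<in> ?D \<and> ys k = pr (fold za f u)"
    using ys(1) unfolding T_def by (metis (no_types, lifting) DiffD1 imageE)
  then obtain us where us: "\<And>k. k < K \<Longrightarrow> us k \<in> ?D \<and> ys k = pr (fold za f (us k))" by metis
  define zs where "zs k = fold za f (us k)" for k
  have zs: "zs k \<in> A \<inter> Bf" "pr (zs k) = ys k" if "k < K" for k
    using us[OF that] by (auto simp: zs_def Bf_def)
  interpret cut: fibred_cut L za la pr Y B0 f c b K R Q P \<rho> B M0 M r0 V a A zs
  proof (unfold_locales)
    show "A \<subseteq> VX" "card (bd A) \<le> B" "Q < card A" by (fact A)+
    show "A' \<subset> A \<Longrightarrow> card (bd A') \<le> B \<Longrightarrow> card A' \<le> M" for A' by (rule min)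
    show "k < K \<Longrightarrow> zs k \<in> A \<inter> Bf" for k by (rule zs)
    show "fold la w (pr (zs k)) \<noteq> pr (fst d)" if "k < K" "d \<in> bd A" "w \<in> words_upto L r0" for k d w
    proof
      assume "fold la w (pr (zs k)) = pr (fst d)"
      then have "ys k = fold la (inv_word w) (pr (fst d))"
        using that zs(2) by (metis (no_types, lifting) Y.fold_inv_word mem_Collect_eq words_upto_def)
      then have "ys k \<in> ?bad" using that by blast
      moreover have "ys k \<in> T" using ys(1) that(1) by blast
      ultimately show False unfolding T_def by (simp only: Diff_iff simp_thms)
    qed
    show "fold la w (pr (zs j)) \<noteq> pr (zs k)" if "j < K" "k < K" "j \<noteq> k" "w \<in> words_upto L r0" for j k w
      using ys(2) that zs(2) by metis
  qed
  obtain z0 w1 w2 where z0: "z0 \<in> B0" and w0: "\<forall>k<K. set (w1 k) \<subseteq> L \<and> set (w2 k) \<subseteq> L \<and>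
     fold za (w1 k) z0 = zs k \<and> fold za (w2 k) (za cut.x (zs k)) = z0 \<and>
     (\<forall>j<K. avoids la cut.x (pr (zs j)) (w1 k) (pr z0) \<and> avoids la cut.x (pr (zs j)) (w2 k) (la cut.x (pr (zs k))))"
    using cut.loops[OF False[unfolded neq0_conv]] by (elim bexE exE) (rule that, assumption+)
  note w = w0[THEN spec, THEN mp]
  have nil: "[] \<in> ?W" by (simp add: words_upto_def)
  have inj: "inj_on ys {..<K}"
  proof (rule inj_onI, rule ccontr)
    fix j k assume "j \<in> {..<K}" "k \<in> {..<K}" "ys j = ys k" "j \<noteq> k"
    then show False using ys(2) nil by (metis fold_simps(1) lessThan_iff)
  qed
  have 1: "fold za (w1 k @ cut.x # w2 k) z0 = z0" if "k < K" for k using w[OF that] by simp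
  have 2: "ys k = fold la (w1 k) (pr z0)" if "k < K" for k
    using w[OF that] zs(2)[OF that] by (metis pr_fold)
  have 3: "avoids la cut.x (ys j) (w1 k) (pr z0) \<and> avoids la cut.x (ys j) (w2 k) (la cut.x (ys k))"
    if "k < K" "j < K" for j k using w[OF that(1)] zs(2) that by metis
  show ?thesis
    apply (rule bexI[OF _ z0], rule exI[of _ cut.x], rule exI[of _ ys], rule exI[of _ w1], rule exI[of _ w2])
    apply (intro conjI allI impI cut.x_L inj)
         apply (use w in blast)
        apply (use w in blast)
       apply (erule 1)
      apply (erule 2)
     apply (use 3 in blast)
    apply (use 3 in blast)
    done
qed

end

section \<open>Words in a non-cyclic subgroup of a free group\<close>

text \<open>Free reduction of an arbitrary word; for reduced words \<open>u\<close> and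
  \<open>v\<close> the product in the free group is \<open>nf (u @ v)\<close>.\<close>

definition nf :: "letter list \<Rightarrow> letter list" where
  "nf w = foldr push_letter w []"

lemma reduced_nf [simp]: "reduced_word (nf w)"
  by (simp add: nf_def reduced_foldr)

lemma nf_Nil [simp]: "nf [] = []"
  by (simp add: nf_def)

lemma nf_reduced: "reduced_word w \<Longrightarrow> nf w = w"
  unfolding nf_def
proof (induction w)
  case (Cons a w)
  then show ?case using reduced_ConsD[of a w] push_reduced[of a w] by simp
qed simp

lemma foldr_push_nf: "reduced_word v \<Longrightarrow> foldr push_letter (nf u) v = foldr push_letter u v"
  unfolding nf_def using foldr_push_assoc[of v u "[]"] by simp

lemma foldr_push_inv_word: "reduced_word w \<Longrightarrow> foldr push_letter (inv_word v) (foldr push_letter v w) = w"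
proof (induction v)
  case (Cons a v)
  then show ?case
    using push_push_inv[OF reduced_foldr, of w "inv_letter a" v] by (simp add: inv_word_Cons)
qed simp

lemma nf_append: "nf (u @ v) = foldr push_letter u (nf v)"
  by (simp add: nf_def)

lemma nf_append_nf: "nf (nf u @ nf v) = nf (u @ v)"
  by (simp add: nf_append foldr_push_nf nf_reduced)

lemma nf_eqI: "nf (u @ inv_word v) = [] \<Longrightarrow> nf u = nf v"
proof -
  assume "nf (u @ inv_word v) = []"
  then have "foldr push_letter (u @ inv_word v) (nf v) = nf v"
    using foldr_push_nf[of "nf v" "u @ inv_word v"] by simp
  moreover have "foldr push_letter (inv_word v) (nf v) = []"
    unfolding nf_def by (rule foldr_push_inv_word) simp
  ultimately show ?thesis by (simp add: nf_def)
qed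

lemma set_nf: "fst ` set (nf w) \<subseteq> fst ` set w"
  using set_foldr[of w "[]"] by (simp add: nf_def)

lemma length_push: "length (push_letter a w) \<le> Suc (length w)"
  by (cases w) auto

lemma length_nf: "length (nf w) \<le> length w"
  unfolding nf_def
proof (induction w)
  case (Cons a w)
  then show ?case using length_push[of a "foldr push_letter w []"] by simp
qed simp

lemma (in letter_action) fold_push:
  "l \<in> L \<Longrightarrow> fold za (push_letter l w) z = fold za w (za l z)"
  by (cases w) (auto simp: za_inv)

text \<open>Adjacent inverse letters cancel in the action, so it factors through free
  reduction.\<close>

lemma (in letter_action) fold_nf:
  "set w \<subseteq> L \<Longrightarrow> fold za (nf w) z = fold za w z"
proof (induction w arbitrary: z)
  case (Cons a w)
  then show ?case using fold_push[of a "nf w" z] by (simp add: nf_def)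
qed simp

lemma cyclic_decomposition:
  assumes "reduced_word w" "w \<noteq> []"
  shows "\<exists>f c. w = f @ c @ inv_word f \<and> c \<noteq> [] \<and> reduced_word (c @ c)"
  using assms
proof (induction "length w" arbitrary: w rule: less_induct)
  case less
  show ?case
  proof (cases "reduced_word (w @ w)")
    case True
    then show ?thesis using less.prems by (intro exI[of _ "[]"] exI[of _ w]) simp
  next
    case False
    then have h: "hd w = inv_letter (last w)" using less.prems by (auto simp: reduced_append_iff)
    obtain l w1 where w1: "w = l # w1" using less.prems by (cases w) auto
    have "w1 \<noteq> []"
    proof
      assume "w1 = []"
      then show False using h w1 by (auto simp: inv_letter_def prod_eq_iff)
    qed
    then obtain w2 l2 where w2: "w1 = w2 @ [l2]" by (cases w1 rule: rev_cases) auto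
    have w: "w = l # w2 @ [l2]" using w1 w2 by simp
    have l2: "l2 = inv_letter l" using h w by simp
    have "w2 \<noteq> []" using less.prems(1) w l2 by (auto simp: reduced_Cons_iff)
    moreover have "reduced_word w2"
      using less.prems(1) w by (auto simp: reduced_Cons_iff reduced_append_iff)
    moreover have "length w2 < length w" using w by simp
    ultimately obtain f c where "w2 = f @ c @ inv_word f" "c \<noteq> []" "reduced_word (c @ c)"
      using less.hyps by blast
    then show ?thesis using w l2 by (intro exI[of _ "l # f"] exI[of _ c]) (simp add: inv_word_Cons)
  qed
qed

text \<open>If one of \<open>f\<close> and \<open>g\<close> ended before the other, its core would
  begin with a letter and end with the inverse of that letter, so it would not be cyclically
  reduced.\<close>

lemma cyclic_decomposition_unique:
  assumes "f @ c @ inv_word f = g @ d @ inv_word g" "c \<noteq> []" "d \<noteq> []"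
    "reduced_word (c @ c)" "reduced_word (d @ d)"
  shows "f = g \<and> c = d"
  using assms(1)
proof (induction f arbitrary: g)
  case Nil
  show ?case
  proof (cases g)
    case (Cons l g')
    then have "hd c = l" "last c = inv_letter l" using Nil by (auto simp: inv_word_Cons)
    then show ?thesis using assms(2,4) by (auto simp: reduced_append_iff)
  qed (use Nil in auto)
next
  case (Cons l f)
  show ?case
  proof (cases g)
    case Nil
    then have "hd d = l" "last d = inv_letter l" using Cons.prems by (auto simp: inv_word_Cons dest: sym)
    then show ?thesis using assms(3,5) by (auto simp: reduced_append_iff)
  next
    case (Cons l' g')
    then show ?thesis using Cons.prems Cons.IH[of g'] by (auto simp: inv_word_Cons)
  qed
qed

lemma nth_word_pow: "t < n * length w \<Longrightarrow> word_pow n w ! t = w ! (t mod length w)"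
proof (induction n arbitrary: t)
  case (Suc n)
  show ?case
  proof (cases "t < length w")
    case False
    then have "t - length w < n * length w" using Suc.prems by simp
    then show ?thesis using False Suc.IH by (simp add: word_pow_Suc nth_append le_mod_geq)
  qed (simp add: word_pow_Suc nth_append)
qed simp

lemma word_pow_add: "word_pow (i + j) w = word_pow i w @ word_pow j w"
  by (induction i) (simp_all add: word_pow_Suc)

text \<open>The square of the common power has the periods \<open>length c\<close> and
  \<open>length d\<close>, so \<open>c @ d\<close> and \<open>d @ c\<close> are both its prefix of
  length \<open>length c + length d\<close>. The power itself may be shorter than that.\<close>

lemma common_power_commute:
  assumes e: "word_pow i c = word_pow j d" and ij: "0 < i" "0 < j"
  shows "c @ d = d @ c"
proof -
  let ?U = "word_pow (i + i) c"
  have U: "?U = word_pow (j + j) d" using e by (simp add: word_pow_add)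
  have len: "i * length c = j * length d" using arg_cong[OF e, of length] by simp
  have nc: "length c \<le> i * length c" and nd: "length d \<le> j * length d" using ij by auto
  have Uc: "?U ! t = c ! (t mod length c)" if "t < length c + length d" for t
    by (rule nth_word_pow, unfold add_mult_distrib) (use that nc nd len in linarith)
  have Ud: "?U ! t = d ! (t mod length d)" if "t < length c + length d" for t
    unfolding U by (rule nth_word_pow, unfold add_mult_distrib) (use that nc nd len in linarith)
  have 1: "(c @ d) ! t = ?U ! t" if t: "t < length c + length d" for t
  proof (cases "t < length c")
    case True
    then show ?thesis using Uc[OF t] by (simp add: nth_append)
  next
    case False
    then have "t - length c < length d" using t by simp
    then have "d ! (t - length c) = ?U ! (t - length c)" using Ud[of "t - length c"] t by simp
    also have "\<dots> = ?U ! t" using Uc[of "t - length c"] Uc[OF t] t False by (simp add: le_mod_geq)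
    finally show ?thesis using False by (simp add: nth_append)
  qed
  have 2: "(d @ c) ! t = ?U ! t" if t: "t < length c + length d" for t
  proof (cases "t < length d")
    case True
    then show ?thesis using Ud[OF t] by (simp add: nth_append)
  next
    case False
    then have "t - length d < length c" using t by simp
    then have "c ! (t - length d) = ?U ! (t - length d)" using Uc[of "t - length d"] t by simp
    also have "\<dots> = ?U ! t" using Ud[of "t - length d"] Ud[OF t] t False by (simp add: le_mod_geq)
    finally show ?thesis using False by (simp add: nth_append)
  qed
  show ?thesis by (rule nth_equalityI) (use 1 2 in auto)
qed

text \<open>Every junction in \<open>f @ word_pow n c @ inv_word f\<close> already occurs in
  \<open>f @ c @ inv_word f\<close> or in \<open>c @ c\<close>, so nothing cancels there.\<close>

lemma nf_pow_conj:
  assumes "reduced_word (f @ c @ inv_word f)" "c \<noteq> []" "reduced_word (c @ c)" "0 < n"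
  shows "nf (word_pow n (f @ c @ inv_word f)) = f @ word_pow n c @ inv_word f"
    and "reduced_word (f @ word_pow n c @ inv_word f)"
proof -
  have red: "reduced_word (f @ word_pow n c @ inv_word f)" if "0 < n" for n
  proof -
    from that obtain k where n: "n = Suc k" using gr0_implies_Suc by blast
    have ne: "word_pow n c \<noteq> []" using assms(2) n by (simp add: word_pow_Suc)
    moreover have "hd (word_pow n c) = hd c" using assms(2) n by (simp add: word_pow_Suc)
    moreover have "last (word_pow n c) = last c" using assms(2) n by (simp add: word_pow_Suc')
    moreover have "reduced_word (word_pow n c)" by (rule reduced_word_pow[OF assms(3)])
    ultimately show ?thesis using assms(1,2) by (auto simp: reduced_append_iff)
  qed
  show "reduced_word (f @ word_pow n c @ inv_word f)" by (rule red[OF assms(4)])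
  show "nf (word_pow n (f @ c @ inv_word f)) = f @ word_pow n c @ inv_word f"
    using assms(4)
  proof (induction n)
    case (Suc n)
    let ?a = "f @ c @ inv_word f"
    show ?case
    proof (cases "n = 0")
      case True
      then show ?thesis using assms(1) by (simp add: word_pow_Suc nf_reduced)
    next
      case False
      then have n: "0 < n" by simp
      let ?p = "word_pow n c @ inv_word f"
      have pr: "reduced_word ?p" using red[OF n] by (simp add: reduced_append_iff)
      have Z: "f @ ?p = foldr push_letter f ?p"
        using nf_append[of f ?p] by (simp only: nf_reduced[OF red[OF n]] nf_reduced[OF pr])
      have "nf (word_pow (Suc n) ?a) = foldr push_letter ?a (f @ ?p)"
        using Suc.IH[OF n] by (simp only: word_pow_Suc nf_append)
      also have "\<dots> = foldr push_letter (f @ c) (foldr push_letter (inv_word f) (foldr push_letter f ?p))"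
        unfolding Z by simp
      also have "\<dots> = foldr push_letter (f @ c) ?p" by (simp only: foldr_push_inv_word[OF pr])
      also have "\<dots> = nf ((f @ c) @ ?p)" by (simp only: nf_append[of "f @ c"] nf_reduced[OF pr])
      also have "\<dots> = f @ word_pow (Suc n) c @ inv_word f"
        using red[of "Suc n"] by (simp add: word_pow_Suc nf_reduced)
      finally show ?thesis .
    qed
  qed simp
qed

lemma fst_set_inv_word: "fst ` set (inv_word w) = fst ` set w"
  by (simp add: inv_word_def image_image)

lemma free_group_simps:
  "carrier (free_group m) = {w. fst ` set w \<subseteq> {..<m} \<and> reduced_word w}"
  "x \<otimes>\<^bsub>free_group m\<^esub> y = foldr push_letter x y"
  "\<one>\<^bsub>free_group m\<^esub> = []"
  by (simp_all add: free_group_def)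

lemma inv_free_group:
  assumes "w \<in> carrier (free_group m)"
  shows "inv\<^bsub>free_group m\<^esub> w = inv_word w"
proof -
  interpret group "free_group m" by (rule group_free_group)
  have "inv_word w \<in> carrier (free_group m)"
    using assms by (simp add: free_group_simps reduced_inv_word fst_set_inv_word)
  moreover have "inv_word w \<otimes>\<^bsub>free_group m\<^esub> w = \<one>\<^bsub>free_group m\<^esub>"
    by (simp add: free_group_simps inv_word_def foldr_push_inverse)
  ultimately show ?thesis using assms inv_equality by blast
qed

lemma pow_free_group:
  assumes "w \<in> carrier (free_group m)"
  shows "w [^]\<^bsub>free_group m\<^esub> n = nf (word_pow n w)"
proof (induction n)
  case 0
  then show ?case by (simp add: free_group_simps)
next
  case (Suc n)
  then have "w [^]\<^bsub>free_group m\<^esub> Suc n = foldr push_letter (nf (word_pow n w)) w"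
    by (simp add: free_group_simps)
  also have "\<dots> = nf (word_pow n w @ w)"
    using assms foldr_push_nf[of w] by (simp add: free_group_simps nf_append nf_reduced)
  finally show ?case by (simp add: word_pow_Suc')
qed

text \<open>Take \<open>a = f c f\<^sup>-\<^sup>1\<close> in \<open>\<Delta>\<close> with \<open>c\<close> cyclically reduced and as short as possible. By division
  with remainder, every element of \<open>\<Delta>\<close> with a power in common with \<open>a\<close> is a power of \<open>a\<close>.\<close>

lemma noncyclic_words:
  assumes \<Delta>: "subgroup \<Delta> (free_group m)"
    and nc: "\<not> cyclic_group ((free_group m)\<lparr>carrier := \<Delta>\<rparr>)"
  shows "\<exists>f c b. f @ c @ inv_word f \<in> \<Delta> \<and> c \<noteq> [] \<and> reduced_word (c @ c) \<and> b \<in> \<Delta> \<and>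
    (\<forall>i j. i \<noteq> 0 \<or> j \<noteq> 0 \<longrightarrow> nf (word_pow i (f @ c @ inv_word f) @ word_pow j b) \<noteq> [] \<and>
       nf (word_pow i (f @ c @ inv_word f) @ word_pow j (inv_word b)) \<noteq> [])"
proof -
  let ?F = "free_group m"
  interpret F: group ?F by (rule group_free_group)
  interpret D: subgroup \<Delta> ?F by (rule \<Delta>)
  interpret H: group "?F\<lparr>carrier := \<Delta>\<rparr>" by (rule subgroup.subgroup_is_group[OF \<Delta> F.group_axioms])
  have red: "reduced_word w" if "w \<in> \<Delta>" for w using D.subset that by (auto simp: free_group_simps)
  have inv: "inv_word w \<in> \<Delta>" if "w \<in> \<Delta>" for w
    using D.m_inv_closed[OF that] inv_free_group[of w m] D.subset that by auto
  have one: "[] \<in> \<Delta>" using D.one_closed by (simp add: free_group_simps)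
  have mult: "foldr push_letter u v \<in> \<Delta>" if "u \<in> \<Delta>" "v \<in> \<Delta>" for u v
    using D.m_closed[OF that] by (simp add: free_group_simps)
  have "\<exists>w\<in>\<Delta>. w \<noteq> []"
  proof (rule ccontr)
    assume "\<not> (\<exists>w\<in>\<Delta>. w \<noteq> [])"
    then have "\<Delta> = {[]}" using one by blast
    then have "trivial_group (?F\<lparr>carrier := \<Delta>\<rparr>)"
      using H.group_axioms by (simp add: trivial_group_def free_group_simps)
    then show False using nc trivial_imp_cyclic_group by blast
  qed
  then obtain w where w: "w \<in> \<Delta>" "w \<noteq> []" by blast
  let ?Q = "\<lambda>(f, c). f @ c @ inv_word f \<in> \<Delta> \<and> c \<noteq> [] \<and> reduced_word (c @ c)"
  obtain f1 c1 where "?Q (f1, c1)" using cyclic_decomposition[OF red[OF w(1)] w(2)] w(1) by auto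
  from ex_has_least_nat[of ?Q, OF this, of "\<lambda>(f, c). length c"]
  obtain f c where fc: "?Q (f, c)" and min: "\<And>f' c'. ?Q (f', c') \<Longrightarrow> length c \<le> length c'" by auto
  define a where "a = f @ c @ inv_word f"
  have a: "a \<in> \<Delta>" "c \<noteq> []" "reduced_word (c @ c)" using fc by (auto simp: a_def)
  have reda: "reduced_word (f @ c @ inv_word f)" using red[OF a(1)] by (simp add: a_def)
  \<comment> \<open>\<open>e\<close> is divided by \<open>c\<close>. A non-empty remainder would be
    a prefix of \<open>c\<close> that commutes with \<open>c\<close>; it would be cyclically
    reduced, and its conjugate by \<open>f\<close> would be an element of \<open>\<Delta>\<close>
    with a shorter core.\<close>
  have root: "\<exists>q. e = word_pow q c"
    if "c @ e = e @ c" "nf (f @ e @ inv_word f) \<in> \<Delta>" for e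
    using that
  proof (induction "length e" arbitrary: e rule: less_induct)
    case less
    show ?case
    proof (cases "length e < length c")
      case True
      show ?thesis
      proof (cases "e = []")
        case True
        then show ?thesis by (intro exI[of _ 0]) simp
      next
        case ne: False
        have "e = take (length e) c" using less.prems(1) True
          by (metis append_eq_append_conv_if less_imp_le_nat take_all_iff append_take_drop_id order.refl take_append diff_is_0_eq take0 append_Nil2)
        then obtain r where r: "c = e @ r" by (metis append_take_drop_id)
        have er: "e @ r = r @ e" using less.prems(1) r by simp
        \<comment> \<open>\<open>c\<close> is both \<open>e @ r\<close> and \<open>r @ e\<close>, so
          \<open>c @ c\<close> contains \<open>e @ e\<close>.\<close>
        have "reduced_word ((r @ e) @ (e @ r))" using a(3) r er by simp
        then have ee: "reduced_word (e @ e)" by (metis append_assoc reduced_append_iff)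
        have "reduced_word (f @ e @ r @ inv_word f)" using reda r by simp
        then have 1: "reduced_word (f @ e)" by (metis append_assoc reduced_append_iff)
        have "reduced_word (f @ r @ e @ inv_word f)" using reda r er by simp
        then have 2: "reduced_word (e @ inv_word f)" by (metis append_assoc reduced_append_iff)
        have "reduced_word (f @ e @ inv_word f)" using 1 2 ne by (auto simp: reduced_append_iff)
        then have "f @ e @ inv_word f \<in> \<Delta>" using less.prems(2) by (simp add: nf_reduced)
        then have "length c \<le> length e" using min[of f e] ne ee by simp
        then show ?thesis using True by simp
      qed
    next
      case False
      have "c = take (length c) e" using less.prems(1) False
        by (metis append_eq_append_conv_if linorder_not_less)
      then obtain e' where e': "e = c @ e'" by (metis append_take_drop_id)
      have 1: "c @ e' = e' @ c" using less.prems(1) e' by simp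
      have "nf (f @ e' @ inv_word f) = foldr push_letter (inv_word a) (nf (f @ e @ inv_word f))"
      proof -
        have r: "reduced_word (nf (e @ inv_word f))" by simp
        have "foldr push_letter (inv_word a) (nf (f @ e @ inv_word f)) =
          foldr push_letter f (foldr push_letter (inv_word c) (foldr push_letter (inv_word f) (foldr push_letter f (nf (e @ inv_word f)))))"
          by (simp add: a_def nf_append)
        also have "\<dots> = foldr push_letter f (foldr push_letter (inv_word c) (nf (e @ inv_word f)))"
          by (simp add: foldr_push_inv_word)
        also have "\<dots> = foldr push_letter f (nf (e' @ inv_word f))"
          using foldr_push_inv_word[OF reduced_nf, of c "e' @ inv_word f"] by (simp add: e' nf_append)
        finally show ?thesis by (simp add: nf_append)
      qed
      then have 2: "nf (f @ e' @ inv_word f) \<in> \<Delta>" using mult inv[OF a(1)] less.prems(2) by simp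
      have "length e' < length e" using e' a(2) by simp
      then obtain q where "e' = word_pow q c" using less.hyps 1 2 by blast
      then show ?thesis using e' by (intro exI[of _ "Suc q"]) (simp add: word_pow_Suc)
    qed
  qed
  have pow_ne: "nf (word_pow i (g @ d @ inv_word g)) \<noteq> []"
    if "0 < i" "reduced_word (g @ d @ inv_word g)" "d \<noteq> []" "reduced_word (d @ d)" for i g d
    using nf_pow_conj(1)[OF that(2,3,4,1)] that by (auto simp: word_pow_Suc gr0_conv_Suc)
  have key: "\<exists>q. b = nf (word_pow q a)"
    if b: "b \<in> \<Delta>" and ij: "i \<noteq> 0 \<or> j \<noteq> 0" and e: "nf (word_pow i a @ word_pow j (inv_word b)) = []" for b i j
  proof (cases "b = []")
    case True
    then show ?thesis by (intro exI[of _ 0]) simp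
  next
    case False
    obtain g d where gd: "b = g @ d @ inv_word g" "d \<noteq> []" "reduced_word (d @ d)"
      using cyclic_decomposition[OF red[OF b] False] by blast
    have redb: "reduced_word (g @ d @ inv_word g)" using red[OF b] gd by simp
    have eq: "nf (word_pow i a) = nf (word_pow j b)"
      using nf_eqI[of "word_pow i a" "word_pow j b"] e by (simp add: inv_word_pow)
    \<comment> \<open>The free group has no torsion: if one exponent were 0, so would be the
      other.\<close>
    have i: "0 < i" and j: "0 < j"
      using ij eq pow_ne[OF _ redb gd(2,3), of j] pow_ne[OF _ reda a(2,3), of i]
      by (auto simp: a_def gd(1) intro!: gr0I)
    have "f @ word_pow i c @ inv_word f = g @ word_pow j d @ inv_word g"
      using eq nf_pow_conj(1)[OF reda a(2,3) i] nf_pow_conj(1)[OF redb gd(2,3) j] by (simp add: a_def gd(1))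
    moreover have "word_pow i c \<noteq> []" "word_pow j d \<noteq> []"
      using i j a(2) gd(2) by (auto simp: word_pow_Suc gr0_conv_Suc)
    moreover have "reduced_word (word_pow i c @ word_pow i c)" "reduced_word (word_pow j d @ word_pow j d)"
      using reduced_word_pow[OF a(3), of "i + i"] reduced_word_pow[OF gd(3), of "j + j"] by (simp_all add: word_pow_add)
    ultimately have "f = g" "word_pow i c = word_pow j d" using cyclic_decomposition_unique by blast+
    then have "c @ d = d @ c" using common_power_commute i j by blast
    moreover have "nf (f @ d @ inv_word f) \<in> \<Delta>" using b gd \<open>f = g\<close> redb by (simp add: nf_reduced)
    ultimately obtain q where q: "d = word_pow q c" using root by blast
    have "0 < q" using q gd(2) by (auto intro!: gr0I)
    then have "nf (word_pow q a) = b"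
      using nf_pow_conj(1)[OF reda a(2,3)] q gd(1) \<open>f = g\<close> by (simp add: a_def)
    then show ?thesis by blast
  qed
  have "\<exists>b\<in>\<Delta>. \<forall>i j. i \<noteq> 0 \<or> j \<noteq> 0 \<longrightarrow> nf (word_pow i a @ word_pow j b) \<noteq> [] \<and>
       nf (word_pow i a @ word_pow j (inv_word b)) \<noteq> []"
  proof (rule ccontr)
    assume n: "\<not> ?thesis"
    have ac: "a \<in> carrier ?F" using a D.subset by blast
    have p: "a [^]\<^bsub>?F\<lparr>carrier := \<Delta>\<rparr>\<^esub> k = a [^]\<^bsub>?F\<^esub> k" for k :: int
      using F.int_pow_consistent[OF \<Delta> a(1), of k] by simp
    have "b \<in> range (\<lambda>n::int. a [^]\<^bsub>?F\<lparr>carrier := \<Delta>\<rparr>\<^esub> n)" if b: "b \<in> \<Delta>" for b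
    proof -
      obtain i j where ij: "i \<noteq> 0 \<or> j \<noteq> (0::nat)" "nf (word_pow i a @ word_pow j b) = [] \<or>
         nf (word_pow i a @ word_pow j (inv_word b)) = []" using n b by blast
      \<comment> \<open>A relation with \<open>b\<close> turns the inverse of \<open>b\<close> into
        a power of \<open>a\<close>, a relation with \<open>inv_word b\<close> turns
        \<open>b\<close> itself into one.\<close>
      from ij(2) show ?thesis
      proof
        assume "nf (word_pow i a @ word_pow j b) = []"
        then obtain q where "inv_word b = nf (word_pow q a)" using key[OF inv[OF b] ij(1)] by auto
        then have "inv\<^bsub>?F\<^esub> b = a [^]\<^bsub>?F\<^esub> q"
          using inv_free_group[of b m] b D.subset pow_free_group[OF ac] by auto
        then have "b = inv\<^bsub>?F\<^esub> (a [^]\<^bsub>?F\<^esub> q)" using b D.subset by (metis F.inv_inv subsetD)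
        also have "\<dots> = a [^]\<^bsub>?F\<^esub> (- int q)" using ac by (simp add: F.int_pow_neg_int)
        finally show ?thesis using p by (metis rangeI)
      next
        assume "nf (word_pow i a @ word_pow j (inv_word b)) = []"
        then obtain q where "b = nf (word_pow q a)" using key[OF b ij(1)] by auto
        then have "b = a [^]\<^bsub>?F\<^esub> int q" using pow_free_group[OF ac] by (simp add: int_pow_int)
        then show ?thesis using p by (metis rangeI)
      qed
    qed
    moreover have "a [^]\<^bsub>?F\<lparr>carrier := \<Delta>\<rparr>\<^esub> k \<in> \<Delta>" for k :: int
      using H.int_pow_closed[of a k] a(1) by simp
    ultimately have "\<Delta> = range (\<lambda>n::int. a [^]\<^bsub>?F\<lparr>carrier := \<Delta>\<rparr>\<^esub> n)" by blast
    then have "cyclic_group (?F\<lparr>carrier := \<Delta>\<rparr>)" using a(1) H.cyclic_group by auto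
    then show False using nc by blast
  qed
  then show ?thesis using a unfolding a_def by blast
qed

section \<open>Cylinders and their Haar measure\<close>

lemma tree_aut_bij: "g \<in> tree_aut \<Longrightarrow> bij g"
  by (simp add: tree_aut_def)

lemma tree_aut_Nil: "g \<in> tree_aut \<Longrightarrow> g [] = []"
  by (simp add: tree_aut_def)

lemma tree_aut_inj: "g \<in> tree_aut \<Longrightarrow> g v = g w \<longleftrightarrow> v = w"
  using tree_aut_bij[of g] by (auto simp: bij_def inj_def)

lemma tree_aut_f_inv: "g \<in> tree_aut \<Longrightarrow> g (inv_into UNIV g v) = v"
  using tree_aut_bij[of g] by (simp add: bij_is_surj surj_f_inv_f)

lemma tree_aut_inv_f: "g \<in> tree_aut \<Longrightarrow> inv_into UNIV g (g v) = v"
  using tree_aut_bij[of g] by (simp add: bij_is_inj)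

lemma section_at_comp:
  assumes "g \<in> tree_aut" "h \<in> tree_aut"
  shows "section_at (h \<circ> g) v = section_at h (g v) \<circ> section_at g v"
proof
  fix u
  have "h (g (v @ u)) = h (g v @ section_at g v u)" using tree_aut_append[OF assms(1)] by simp
  also have "\<dots> = h (g v) @ section_at h (g v) (section_at g v u)" by (rule tree_aut_append[OF assms(2)])
  finally show "section_at (h \<circ> g) v u = (section_at h (g v) \<circ> section_at g v) u"
    by (simp add: section_at_def[of "h \<circ> g"] tree_aut_length[OF assms(1)] tree_aut_length[OF assms(2)])
qed

lemma section_at_id [simp]: "section_at id v = id"
  by (auto simp: section_at_def)

lemma section_at_section_at: "section_at (section_at g v) u = section_at g (v @ u)"
  by (auto simp: section_at_def add.commute)

lemma section_at_tree_aut: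
  assumes g: "g \<in> tree_aut"
  shows "section_at g v \<in> tree_aut"
proof -
  have a: "g (v @ u) = g v @ section_at g v u" for u by (rule tree_aut_append[OF g])
  have "inj (section_at g v)"
    using a tree_aut_inj[OF g] by (metis injI same_append_eq)
  moreover have "\<exists>u. w = section_at g v u" for w
  proof -
    \<comment> \<open>For surjectivity: \<open>g\<close> maps prefixes to prefixes and is injective,
      so the preimage of \<open>g v @ w\<close> must begin with \<open>v\<close>.\<close>
    obtain z where z: "g z = g v @ w" using tree_aut_f_inv[OF g] by metis
    have "length (g z) = length z" by (rule tree_aut_length[OF g])
    then have l: "length v \<le> length z" using z tree_aut_length[OF g, of v] by simp
    have "g (take (length v) z) = take (length v) (g z)"
      using tree_aut_take[OF g, of "take (length v) z" "drop (length v) z"] l by (simp add: min_absorb2)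
    also have "\<dots> = g v" using z tree_aut_length[OF g, of v] by simp
    finally have "take (length v) z = v" using tree_aut_inj[OF g] by blast
    then have "z = v @ drop (length v) z" by (metis append_take_drop_id)
    then have "g z = g v @ section_at g v (drop (length v) z)" using a by metis
    then show ?thesis using z by auto
  qed
  then have "surj (section_at g v)" unfolding surj_def by blast
  moreover have "section_at g v [] = []" using a[of "[]"] by simp
  moreover have "is_child (section_at g v u) (section_at g v w) \<longleftrightarrow> is_child u w" for u w
  proof -
    have 1: "is_child (x @ u) (x @ w) \<longleftrightarrow> is_child u w" for x u w :: "'a list"
      by (simp add: is_child_def)
    have "is_child (g (v @ u)) (g (v @ w)) \<longleftrightarrow> is_child (v @ u) (v @ w)"
      using g by (simp add: tree_aut_def)
    then show ?thesis by (simp add: a 1)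
  qed
  ultimately show ?thesis by (simp add: tree_aut_def bij_def)
qed

lemma take_eq_prefix:
  assumes "take (length y) v = y"
  shows "\<exists>u. v = y @ u"
proof
  have "v = take (length y) v @ drop (length y) v" by (rule append_take_drop_id[symmetric])
  also have "\<dots> = y @ drop (length y) v" by (rule arg_cong[OF assms])
  finally show "v = y @ drop (length y) v" .
qed

text \<open>Embeds \<open>h\<close> into the rigid stabilizer of \<open>y\<close>, the automorphisms
  supported on the subtree below \<open>y\<close>.\<close>

definition insert_at :: "'d list \<Rightarrow> ('d list \<Rightarrow> 'd list) \<Rightarrow> 'd list \<Rightarrow> 'd list" where
  "insert_at y h w = (if take (length y) w = y then y @ h (drop (length y) w) else w)"

lemma insert_at_append [simp]: "insert_at y h (y @ u) = y @ h u"
  by (simp add: insert_at_def)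

lemma insert_at_other: "take (length y) w \<noteq> y \<Longrightarrow> insert_at y h w = w"
  by (simp add: insert_at_def)

lemma insert_at_level:
  assumes "h \<in> tree_aut" "length w \<le> length y"
  shows "insert_at y h w = w"
proof (cases "w = y")
  case True
  then show ?thesis using tree_aut_Nil[OF assms(1)] by (simp add: insert_at_def)
next
  case False
  then show ?thesis using assms(2) by (simp add: insert_at_def)
qed

lemma insert_at_comp: "insert_at y h \<circ> insert_at y k = insert_at y (h \<circ> k)"
proof
  fix w
  show "(insert_at y h \<circ> insert_at y k) w = insert_at y (h \<circ> k) w"
    by (cases "take (length y) w = y") (simp_all add: insert_at_def)
qed

lemma insert_at_id [simp]: "insert_at y id = id"
proof
  fix w
  show "insert_at y id w = id w"
  proof (cases "take (length y) w = y")
    case True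
    then have "y @ drop (length y) w = take (length y) w @ drop (length y) w"
      by (rule arg_cong[OF sym])
    also have "\<dots> = w" by (rule append_take_drop_id)
    finally show ?thesis using True by (simp add: insert_at_def)
  qed (simp add: insert_at_def)
qed

lemma insert_at_child:
  assumes h: "h \<in> tree_aut" and c: "is_child v w"
  shows "is_child (insert_at y h v) (insert_at y h w)"
proof -
  obtain x where w: "w = v @ [x]" using c by (auto simp: is_child_def)
  show ?thesis
  proof (cases "length v < length y")
    case True
    then have "length v \<le> length y" "length w \<le> length y" using w by auto
    then show ?thesis using insert_at_level[OF h, of v y] insert_at_level[OF h, of w y] c by simp
  next
    case False
    show ?thesis
    proof (cases "take (length y) v = y")
      case True
      then obtain u where u: "v = y @ u" using take_eq_prefix by blast
      have "is_child u (u @ [x])" by (simp add: is_child_def)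
      then have "is_child (h u) (h (u @ [x]))" using h by (simp add: tree_aut_def)
      then show ?thesis by (simp add: w u is_child_def)
    next
      case n: False
      then have "take (length y) w \<noteq> y" using False w by simp
      then show ?thesis using n c by (simp add: insert_at_other)
    qed
  qed
qed

lemma insert_at_inv: "h \<in> tree_aut \<Longrightarrow> insert_at y h \<circ> insert_at y (inv_into UNIV h) = id"
  "h \<in> tree_aut \<Longrightarrow> insert_at y (inv_into UNIV h) \<circ> insert_at y h = id"
proof -
  assume h: "h \<in> tree_aut"
  have "h \<circ> inv_into UNIV h = id" "inv_into UNIV h \<circ> h = id"
    using tree_aut_f_inv[OF h] tree_aut_inv_f[OF h] by auto
  then show "insert_at y h \<circ> insert_at y (inv_into UNIV h) = id"
    "insert_at y (inv_into UNIV h) \<circ> insert_at y h = id" by (simp_all add: insert_at_comp)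
qed

lemma inv_insert_at: "h \<in> tree_aut \<Longrightarrow> inv_into UNIV (insert_at y h) = insert_at y (inv_into UNIV h)"
  by (rule inv_unique_comp) (simp_all add: insert_at_inv)

lemma insert_at_tree_aut:
  assumes h: "h \<in> tree_aut"
  shows "insert_at y h \<in> tree_aut"
proof -
  let ?k = "insert_at y (inv_into UNIV h)"
  have k: "?k (insert_at y h w) = w" for w using fun_cong[OF insert_at_inv(2)[OF h, of y], of w] by simp
  have "bij (insert_at y h)" by (rule o_bij[OF insert_at_inv(2)[OF h] insert_at_inv(1)[OF h]])
  moreover have "insert_at y h [] = []" by (rule insert_at_level[OF h]) simp
  moreover have "is_child v w" if "is_child (insert_at y h v) (insert_at y h w)" for v w
    using insert_at_child[OF tree_aut_inv[OF h] that, of y] by (simp add: k)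
  ultimately show ?thesis unfolding tree_aut_def using insert_at_child[OF h] by blast
qed

lemma section_insert_at:
  assumes "length v = length y"
  shows "section_at (insert_at y h) v = (if v = y then h else id)"
proof
  fix u
  have "take (length y) (v @ u) = v" using assms by simp
  then show "section_at (insert_at y h) v u = (if v = y then h else id) u"
    by (simp add: section_at_def insert_at_def assms)
qed

section \<open>The group W(H) and its basic clopen sets\<close>

locale tree_group =
  fixes H :: "('d::finite \<Rightarrow> 'd) set"
  assumes H_sub: "subgroup H (BijGroup (UNIV :: 'd set))"
begin

abbreviation W where "W \<equiv> W_set H"
abbreviation G where "G \<equiv> W_group H"

lemma group_G: "group G" by (rule group_W_group[OF H_sub])

lemma G_simps [simp]: "carrier G = W" "g \<otimes>\<^bsub>G\<^esub> h = h \<circ> g" "\<one>\<^bsub>G\<^esub> = id"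
  by (simp_all add: W_group_def)

lemma W_tree: "g \<in> W \<Longrightarrow> g \<in> tree_aut"
  by (simp add: W_set_def)

lemma W_comp: "g \<in> W \<Longrightarrow> h \<in> W \<Longrightarrow> h \<circ> g \<in> W"
  using monoid.m_closed[OF group.is_monoid[OF group_G], of g h] by simp

lemma W_id: "id \<in> W"
  using monoid.one_closed[OF group.is_monoid[OF group_G]] by simp

lemma W_inv_eq: assumes "g \<in> W" shows "inv\<^bsub>G\<^esub> g = inv_into UNIV g"
proof -
  interpret group G by (rule group_G)
  have "inv\<^bsub>G\<^esub> g \<circ> g = id" "g \<circ> inv\<^bsub>G\<^esub> g = id"
    using r_inv[of g] l_inv[of g] assms by auto
  then show ?thesis using inv_unique_comp[of g "inv\<^bsub>G\<^esub> g"] by simp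
qed

lemma W_inv: "g \<in> W \<Longrightarrow> inv_into UNIV g \<in> W"
  using group.inv_closed[OF group_G, of g] W_inv_eq[of g] by simp

lemma id_H: "id \<in> H"
  using subgroup.one_closed[OF H_sub] by (simp add: BijGroup_def id_def restrict_def)

lemma W_section: "g \<in> W \<Longrightarrow> section_at g v \<in> W"
  by (simp add: W_set_def section_at_tree_aut section_at_section_at)

lemma W_insert_at:
  assumes h: "h \<in> W"
  shows "insert_at y h \<in> W"
proof -
  have "root_perm (section_at (insert_at y h) v) \<in> H" for v
  proof (cases "take (length y) v = y")
    case True
    then obtain u where u: "v = y @ u" using take_eq_prefix by blast
    have "section_at (insert_at y h) v = section_at h u" by (auto simp: section_at_def u)
    then show ?thesis using h by (simp add: W_set_def)
  next
    case False
    have "insert_at y h (v @ [x]) = v @ [x]" for x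
    proof (cases "length v < length y")
      case True
      then show ?thesis using insert_at_level[OF W_tree[OF h], of "v @ [x]" y] by simp
    next
      case len: False
      then show ?thesis using False by (simp add: insert_at_other)
    qed
    then have "root_perm (section_at (insert_at y h) v) = id"
      by (auto simp: root_perm_def section_at_def)
    then show ?thesis using id_H by simp
  qed
  then show ?thesis using insert_at_tree_aut[OF W_tree[OF h]] by (simp add: W_set_def)
qed

text \<open>For \<open>b\<close> in \<open>W\<close> this is the coset through \<open>b\<close> of
  the stabilizer of level \<open>j\<close>.\<close>

definition cyl :: "('d list \<Rightarrow> 'd list) \<Rightarrow> nat \<Rightarrow> ('d list \<Rightarrow> 'd list) set" where
  "cyl b j = {g \<in> W. \<forall>w. length w \<le> j \<longrightarrow> g w = b w}"

lemma cyl_W: "cyl b j \<subseteq> W" by (auto simp: cyl_def)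

lemma cyl_self: "b \<in> W \<Longrightarrow> b \<in> cyl b j" by (simp add: cyl_def)

lemma cyl_eq: assumes "g \<in> cyl b j" shows "cyl g j = cyl b j"
proof -
  have eq: "g w = b w" if "length w \<le> j" for w using assms that by (simp add: cyl_def)
  show ?thesis unfolding cyl_def by (rule Collect_cong, rule conj_cong, rule refl, rule all_cong) (simp add: eq)
qed

lemma cyl_0: assumes "b \<in> W" shows "cyl b 0 = W"
proof -
  have 0: "g [] = b []" if "g \<in> W" for g
    by (simp only: tree_aut_Nil[OF W_tree[OF that]] tree_aut_Nil[OF W_tree[OF assms]])
  show ?thesis
  proof
    show "W \<subseteq> cyl b 0"
    proof
      fix g assume "g \<in> W"
      then show "g \<in> cyl b 0" using 0[of g] by (simp add: cyl_def)
    qed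
  qed (rule cyl_W)
qed

lemma cyl_mono: "i \<le> j \<Longrightarrow> cyl b j \<subseteq> cyl b i" by (auto simp: cyl_def)

lemma finite_words_length: "finite {w :: 'd list. length w \<le> j}"
  using finite_lists_length_le[of "UNIV :: 'd set" j] by simp

lemma finite_cyls: "finite ((\<lambda>b. cyl b j) ` W)"
proof -
  let ?A = "{w :: 'd list. length w \<le> j}"
  let ?r = "\<lambda>b. restrict b ?A"
  have fin: "finite (?r ` W)"
  proof (rule finite_subset)
    have "restrict g ?A \<in> ?A \<rightarrow>\<^sub>E ?A" if "g \<in> W" for g
      using tree_aut_length[OF W_tree[OF that]] by (simp add: restrict_PiE_iff)
    then show "?r ` W \<subseteq> ?A \<rightarrow>\<^sub>E ?A" by blast
    show "finite (?A \<rightarrow>\<^sub>E ?A)" by (intro finite_PiE finite_words_length)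
  qed
  have "cyl b j = {g \<in> W. \<forall>w. length w \<le> j \<longrightarrow> g w = ?r b w}" for b by (auto simp: cyl_def)
  then have "(\<lambda>b. cyl b j) ` W = (\<lambda>r. {g \<in> W. \<forall>w. length w \<le> j \<longrightarrow> g w = r w}) ` ?r ` W"
    by (simp only: image_image)
  then show ?thesis using fin by (simp only: finite_imageI)
qed

text \<open>A transversal of the cylinders of depth \<open>j\<close>; finite averages over it take
  the place of Haar integrals.\<close>

definition reps :: "nat \<Rightarrow> ('d list \<Rightarrow> 'd list) set" where
  "reps j = (\<lambda>C. SOME g. g \<in> C) ` ((\<lambda>b. cyl b j) ` W)"

lemma finite_reps: "finite (reps j)"
  unfolding reps_def using finite_cyls by blast

lemma rep_cyl: "b \<in> W \<Longrightarrow> (SOME g. g \<in> cyl b j) \<in> cyl b j"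
  using cyl_self by (metis someI)

lemma reps_W: "reps j \<subseteq> W"
  unfolding reps_def using rep_cyl cyl_W by blast

lemma ex1_rep: assumes "b \<in> W" shows "\<exists>!h. h \<in> reps j \<and> h \<in> cyl b j"
proof
  let ?h = "SOME g. g \<in> cyl b j"
  show "?h \<in> reps j \<and> ?h \<in> cyl b j" using assms rep_cyl by (auto simp: reps_def)
  fix h assume h: "h \<in> reps j \<and> h \<in> cyl b j"
  then obtain b' where b': "b' \<in> W" "h = (SOME g. g \<in> cyl b' j)" by (auto simp: reps_def)
  then have "h \<in> cyl b' j" using rep_cyl by simp
  then have "cyl b' j = cyl b j" using cyl_eq[of h b' j] cyl_eq[of h b j] h by simp
  then show "h = ?h" using b' by simp
qed

lemma card_reps_pos: "0 < card (reps j)"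
  using ex1_rep[OF W_id] finite_reps card_gt_0_iff by blast

lemma disjoint_cyl_reps: "disjoint_family_on (\<lambda>h. cyl h j) (reps j)"
  unfolding disjoint_family_on_def
proof (intro ballI impI equals0I)
  fix h k g assume hk: "h \<in> reps j" "k \<in> reps j" "h \<noteq> k" and g: "g \<in> cyl h j \<inter> cyl k j"
  then have "h \<in> cyl g j" "k \<in> cyl g j" "g \<in> W" using reps_W by (auto simp: cyl_def)
  then show False using ex1_rep hk by blast
qed

lemma UN_cyl_reps: "(\<Union>h\<in>reps j. cyl h j) = W"
proof
  show "W \<subseteq> (\<Union>h\<in>reps j. cyl h j)"
  proof
    fix g assume g: "g \<in> W"
    then obtain h where h: "h \<in> reps j" "h \<in> cyl g j" using ex1_rep by blast
    then have "g \<in> cyl h j" using cyl_eq[OF h(2)] cyl_self[OF g] by simp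
    then show "g \<in> (\<Union>h\<in>reps j. cyl h j)" using h by blast
  qed
qed (use cyl_W in blast)

text \<open>The product of \<open>G\<close> is composition in reverse order, so left translation by
  \<open>k\<close> is precomposition with \<open>k\<close>; it keeps the depth because
  \<open>k\<close> preserves lengths.\<close>

lemma coset_cyl:
  assumes k: "k \<in> W" and b: "b \<in> W"
  shows "k <#\<^bsub>G\<^esub> cyl b j = cyl (b \<circ> k) j"
proof
  show "k <#\<^bsub>G\<^esub> cyl b j \<subseteq> cyl (b \<circ> k) j"
    using k W_comp tree_aut_length[OF W_tree[OF k]] by (auto simp: l_coset_def cyl_def)
  show "cyl (b \<circ> k) j \<subseteq> k <#\<^bsub>G\<^esub> cyl b j"
  proof
    fix g assume g: "g \<in> cyl (b \<circ> k) j"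
    let ?g = "g \<circ> inv_into UNIV k"
    have "?g \<in> W" using g W_inv[OF k] W_comp by (auto simp: cyl_def)
    moreover have "?g w = b w" if "length w \<le> j" for w
      using g that tree_aut_length[OF W_tree[OF W_inv[OF k]], of w] tree_aut_f_inv[OF W_tree[OF k]]
      by (auto simp: cyl_def)
    ultimately have "?g \<in> cyl b j" by (simp add: cyl_def)
    then have "k \<otimes>\<^bsub>G\<^esub> ?g \<in> k <#\<^bsub>G\<^esub> cyl b j" unfolding l_coset_def by (rule UN_I) (rule singletonI)
    moreover have "k \<otimes>\<^bsub>G\<^esub> ?g = g" using tree_aut_inv_f[OF W_tree[OF k]] by auto
    ultimately show "g \<in> k <#\<^bsub>G\<^esub> cyl b j" by (simp only:)
  qed
qed

text \<open>The empty set is included to make the family stable under intersections.\<close>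

definition cyls :: "('d list \<Rightarrow> 'd list) set set" where
  "cyls = insert {} {cyl b j | b j. b \<in> W}"

lemma cyls_Pow: "cyls \<subseteq> Pow W" using cyl_W by (auto simp: cyls_def)

lemma W_cyls: "W \<in> cyls" using cyl_0[OF W_id] W_id by (auto simp: cyls_def)

lemma countable_cyls: "countable cyls"
proof -
  have "cyls = insert {} (\<Union>j. (\<lambda>b. cyl b j) ` W)" by (auto simp: cyls_def)
  moreover have "countable (\<Union>j. (\<lambda>b. cyl b j) ` W)" using finite_cyls countable_finite by blast
  ultimately show ?thesis by simp
qed

text \<open>Two cylinders are nested or disjoint.\<close>

lemma Int_stable_cyls: "Int_stable cyls"
proof (rule Int_stableI)
  have *: "cyl b i \<inter> cyl c j \<in> cyls" if "b \<in> W" "c \<in> W" "i \<le> j" for b c i j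
  proof (cases "c \<in> cyl b i")
    case True
    then have "cyl c j \<subseteq> cyl b i" using cyl_mono[OF that(3), of c] cyl_eq[OF True] by blast
    then have "cyl b i \<inter> cyl c j = cyl c j" by blast
    then show ?thesis using that by (auto simp: cyls_def)
  next
    case False
    have "cyl b i \<inter> cyl c j = {}"
    proof (rule equals0I)
      fix g assume "g \<in> cyl b i \<inter> cyl c j"
      then have "g \<in> cyl b i" "g \<in> cyl c i" using cyl_mono[OF that(3), of c] by blast+
      then have "cyl c i = cyl b i" using cyl_eq[of g b i] cyl_eq[of g c i] by simp
      then show False using False cyl_self[OF that(2)] by blast
    qed
    then show ?thesis by (simp add: cyls_def)
  qed
  fix A B assume AB: "A \<in> cyls" "B \<in> cyls"
  show "A \<inter> B \<in> cyls"
  proof (cases "A = {} \<or> B = {}")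
    case True
    then show ?thesis by (auto simp: cyls_def)
  next
    case False
    then obtain b i c j where "A = cyl b i" "B = cyl c j" "b \<in> W" "c \<in> W"
      using AB by (auto simp: cyls_def)
    then show ?thesis using *[of b c i j] *[of c b j i] by (cases "i \<le> j") (auto simp: Int_commute)
  qed
qed

lemma openin_cyl: assumes "b \<in> W" shows "openin (W_topology H) (cyl b j)"
proof -
  let ?X = "\<lambda>w. if length w \<le> j then {b w} else UNIV"
  have fin: "finite {w :: 'd list. ?X w \<noteq> topspace (discrete_topology (UNIV :: 'd list set))}"
    by (rule finite_subset[OF _ finite_words_length[of j]]) (auto split: if_splits)
  have "openin (product_topology (\<lambda>_. discrete_topology (UNIV :: 'd list set)) UNIV) (Pi\<^sub>E UNIV ?X)"
    by (rule product_topology_basis) (use fin in auto)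
  moreover have "cyl b j = Pi\<^sub>E UNIV ?X \<inter> W"
    by (auto simp: cyl_def PiE_def Pi_def split: if_splits)
  ultimately show ?thesis unfolding W_topology_def openin_subtopology by blast
qed

text \<open>A basic open set restricts the images of finitely many vertices only, so it contains the
  cylinder through any of its points that reaches down to the deepest of these vertices.\<close>

lemma open_UN_cyls:
  assumes U: "openin (W_topology H) U"
  shows "U = \<Union> {C \<in> cyls. C \<subseteq> U}"
proof
  show "U \<subseteq> \<Union> {C \<in> cyls. C \<subseteq> U}"
  proof
    fix g assume g: "g \<in> U"
    obtain V where V: "openin (product_topology (\<lambda>_. discrete_topology (UNIV :: 'd list set)) UNIV) V" "U = V \<inter> W"
      using U unfolding W_topology_def openin_subtopology by blast
    obtain D where D: "g \<in> Pi\<^sub>E UNIV D" "finite {w. D w \<noteq> topspace (discrete_topology (UNIV :: 'd list set))}"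
      "Pi\<^sub>E UNIV D \<subseteq> V"
      using product_topology_open_contains_basis[OF V(1), of g] g V(2) by blast
    have fin: "finite {w. D w \<noteq> UNIV}" using D(2) by simp
    define j where "j = Max (insert 0 (length ` {w. D w \<noteq> UNIV}))"
    have j: "length w \<le> j" if "D w \<noteq> UNIV" for w
      unfolding j_def by (rule Max_ge) (use fin that in auto)
    have gW: "g \<in> W" using g V by blast
    have "cyl g j \<subseteq> Pi\<^sub>E UNIV D"
    proof
      fix k assume k: "k \<in> cyl g j"
      have "k w \<in> D w" for w
      proof (cases "D w = UNIV")
        case False
        then have "k w = g w" using k j by (auto simp: cyl_def)
        then show ?thesis using D(1) by auto
      qed simp
      then show "k \<in> Pi\<^sub>E UNIV D" by auto
    qed
    then have "cyl g j \<subseteq> U" using D(3) V(2) cyl_W by blast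
    moreover have "cyl g j \<in> cyls" using gW by (auto simp: cyls_def)
    ultimately show "g \<in> \<Union> {C \<in> cyls. C \<subseteq> U}" using cyl_self[OF gW] by blast
  qed
qed (rule Union_least, simp)

text \<open>There are only countably many cylinders, so every open set is a countable union of
  them.\<close>

lemma sigma_open_eq_cyls: "sigma_sets W {U. openin (W_topology H) U} = sigma_sets W cyls"
proof
  show "sigma_sets W cyls \<subseteq> sigma_sets W {U. openin (W_topology H) U}"
    by (rule sigma_sets_mono') (auto simp: cyls_def openin_cyl)
  show "sigma_sets W {U. openin (W_topology H) U} \<subseteq> sigma_sets W cyls"
  proof (rule sigma_sets_mono, rule subsetI)
    fix U assume "U \<in> {U. openin (W_topology H) U}"
    then have U: "U = \<Union> {C \<in> cyls. C \<subseteq> U}" using open_UN_cyls by blast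
    interpret sigma_algebra W "sigma_sets W cyls" by (rule sigma_algebra_sigma_sets[OF cyls_Pow])
    have "countable {C \<in> cyls. C \<subseteq> U}" using countable_cyls by (rule countable_subset[rotated]) blast
    then have "\<Union> {C \<in> cyls. C \<subseteq> U} \<in> sigma_sets W cyls"
      by (rule countable_Union) auto
    then show "U \<in> sigma_sets W cyls" using U by simp
  qed
qed

end

section \<open>Haar measure and left translations\<close>

locale haar_tree = tree_group H for H :: "('d::finite \<Rightarrow> 'd) set" +
  fixes \<mu> :: "('d list \<Rightarrow> 'd list) measure"
  assumes haar: "haar_prob (W_group H) (W_topology H) \<mu>"
begin

lemma prob_mu: "prob_space \<mu>" and space_mu: "space \<mu> = W"
  and sets_mu: "sets \<mu> = sigma_sets W cyls"
  and mu_coset: "g \<in> W \<Longrightarrow> A \<in> sets \<mu> \<Longrightarrow> g <#\<^bsub>G\<^esub> A \<in> sets \<mu> \<and> emeasure \<mu> (g <#\<^bsub>G\<^esub> A) = emeasure \<mu> A"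
proof -
  have h: "prob_space \<mu> \<and> space \<mu> = W \<and> sets \<mu> = sigma_sets W cyls \<and>
     (\<forall>g\<in>W. \<forall>A\<in>sets \<mu>. g <#\<^bsub>G\<^esub> A \<in> sets \<mu> \<and> emeasure \<mu> (g <#\<^bsub>G\<^esub> A) = emeasure \<mu> A)"
    using haar unfolding haar_prob_def sigma_open_eq_cyls G_simps by assumption
  show "prob_space \<mu>" "space \<mu> = W" "sets \<mu> = sigma_sets W cyls" using h by blast+
  show "g \<in> W \<Longrightarrow> A \<in> sets \<mu> \<Longrightarrow> g <#\<^bsub>G\<^esub> A \<in> sets \<mu> \<and> emeasure \<mu> (g <#\<^bsub>G\<^esub> A) = emeasure \<mu> A"
    using h by blast
qed

lemma cyl_sets: "b \<in> W \<Longrightarrow> cyl b j \<in> sets \<mu>"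
  unfolding sets_mu by (rule sigma_sets.Basic) (auto simp: cyls_def)

lemma left_mult_vimage:
  assumes k: "k \<in> W" and A: "A \<in> sets \<mu>"
  shows "(\<lambda>g. g \<circ> k) -` A \<inter> W = inv_into UNIV k <#\<^bsub>G\<^esub> A"
proof -
  have AW: "A \<subseteq> W" using sets.sets_into_space[OF A] space_mu by simp
  have 1: "k \<circ> inv_into UNIV k = id" "inv_into UNIV k \<circ> k = id"
    using tree_aut_f_inv[OF W_tree[OF k]] tree_aut_inv_f[OF W_tree[OF k]] by auto
  show ?thesis
  proof
    show "(\<lambda>g. g \<circ> k) -` A \<inter> W \<subseteq> inv_into UNIV k <#\<^bsub>G\<^esub> A"
    proof
      fix g assume "g \<in> (\<lambda>g. g \<circ> k) -` A \<inter> W"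
      then have "g \<circ> k \<in> A" by simp
      then have "inv_into UNIV k \<otimes>\<^bsub>G\<^esub> (g \<circ> k) \<in> inv_into UNIV k <#\<^bsub>G\<^esub> A"
        unfolding l_coset_def by (rule UN_I) (rule singletonI)
      moreover have "inv_into UNIV k \<otimes>\<^bsub>G\<^esub> (g \<circ> k) = g" using 1 by (simp add: comp_assoc)
      ultimately show "g \<in> inv_into UNIV k <#\<^bsub>G\<^esub> A" by (simp only:)
    qed
    show "inv_into UNIV k <#\<^bsub>G\<^esub> A \<subseteq> (\<lambda>g. g \<circ> k) -` A \<inter> W"
      using AW W_comp[OF W_inv[OF k]] 1 by (auto simp: l_coset_def comp_assoc)
  qed
qed

lemma left_mult_measurable:
  assumes k: "k \<in> W"
  shows "(\<lambda>g. g \<circ> k) \<in> measurable \<mu> \<mu>"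
proof (rule measurableI)
  fix g assume "g \<in> space \<mu>"
  then show "g \<circ> k \<in> space \<mu>" using W_comp[OF k, of g] by (simp only: space_mu)
next
  fix A assume A: "A \<in> sets \<mu>"
  show "(\<lambda>g. g \<circ> k) -` A \<inter> space \<mu> \<in> sets \<mu>"
    unfolding space_mu left_mult_vimage[OF k A] using mu_coset[OF W_inv[OF k] A] by (rule conjunct1)
qed

lemma left_mult_emeasure:
  assumes k: "k \<in> W" and A: "A \<in> sets \<mu>"
  shows "emeasure \<mu> ((\<lambda>g. g \<circ> k) -` A \<inter> W) = emeasure \<mu> A"
  unfolding left_mult_vimage[OF k A] using mu_coset[OF W_inv[OF k] A] by (rule conjunct2)

text \<open>Left translations permute the cylinders of a given depth transitively, and these
  partition \<open>W\<close>.\<close>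

lemma measure_cyl: assumes b: "b \<in> W" shows "measure \<mu> (cyl b j) = 1 / card (reps j)"
proof -
  interpret prob_space \<mu> by (rule prob_mu)
  have eq: "measure \<mu> (cyl c j) = measure \<mu> (cyl b j)" if c: "c \<in> W" for c
  proof -
    let ?k = "inv_into UNIV b \<circ> c"
    have k: "?k \<in> W" using W_comp[OF c W_inv[OF b]] .
    have "b \<circ> ?k = c" using tree_aut_f_inv[OF W_tree[OF b]] by auto
    then have "?k <#\<^bsub>G\<^esub> cyl b j = cyl c j" using coset_cyl[OF k b] by simp
    then show ?thesis using mu_coset[OF k cyl_sets[OF b], of j] by (simp add: measure_def)
  qed
  have "1 = measure \<mu> (\<Union>h\<in>reps j. cyl h j)" using prob_space space_mu UN_cyl_reps by simp
  also have "\<dots> = (\<Sum>h\<in>reps j. measure \<mu> (cyl h j))"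
    by (rule finite_measure_finite_Union[OF finite_reps _ disjoint_cyl_reps]) (use cyl_sets reps_W in auto)
  also have "\<dots> = (\<Sum>h\<in>reps j. measure \<mu> (cyl b j))"
    by (rule sum.cong) (use eq reps_W in blast)+
  finally have "1 = real (card (reps j)) * measure \<mu> (cyl b j)" by simp
  then show ?thesis using card_reps_pos[of j] by (simp add: field_simps)
qed

end

section \<open>Independence of sections along loops\<close>

text \<open>\<open>fold (lact g) w\<close> applies the letters from left to right, as the right
  action requires; by \<open>free_hom_fold\<close> it is the image of \<open>w\<close> under the
  homomorphism.\<close>

definition lact :: "(nat \<Rightarrow> 'd list \<Rightarrow> 'd list) \<Rightarrow> letter \<Rightarrow> 'd list \<Rightarrow> 'd list" where
  "lact g l = (if snd l then g (fst l) else inv_into UNIV (g (fst l)))"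

lemma inv_letter_neq [simp]: "inv_letter a \<noteq> a" "a \<noteq> inv_letter a"
  by (auto simp: inv_letter_def prod_eq_iff)

lemma avoids_append: "avoids la x y (u @ w) v \<longleftrightarrow> avoids la x y u v \<and> avoids la x y w (fold la u v)"
  by (induction u arbitrary: v) auto

text \<open>The edge labelled \<open>x\<close> at \<open>y\<close> is the edge labelled
  \<open>inv_letter x\<close> at \<open>za x y\<close>, read from its other end.\<close>

lemma (in letter_action) avoids_inv_letter:
  assumes "x \<in> L"
  shows "avoids za x y w u \<longleftrightarrow> avoids za (inv_letter x) (za x y) w u"
proof (induction w arbitrary: u)
  case (Cons l w)
  have 1: "za (inv_letter x) u = y \<longleftrightarrow> u = za x y"
    using za_inv[OF assms, of y] za_inv'[OF assms, of u] by metis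
  have 2: "za x u = za x y \<longleftrightarrow> u = y"
    using za_inv[OF assms] by metis
  show ?case using Cons[of "za l u"] 1 2 by auto
qed simp

section \<open>Random homomorphisms into W(H)\<close>

locale random_action = haar_tree H \<mu>
  for H :: "('d::finite \<Rightarrow> 'd) set" and \<mu> :: "('d list \<Rightarrow> 'd list) measure" +
  fixes m :: nat
begin

abbreviation M where "M \<equiv> PiM {..<m} (\<lambda>_. \<mu>)"

definition Lt :: "letter set" where "Lt = {l. fst l < m}"

sublocale P: product_prob_space "\<lambda>_. \<mu>" "{..<m}"
  by (rule product_prob_spaceI) (rule prob_mu)

lemma space_M: "space M = (\<Pi>\<^sub>E i\<in>{..<m}. W)"
  by (simp add: space_PiM space_mu)

lemma space_W: "g \<in> space M \<Longrightarrow> i < m \<Longrightarrow> g i \<in> W"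
  using PiE_mem[of g "{..<m}" "\<lambda>_. W" i] by (simp add: space_M)

lemma lact_W: "g \<in> space M \<Longrightarrow> l \<in> Lt \<Longrightarrow> lact g l \<in> W"
  using space_W[of g "fst l"] W_inv[of "g (fst l)"] by (simp add: lact_def Lt_def)

lemma fold_W: "g \<in> space M \<Longrightarrow> set w \<subseteq> Lt \<Longrightarrow> fold (lact g) w \<in> W"
proof (induction w)
  case Nil
  then show ?case using W_id by (simp add: id_def[symmetric])
next
  case (Cons l w)
  then have "fold (lact g) w \<circ> lact g l \<in> W" using W_comp[OF lact_W[of g l]] by simp
  then show ?case by (simp add: comp_def)
qed

lemma length_fold: "g \<in> space M \<Longrightarrow> set w \<subseteq> Lt \<Longrightarrow> length (fold (lact g) w v) = length v"
  by (rule tree_aut_length[OF W_tree[OF fold_W]])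

lemma length_lact: "g \<in> space M \<Longrightarrow> l \<in> Lt \<Longrightarrow> length (lact g l v) = length v"
  by (rule tree_aut_length[OF W_tree[OF lact_W]])

lemma letter_action_lact:
  assumes g: "g \<in> space M"
  shows "letter_action Lt (lact g)"
proof
  fix a v assume a: "a \<in> Lt"
  then show "inv_letter a \<in> Lt" by (simp add: Lt_def)
  have t: "g (fst a) \<in> tree_aut" using W_tree[OF space_W[OF g]] a by (simp add: Lt_def)
  show "lact g (inv_letter a) (lact g a v) = v"
    using tree_aut_f_inv[OF t, of v] tree_aut_inv_f[OF t, of v] by (simp add: lact_def inv_letter_def)
qed

lemma free_hom_fold:
  assumes g: "g \<in> space M" and w: "set w \<subseteq> Lt"
  shows "free_hom G g w = fold (lact g) w"
  using w
proof (induction w)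
  case Nil
  then show ?case by (simp add: free_hom_Nil id_def[symmetric])
next
  case (Cons a w)
  have "eval_letter G g a = lact g a"
    using W_inv_eq[OF space_W[OF g, of "fst a"]] Cons.prems by (simp add: eval_letter_def lact_def Lt_def)
  then show ?case using Cons by (simp add: free_hom_Cons)
qed

section \<open>Events determined by the action on one level\<close>

definition agree :: "nat \<Rightarrow> (nat \<Rightarrow> 'd list \<Rightarrow> 'd list) \<Rightarrow> (nat \<Rightarrow> 'd list \<Rightarrow> 'd list) \<Rightarrow> bool" where
  "agree n g g' \<longleftrightarrow> (\<forall>i<m. \<forall>u. length u \<le> n \<longrightarrow> g i u = g' i u)"

lemma agree_sym: "agree n g g' \<Longrightarrow> agree n g' g"
  by (simp add: agree_def)

lemma agree_trans: "agree n g g' \<Longrightarrow> agree n g' g'' \<Longrightarrow> agree n g g''"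
  by (simp add: agree_def)

lemma agree_refl: "agree n g g"
  by (simp add: agree_def)

lemma agree_mono: "agree n g g' \<Longrightarrow> k \<le> n \<Longrightarrow> agree k g g'"
  by (simp add: agree_def)

lemma lact_agree:
  assumes g: "g \<in> space M" "g' \<in> space M" and a: "agree n g g'" and l: "l \<in> Lt" and u: "length u \<le> n"
  shows "lact g l u = lact g' l u"
proof -
  have i: "fst l < m" using l by (simp add: Lt_def)
  show ?thesis
  proof (cases "snd l")
    case True
    then show ?thesis using a i u by (simp add: lact_def agree_def)
  next
    case False
    let ?g = "g (fst l)" and ?g' = "g' (fst l)"
    have t: "?g \<in> tree_aut" "?g' \<in> tree_aut" using W_tree[OF space_W] g i by blast+
    let ?u = "inv_into UNIV ?g u"
    have "length ?u \<le> n" using tree_aut_length[OF tree_aut_inv[OF t(1)], of u] u by simp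
    then have "?g' ?u = ?g ?u" using a i by (simp add: agree_def)
    also have "\<dots> = u" by (rule tree_aut_f_inv[OF t(1)])
    finally have "inv_into UNIV ?g' u = ?u" using tree_aut_inv_f[OF t(2), of ?u] by simp
    then show ?thesis using False by (simp add: lact_def)
  qed
qed

lemma fold_agree:
  assumes g: "g \<in> space M" "g' \<in> space M" and a: "agree n g g'"
  shows "set w \<subseteq> Lt \<Longrightarrow> length u \<le> n \<Longrightarrow> fold (lact g) w u = fold (lact g') w u"
proof (induction w arbitrary: u)
  case (Cons l w)
  have 1: "lact g l u = lact g' l u" using lact_agree[OF g a, of l u] Cons.prems by simp
  have "length (lact g' l u) \<le> n" using length_lact[OF g(2), of l u] Cons.prems by simp
  then show ?case using Cons.IH[of "lact g' l u"] Cons.prems 1 by simp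
qed simp

lemma avoids_agree:
  assumes g: "g \<in> space M" "g' \<in> space M" and a: "agree n g g'"
  shows "set w \<subseteq> Lt \<Longrightarrow> length u \<le> n \<Longrightarrow> avoids (lact g) x y w u = avoids (lact g') x y w u"
proof (induction w arbitrary: u)
  case (Cons l w)
  have 1: "lact g l u = lact g' l u" using lact_agree[OF g a, of l u] Cons.prems by simp
  have "length (lact g' l u) \<le> n" using length_lact[OF g(2), of l u] Cons.prems by simp
  then show ?case using Cons.IH[of "lact g' l u"] Cons.prems 1 by simp
qed simp

text \<open>On \<open>space M\<close> this says that \<open>Q\<close> belongs to the finite
  sigma-algebra generated by the action of the generators on level \<open>n\<close>; the sets
  \<open>atom n g\<close> are its atoms.\<close>

definition determined :: "nat \<Rightarrow> ((nat \<Rightarrow> 'd list \<Rightarrow> 'd list) \<Rightarrow> bool) \<Rightarrow> bool" where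
  "determined n Q \<longleftrightarrow> (\<forall>g\<in>space M. \<forall>g'\<in>space M. agree n g g' \<longrightarrow> Q g = Q g')"

definition atom :: "nat \<Rightarrow> (nat \<Rightarrow> 'd list \<Rightarrow> 'd list) \<Rightarrow> (nat \<Rightarrow> 'd list \<Rightarrow> 'd list) set" where
  "atom n g = {g' \<in> space M. agree n g g'}"

lemma atom_eq_cyl:
  assumes g: "g \<in> space M"
  shows "atom n g = (\<Pi>\<^sub>E i\<in>{..<m}. cyl (g i) n)"
proof
  show "atom n g \<subseteq> (\<Pi>\<^sub>E i\<in>{..<m}. cyl (g i) n)"
    unfolding atom_def space_M agree_def cyl_def by (auto simp: PiE_def Pi_def)
  show "(\<Pi>\<^sub>E i\<in>{..<m}. cyl (g i) n) \<subseteq> atom n g"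
    unfolding atom_def space_M agree_def cyl_def by (auto simp: PiE_def Pi_def)
qed

lemma atom_sets:
  assumes g: "g \<in> space M"
  shows "atom n g \<in> sets M"
  unfolding atom_eq_cyl[OF g]
proof (rule sets_PiM_I_finite[OF finite_lessThan])
  fix i assume "i \<in> {..<m}"
  then show "cyl (g i) n \<in> sets \<mu>" using cyl_sets[OF space_W[OF g]] by simp
qed

lemma finite_atoms: "finite (atom n ` space M)"
proof -
  have "atom n ` space M \<subseteq> (\<lambda>C. \<Pi>\<^sub>E i\<in>{..<m}. C i) ` (\<Pi>\<^sub>E i\<in>{..<m}. (\<lambda>b. cyl b n) ` W)"
  proof
    fix A assume "A \<in> atom n ` space M"
    then obtain g where g: "g \<in> space M" "A = atom n g" by blast
    let ?C = "\<lambda>i\<in>{..<m}. cyl (g i) n"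
    have 1: "?C \<in> (\<Pi>\<^sub>E i\<in>{..<m}. (\<lambda>b. cyl b n) ` W)" using space_W[OF g(1)] by (auto simp: PiE_def)
    have "A = (\<Pi>\<^sub>E i\<in>{..<m}. ?C i)" unfolding g(2) atom_eq_cyl[OF g(1)] by (rule PiE_cong) simp
    then show "A \<in> (\<lambda>C. \<Pi>\<^sub>E i\<in>{..<m}. C i) ` (\<Pi>\<^sub>E i\<in>{..<m}. (\<lambda>b. cyl b n) ` W)"
      using 1 by (rule image_eqI)
  qed
  moreover have "finite (\<Pi>\<^sub>E i\<in>{..<m}. (\<lambda>b. cyl b n) ` W)" by (rule finite_PiE) (simp_all add: finite_cyls)
  ultimately show ?thesis by (rule finite_surj[rotated])
qed

lemma disjoint_atoms:
  assumes "A \<in> atom n ` space M" "B \<in> atom n ` space M" "A \<noteq> B"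
  shows "A \<inter> B = {}"
proof (rule equals0I)
  fix g assume "g \<in> A \<inter> B"
  moreover obtain a b where ab: "A = atom n a" "B = atom n b" using assms by blast
  ultimately have "agree n a g" "agree n b g" by (auto simp: atom_def)
  then have "agree n a b" using agree_trans agree_sym by blast
  then have "A = B" unfolding ab atom_def using agree_trans agree_sym by blast
  then show False using assms by blast
qed

lemma determined_UN:
  assumes "determined n Q"
  shows "{g \<in> space M. Q g} = \<Union> {A \<in> atom n ` space M. A \<subseteq> {g \<in> space M. Q g}}"
proof
  show "{g \<in> space M. Q g} \<subseteq> \<Union> {A \<in> atom n ` space M. A \<subseteq> {g \<in> space M. Q g}}"
  proof
    fix g assume g: "g \<in> {g \<in> space M. Q g}"
    then have "atom n g \<subseteq> {g \<in> space M. Q g}"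
      using assms unfolding atom_def determined_def by blast
    moreover have "g \<in> atom n g" using g agree_refl by (simp add: atom_def)
    ultimately show "g \<in> \<Union> {A \<in> atom n ` space M. A \<subseteq> {g \<in> space M. Q g}}" using g by blast
  qed
qed (rule Union_least, simp)

lemma determined_sets:
  assumes "determined n Q"
  shows "{g \<in> space M. Q g} \<in> sets M"
proof -
  have "finite {A \<in> atom n ` space M. A \<subseteq> {g \<in> space M. Q g}}" using finite_atoms by simp
  then have "\<Union> {A \<in> atom n ` space M. A \<subseteq> {g \<in> space M. Q g}} \<in> sets M"
    by (rule sets.finite_Union) (use atom_sets in auto)
  then show ?thesis by (simp only: determined_UN[OF assms, symmetric])
qed

section \<open>Sections along words and the change of one edge label\<close>

definition sec :: "(nat \<Rightarrow> 'd list \<Rightarrow> 'd list) \<Rightarrow> letter list \<Rightarrow> 'd list \<Rightarrow> 'd list \<Rightarrow> 'd list" where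
  "sec g w v = section_at (fold (lact g) w) v"

lemma sec_W: "g \<in> space M \<Longrightarrow> set w \<subseteq> Lt \<Longrightarrow> sec g w v \<in> W"
  unfolding sec_def by (intro W_section fold_W)

lemma sec_append:
  assumes "g \<in> space M" "set u \<subseteq> Lt" "set w \<subseteq> Lt"
  shows "sec g (u @ w) v = sec g w (fold (lact g) u v) \<circ> sec g u v"
  unfolding sec_def fold_append
  by (rule section_at_comp[OF W_tree[OF fold_W[OF assms(1,2)]] W_tree[OF fold_W[OF assms(1,3)]]])

lemma sec_agree:
  assumes "g \<in> space M" "g' \<in> space M" "agree n g g'" "set w \<subseteq> Lt" "length v + length u \<le> n"
  shows "sec g w v u = sec g' w v u"
  unfolding sec_def section_at_def using fold_agree[OF assms(1-4), of "v @ u"] assms(5) by simp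

text \<open>For \<open>h\<close> in \<open>W\<close> this multiplies the section of generator
  \<open>i\<close> at \<open>y\<close> by \<open>h\<close> and changes neither the other sections on
  the level of \<open>y\<close> nor the action on that level. In the group it is a left
  multiplication of one coordinate.\<close>

definition shift :: "nat \<Rightarrow> 'd list \<Rightarrow> ('d list \<Rightarrow> 'd list) \<Rightarrow> (nat \<Rightarrow> 'd list \<Rightarrow> 'd list) \<Rightarrow> nat \<Rightarrow> 'd list \<Rightarrow> 'd list" where
  "shift i y h g = g(i := g i \<circ> insert_at y h)"

lemma shift_space:
  assumes g: "g \<in> space M" and i: "i < m" and h: "h \<in> W"
  shows "shift i y h g \<in> space M"
proof -
  have "g i \<circ> insert_at y h \<in> W" by (rule W_comp[OF W_insert_at[OF h] space_W[OF g i]])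
  then have "g(i := g i \<circ> insert_at y h) \<in> (\<Pi>\<^sub>E j\<in>insert i {..<m}. W)"
    by (rule PiE_fun_upd) (use g in \<open>simp only: space_M\<close>)
  moreover have "insert i {..<m} = {..<m}" using i by blast
  ultimately show ?thesis unfolding space_M shift_def by (simp only:)
qed

lemma shift_agree: assumes "h \<in> W" shows "agree (length y) g (shift i y h g)"
  unfolding agree_def shift_def by (simp add: insert_at_level[OF W_tree[OF assms]])

lemma shift_measurable:
  assumes i: "i < m" and h: "h \<in> W"
  shows "shift i y h \<in> measurable M M"
proof -
  have 1: "(\<lambda>g. g i) \<in> measurable M \<mu>" by (rule measurable_component_singleton) (use i in simp)
  have 2: "(\<lambda>f. f \<circ> insert_at y h) \<in> measurable \<mu> \<mu>" by (rule left_mult_measurable[OF W_insert_at[OF h]])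
  have 3: "(\<lambda>g. g i \<circ> insert_at y h) \<in> measurable M \<mu>" using measurable_comp[OF 1 2] by (simp only: comp_def)
  have "{..<m} = {..<m} \<union> {i}" using i by blast
  then have "(\<lambda>g. g(i := g i \<circ> insert_at y h)) \<in> measurable M M"
    by (rule measurable_fun_upd[OF _ measurable_ident_sets[OF refl] 3])
  then show ?thesis unfolding shift_def .
qed

text \<open>On boxes the claim is the left invariance of \<open>\<mu>\<close> in the coordinate
  \<open>i\<close>.\<close>

lemma shift_distr:
  assumes i: "i < m" and h: "h \<in> W"
  shows "distr M M (shift i y h) = M"
proof (rule P.PiM_eqI[OF finite_lessThan])
  show "sets (distr M M (shift i y h)) = sets M" by simp
  fix A assume A: "\<And>j. j \<in> {..<m} \<Longrightarrow> A j \<in> sets \<mu>"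
  let ?k = "insert_at y h"
  have k: "?k \<in> W" by (rule W_insert_at[OF h])
  let ?A = "A(i := (\<lambda>f. f \<circ> ?k) -` A i \<inter> W)"
  have A': "?A j \<in> sets \<mu>" if "j \<in> {..<m}" for j
    using A[OF that] measurable_sets[OF left_mult_measurable[OF k], of "A i"]
    by (cases "j = i") (simp_all add: space_mu)
  have "emeasure (distr M M (shift i y h)) (Pi\<^sub>E {..<m} A) = emeasure M (shift i y h -` Pi\<^sub>E {..<m} A \<inter> space M)"
    by (rule emeasure_distr[OF shift_measurable[OF i h]]) (intro sets_PiM_I_finite A finite_lessThan)
  also have "shift i y h -` Pi\<^sub>E {..<m} A \<inter> space M = Pi\<^sub>E {..<m} ?A"
  proof
    show "shift i y h -` Pi\<^sub>E {..<m} A \<inter> space M \<subseteq> Pi\<^sub>E {..<m} ?A"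
    proof
      fix g assume "g \<in> shift i y h -` Pi\<^sub>E {..<m} A \<inter> space M"
      then have g: "g \<in> space M" "shift i y h g \<in> Pi\<^sub>E {..<m} A" by blast+
      show "g \<in> Pi\<^sub>E {..<m} ?A"
      proof (rule PiE_I)
        fix j assume j: "j \<in> {..<m}"
        have "shift i y h g j \<in> A j" by (rule PiE_mem[OF g(2) j])
        then show "g j \<in> ?A j" using space_W[OF g(1) i] by (cases "j = i") (simp_all add: shift_def)
      next
        fix j assume "j \<notin> {..<m}"
        then show "g j = undefined" using g(1) PiE_arb unfolding space_M by fastforce
      qed
    qed
    show "Pi\<^sub>E {..<m} ?A \<subseteq> shift i y h -` Pi\<^sub>E {..<m} A \<inter> space M"
    proof
      fix g assume g: "g \<in> Pi\<^sub>E {..<m} ?A"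
      have gA: "g j \<in> ?A j" if "j \<in> {..<m}" for j by (rule PiE_mem[OF g that])
      have gW: "g j \<in> W" if j: "j \<in> {..<m}" for j
        using gA[OF j] sets.sets_into_space[OF A'[OF j]] by (simp only: space_mu subset_iff)
      have undef: "g j = undefined" if "j \<notin> {..<m}" for j by (rule PiE_arb[OF g that])
      have "g \<in> space M" unfolding space_M by (rule PiE_I) (fact gW undef)+
      moreover have "shift i y h g \<in> Pi\<^sub>E {..<m} A"
      proof (rule PiE_I)
        fix j assume j: "j \<in> {..<m}"
        show "shift i y h g j \<in> A j" using gA[OF j] by (cases "j = i") (simp_all add: shift_def)
      next
        fix j assume "j \<notin> {..<m}"
        then show "shift i y h g j = undefined" using undef i by (auto simp: shift_def)
      qed
      ultimately show "g \<in> shift i y h -` Pi\<^sub>E {..<m} A \<inter> space M" by blast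
    qed
  qed
  also have "emeasure M (Pi\<^sub>E {..<m} ?A) = (\<Prod>j\<in>{..<m}. emeasure \<mu> (?A j))"
    by (rule P.emeasure_PiM[OF finite_lessThan A'])
  also have "\<dots> = (\<Prod>j\<in>{..<m}. emeasure \<mu> (A j))"
  proof (rule prod.cong[OF refl])
    fix j assume "j \<in> {..<m}"
    then show "emeasure \<mu> (?A j) = emeasure \<mu> (A j)"
      using left_mult_emeasure[OF k A] by (cases "j = i") simp_all
  qed
  finally show "emeasure (distr M M (shift i y h)) (Pi\<^sub>E {..<m} A) = (\<Prod>j\<in>{..<m}. emeasure \<mu> (A j))" .
qed

lemma shift_measure:
  assumes i: "i < m" and h: "h \<in> W" and A: "A \<in> sets M"
  shows "measure M {g \<in> space M. shift i y h g \<in> A} = measure M A"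
proof -
  have "measure M A = measure (distr M M (shift i y h)) A" by (simp only: shift_distr[OF i h])
  also have "\<dots> = measure M (shift i y h -` A \<inter> space M)"
    by (rule measure_distr[OF shift_measurable[OF i h] A])
  also have "shift i y h -` A \<inter> space M = {g \<in> space M. shift i y h g \<in> A}" by blast
  finally show ?thesis ..
qed

lemma cyl_iff: "b \<in> W \<Longrightarrow> g \<in> W \<Longrightarrow> g \<in> cyl b j \<longleftrightarrow> (\<forall>w. length w \<le> j \<longrightarrow> g w = b w)"
  by (simp add: cyl_def)

text \<open>Composition with automorphisms on either side preserves agreement down to a given level,
  so it permutes the cylinders of that depth.\<close>

lemma cyl_translate:
  assumes A: "A \<in> W" and C: "C \<in> W" and b: "b \<in> W"
  shows "\<exists>b'\<in>W. \<forall>h\<in>W. C \<circ> h \<circ> A \<in> cyl b j \<longleftrightarrow> h \<in> cyl b' j"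
proof
  let ?b = "inv_into UNIV C \<circ> b \<circ> inv_into UNIV A"
  show b': "?b \<in> W" by (intro W_comp W_inv A b C)
  have tA: "A \<in> tree_aut" and tC: "C \<in> tree_aut" using A C W_tree by blast+
  show "\<forall>h\<in>W. C \<circ> h \<circ> A \<in> cyl b j \<longleftrightarrow> h \<in> cyl ?b j"
  proof
    fix h assume h: "h \<in> W"
    have ch: "C \<circ> h \<circ> A \<in> W" by (intro W_comp A C h)
    show "C \<circ> h \<circ> A \<in> cyl b j \<longleftrightarrow> h \<in> cyl ?b j"
      unfolding cyl_iff[OF b ch] cyl_iff[OF b' h]
    proof safe
      fix w :: "'d list" assume a: "\<forall>w. length w \<le> j \<longrightarrow> (C \<circ> h \<circ> A) w = b w" and w: "length w \<le> j"
      have "length (inv_into UNIV A w) \<le> j" using tree_aut_length[OF tree_aut_inv[OF tA], of w] w by simp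
      then have "C (h w) = b (inv_into UNIV A w)"
        using a[rule_format, of "inv_into UNIV A w"] tree_aut_f_inv[OF tA, of w] by simp
      then show "h w = ?b w" using tree_aut_inv_f[OF tC, of "h w"] by simp
    next
      fix w :: "'d list" assume a: "\<forall>w. length w \<le> j \<longrightarrow> h w = ?b w" and w: "length w \<le> j"
      have "length (A w) \<le> j" using tree_aut_length[OF tA, of w] w by simp
      then have "h (A w) = inv_into UNIV C (b w)" using a tree_aut_inv_f[OF tA, of w] by simp
      then show "(C \<circ> h \<circ> A) w = b w" using tree_aut_f_inv[OF tC, of "b w"] by simp
    qed
  qed
qed

text \<open>Inversion permutes the cylinders as well; this case occurs when a loop crosses its edge
  with an inverse letter.\<close>

lemma cyl_translate_inv:
  assumes A: "A \<in> W" and C: "C \<in> W" and b: "b \<in> W"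
  shows "\<exists>b'\<in>W. \<forall>h\<in>W. C \<circ> inv_into UNIV h \<circ> A \<in> cyl b j \<longleftrightarrow> h \<in> cyl b' j"
proof
  let ?b = "A \<circ> inv_into UNIV b \<circ> C"
  show b': "?b \<in> W" by (intro W_comp W_inv A b C)
  have tA: "A \<in> tree_aut" and tC: "C \<in> tree_aut" and tb: "b \<in> tree_aut" using A C b W_tree by blast+
  show "\<forall>h\<in>W. C \<circ> inv_into UNIV h \<circ> A \<in> cyl b j \<longleftrightarrow> h \<in> cyl ?b j"
  proof
    fix h assume h: "h \<in> W"
    have th: "h \<in> tree_aut" using h W_tree by blast
    have ch: "C \<circ> inv_into UNIV h \<circ> A \<in> W" by (intro W_comp W_inv A C h)
    show "C \<circ> inv_into UNIV h \<circ> A \<in> cyl b j \<longleftrightarrow> h \<in> cyl ?b j"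
      unfolding cyl_iff[OF b ch] cyl_iff[OF b' h]
    proof safe
      fix w :: "'d list" assume a: "\<forall>w. length w \<le> j \<longrightarrow> (C \<circ> inv_into UNIV h \<circ> A) w = b w" and w: "length w \<le> j"
      let ?u = "inv_into UNIV b (C w)"
      have "length ?u \<le> j"
        using tree_aut_length[OF tree_aut_inv[OF tb], of "C w"] tree_aut_length[OF tC, of w] w by simp
      then have "C (inv_into UNIV h (A ?u)) = C w" using a tree_aut_f_inv[OF tb, of "C w"] by simp
      then have "inv_into UNIV h (A ?u) = w" by (simp only: tree_aut_inj[OF tC])
      then show "h w = ?b w" using tree_aut_f_inv[OF th, of "A ?u"] by simp
    next
      fix w :: "'d list" assume a: "\<forall>w. length w \<le> j \<longrightarrow> h w = ?b w" and w: "length w \<le> j"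
      let ?u = "inv_into UNIV C (b w)"
      have "length ?u \<le> j"
        using tree_aut_length[OF tree_aut_inv[OF tC], of "b w"] tree_aut_length[OF tb, of w] w by simp
      then have "h ?u = A w" using a tree_aut_f_inv[OF tC, of "b w"] tree_aut_inv_f[OF tb, of w] by simp
      then have "inv_into UNIV h (A w) = ?u" using tree_aut_inv_f[OF th, of ?u] by simp
      then show "(C \<circ> inv_into UNIV h \<circ> A) w = b w" using tree_aut_f_inv[OF tC, of "b w"] by simp
    qed
  qed
qed

lemma shift_lact:
  assumes g: "g \<in> space M" and i: "i < m" and h: "h \<in> W" and l: "l \<in> Lt" and v: "length v = length y"
  shows "section_at (lact (shift i y h g) l) v =
    (if l = (i, True) \<and> v = y then section_at (lact g l) v \<circ> h
     else if l = (i, False) \<and> lact g l v = y then inv_into UNIV h \<circ> section_at (lact g l) v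
     else section_at (lact g l) v)"
proof (cases "fst l = i")
  case False
  then have "lact (shift i y h g) l = lact g l" by (simp add: lact_def shift_def)
  then show ?thesis using False by auto
next
  case fst: True
  let ?k = "insert_at y h"
  have th: "h \<in> tree_aut" using h W_tree by blast
  have tg: "g i \<in> tree_aut" using space_W[OF g i] W_tree by blast
  have tk: "?k \<in> tree_aut" "insert_at y (inv_into UNIV h) \<in> tree_aut"
    using insert_at_tree_aut tree_aut_inv th by blast+
  show ?thesis
  proof (cases "snd l")
    case True
    then have l': "l = (i, True)" using fst by (simp add: prod_eq_iff)
    have "lact (shift i y h g) l = g i \<circ> ?k" by (simp add: lact_def shift_def l')
    then have "section_at (lact (shift i y h g) l) v = section_at (g i) (?k v) \<circ> section_at ?k v"
      using section_at_comp[OF tk(1) tg] by simp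
    moreover have "?k v = v" using insert_at_level[OF th] v by simp
    ultimately show ?thesis using section_insert_at[OF v, of h] by (simp add: l' lact_def)
  next
    case False
    then have l': "l = (i, False)" using fst by (simp add: prod_eq_iff)
    let ?gi = "inv_into UNIV (g i)"
    have ti: "?gi \<in> tree_aut" by (rule tree_aut_inv[OF tg])
    have "lact (shift i y h g) l = inv_into UNIV (g i \<circ> ?k)" by (simp add: lact_def shift_def l')
    also have "\<dots> = inv_into UNIV ?k \<circ> ?gi"
      by (rule o_inv_distrib) (use tree_aut_bij tg tk in auto)
    also have "inv_into UNIV ?k = insert_at y (inv_into UNIV h)" by (rule inv_insert_at[OF th])
    finally have "section_at (lact (shift i y h g) l) v =
      section_at (insert_at y (inv_into UNIV h)) (?gi v) \<circ> section_at ?gi v"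
      by (simp only: section_at_comp[OF ti tk(2)])
    moreover have "length (?gi v) = length y" using tree_aut_length[OF ti] v by simp
    ultimately show ?thesis using section_insert_at[of "?gi v" y "inv_into UNIV h"] by (simp add: l' lact_def)
  qed
qed

lemma sec_Cons:
  assumes "g \<in> space M" "l \<in> Lt" "set w \<subseteq> Lt"
  shows "sec g (l # w) v = sec g w (lact g l v) \<circ> section_at (lact g l) v"
  using sec_append[of g "[l]" w v] assms by (simp add: sec_def)

text \<open>The section along the walk is a product of sections of the letters at the vertices
  visited, and none of these factors is the one that \<open>shift\<close> changes.\<close>

lemma sec_shift_avoids:
  assumes g: "g \<in> space M" and i: "i < m" and h: "h \<in> W"
  shows "set w \<subseteq> Lt \<Longrightarrow> length v = length y \<Longrightarrow> avoids (lact g) (i, True) y w v \<Longrightarrow>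
    sec (shift i y h g) w v = sec g w v"
proof (induction w arbitrary: v)
  case Nil
  then show ?case by (simp add: sec_def)
next
  case (Cons l w)
  let ?g = "shift i y h g"
  have g': "?g \<in> space M" by (rule shift_space[OF g i h])
  have l: "l \<in> Lt" and w: "set w \<subseteq> Lt" using Cons.prems by simp_all
  have 1: "lact ?g l v = lact g l v"
    using lact_agree[OF g g' shift_agree[OF h] l, of v] Cons.prems(2) by simp
  have 2: "section_at (lact ?g l) v = section_at (lact g l) v"
    using shift_lact[OF g i h l Cons.prems(2)] Cons.prems(3) by (auto simp: inv_letter_def)
  have 3: "sec ?g w (lact g l v) = sec g w (lact g l v)"
    using Cons.IH[OF w, of "lact g l v"] length_lact[OF g l, of v] Cons.prems(2,3) by simp
  show ?case unfolding sec_Cons[OF g l w] sec_Cons[OF g' l w] 1 2 3 ..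
qed

text \<open>\<open>shift\<close> acts on generators only, so an edge labelled with an inverse letter
  is described from its other end.\<close>

definition edge_src :: "(nat \<Rightarrow> 'd list \<Rightarrow> 'd list) \<Rightarrow> letter \<Rightarrow> 'd list \<Rightarrow> 'd list" where
  "edge_src g x y = (if snd x then y else lact g x y)"

lemma avoids_edge_src:
  assumes g: "g \<in> space M" and x: "x \<in> Lt"
  shows "avoids (lact g) x y w u \<longleftrightarrow> avoids (lact g) (fst x, True) (edge_src g x y) w u"
proof -
  interpret letter_action Lt "lact g" by (rule letter_action_lact[OF g])
  show ?thesis
  proof (cases "snd x")
    case True
    then have "(fst x, True) = x" by (simp add: prod_eq_iff)
    then show ?thesis using True by (simp add: edge_src_def)
  next
    case False
    then have "(fst x, True) = inv_letter x" by (simp add: inv_letter_def)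
    then show ?thesis using False avoids_inv_letter[OF x, of y w u] by (simp add: edge_src_def)
  qed
qed

text \<open>The parts before and after the crossing do not feel the shift, so \<open>h\<close> or
  its inverse enters exactly once, between factors that are independent of \<open>h\<close>.\<close>

lemma sec_shift_cross:
  assumes g: "g \<in> space M" and h: "h \<in> W" and x: "x \<in> Lt"
    and w: "set w1 \<subseteq> Lt" "set w2 \<subseteq> Lt" and y: "y = fold (lact g) w1 v"
    and av: "avoids (lact g) x y w1 v" "avoids (lact g) x y w2 (lact g x y)"
  shows "sec (shift (fst x) (edge_src g x y) h g) (w1 @ x # w2) v =
    (if snd x then sec g w2 (lact g x y) \<circ> section_at (lact g x) y \<circ> h \<circ> sec g w1 v
     else sec g w2 (lact g x y) \<circ> inv_into UNIV h \<circ> (section_at (lact g x) y \<circ> sec g w1 v))"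
proof -
  let ?y = "edge_src g x y"
  let ?g = "shift (fst x) ?y h g"
  have i: "fst x < m" using x by (simp add: Lt_def)
  have ly: "length y = length v" unfolding y by (rule length_fold[OF g w(1)])
  have l: "length ?y = length v" using ly length_lact[OF g x, of y] by (simp add: edge_src_def)
  have g': "?g \<in> space M" by (rule shift_space[OF g i h])
  have ag: "agree (length ?y) g ?g" by (rule shift_agree[OF h])
  have "length v \<le> length ?y" using l by simp
  then have f: "fold (lact ?g) w1 v = y" by (rule trans[OF fold_agree[OF g g' ag w(1), symmetric] y[symmetric]])
  have lx: "lact ?g x y = lact g x y" using lact_agree[OF g g' ag x, of y] l ly by simp
  have 1: "sec ?g w1 v = sec g w1 v"
    using sec_shift_avoids[OF g i h w(1), of v ?y] l av(1) avoids_edge_src[OF g x] by simp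
  have 2: "sec ?g w2 (lact g x y) = sec g w2 (lact g x y)"
    using sec_shift_avoids[OF g i h w(2), of "lact g x y" ?y] l ly av(2) avoids_edge_src[OF g x]
      length_lact[OF g x, of y] by simp
  have ly': "length y = length ?y" using l ly by simp
  have 3: "section_at (lact ?g x) y = (if snd x then section_at (lact g x) y \<circ> h
     else inv_into UNIV h \<circ> section_at (lact g x) y)"
    using shift_lact[OF g i h x ly'] by (cases x) (auto simp: edge_src_def)
  have "sec ?g (w1 @ x # w2) v = sec ?g (x # w2) y \<circ> sec ?g w1 v"
    using sec_append[OF g' w(1), of "x # w2" v] x w(2) f by simp
  also have "sec ?g (x # w2) y = sec ?g w2 (lact g x y) \<circ> section_at (lact ?g x) y"
    using sec_Cons[OF g' x w(2), of y] lx by simp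
  finally show ?thesis unfolding 1 2 3
    by (cases "snd x") (simp_all only: comp_assoc if_True if_False simp_thms)
qed

text \<open>The unions of cylinders of depth \<open>j\<close>.\<close>

definition level_set :: "nat \<Rightarrow> ('d list \<Rightarrow> 'd list) set \<Rightarrow> bool" where
  "level_set j B \<longleftrightarrow> B \<subseteq> W \<and> (\<forall>g\<in>B. cyl g j \<subseteq> B)"

lemma level_set_UN:
  assumes "level_set j B"
  shows "B = (\<Union>h\<in>reps j \<inter> B. cyl h j)"
proof
  show "B \<subseteq> (\<Union>h\<in>reps j \<inter> B. cyl h j)"
  proof
    fix g assume g: "g \<in> B"
    then have gW: "g \<in> W" using assms by (auto simp: level_set_def)
    obtain h where h: "h \<in> reps j" "h \<in> cyl g j" using ex1_rep[OF gW] by blast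
    have "h \<in> B" using h(2) g assms by (auto simp: level_set_def)
    moreover have "g \<in> cyl h j" using cyl_self[OF gW] cyl_eq[OF h(2)] by simp
    ultimately show "g \<in> (\<Union>h\<in>reps j \<inter> B. cyl h j)" using h(1) by blast
  qed
  show "(\<Union>h\<in>reps j \<inter> B. cyl h j) \<subseteq> B" using assms by (auto simp: level_set_def)
qed

lemma level_set_sets: "level_set j B \<Longrightarrow> B \<in> sets \<mu>"
proof -
  assume B: "level_set j B"
  have "(\<Union>h\<in>reps j \<inter> B. cyl h j) \<in> sets \<mu>"
    by (rule sets.finite_UN) (use finite_reps reps_W cyl_sets in blast)+
  then show ?thesis using level_set_UN[OF B] by simp
qed

lemma measure_level_set:
  assumes "level_set j B"
  shows "measure \<mu> B = card (reps j \<inter> B) / card (reps j)"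
proof -
  have "measure \<mu> B = measure \<mu> (\<Union>h\<in>reps j \<inter> B. cyl h j)" using level_set_UN[OF assms] by simp
  also have "\<dots> = (\<Sum>h\<in>reps j \<inter> B. measure \<mu> (cyl h j))"
    by (rule P.M.finite_measure_finite_Union)
      (use finite_reps cyl_sets reps_W disjoint_family_on_mono[OF Int_lower1 disjoint_cyl_reps] in blast)+
  also have "\<dots> = (\<Sum>h\<in>reps j \<inter> B. 1 / card (reps j))"
    by (rule sum.cong[OF refl]) (use measure_cyl reps_W in blast)
  finally show ?thesis by simp
qed

text \<open>Preimages of cylinders under \<open>S\<close> are cylinders, and each of these has
  exactly one representative. So \<open>S\<close> meets every cylinder once as \<open>h\<close> runs
  through \<open>reps j\<close>.\<close>

lemma card_translate:
  assumes B: "level_set j B" and S: "\<And>h. h \<in> W \<Longrightarrow> S h \<in> W"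
    and tr: "\<And>b. b \<in> W \<Longrightarrow> \<exists>b'\<in>W. \<forall>h\<in>W. S h \<in> cyl b j \<longleftrightarrow> h \<in> cyl b' j"
  shows "card {h \<in> reps j. S h \<in> B} = card (reps j \<inter> B)"
proof -
  have one: "card {h \<in> reps j. S h \<in> cyl b j} = 1" if b: "b \<in> W" for b
  proof -
    obtain b' where b': "b' \<in> W" "\<forall>h\<in>W. S h \<in> cyl b j \<longleftrightarrow> h \<in> cyl b' j" using tr[OF b] by blast
    obtain h where h: "h \<in> reps j" "h \<in> cyl b' j" and u: "\<And>k. k \<in> reps j \<Longrightarrow> k \<in> cyl b' j \<Longrightarrow> k = h"
      using ex1_rep[OF b'(1)] by blast
    have "{h \<in> reps j. S h \<in> cyl b j} = {h}"
      using h u b'(2) reps_W by blast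
    then show ?thesis by simp
  qed
  have "{h \<in> reps j. S h \<in> B} = (\<Union>b\<in>reps j \<inter> B. {h \<in> reps j. S h \<in> cyl b j})"
    using level_set_UN[OF B] by blast
  also have "card \<dots> = (\<Sum>b\<in>reps j \<inter> B. card {h \<in> reps j. S h \<in> cyl b j})"
  proof (rule card_UN_disjoint)
    show "finite (reps j \<inter> B)" using finite_reps by simp
    show "\<forall>b\<in>reps j \<inter> B. finite {h \<in> reps j. S h \<in> cyl b j}" using finite_reps by simp
    show "\<forall>b\<in>reps j \<inter> B. \<forall>b'\<in>reps j \<inter> B. b \<noteq> b' \<longrightarrow>
      {h \<in> reps j. S h \<in> cyl b j} \<inter> {h \<in> reps j. S h \<in> cyl b' j} = {}"
      using disjoint_cyl_reps[of j] unfolding disjoint_family_on_def by blast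
  qed
  also have "\<dots> = (\<Sum>b\<in>reps j \<inter> B. 1)"
    by (rule sum.cong[OF refl]) (use one reps_W in blast)
  finally show ?thesis by simp
qed

text \<open>Double counting: the indicators of the sets \<open>D h\<close> add up to
  \<open>N\<close> on \<open>A\<close> and to 0 elsewhere.\<close>

lemma sum_measure_const:
  assumes fin: "finite R" and X: "\<And>h. h \<in> R \<Longrightarrow> D h \<in> sets M" and A: "A \<in> sets M"
    and sub: "\<And>h. h \<in> R \<Longrightarrow> D h \<subseteq> A" and N: "\<And>g. g \<in> A \<Longrightarrow> card {h \<in> R. g \<in> D h} = N"
  shows "(\<Sum>h\<in>R. measure M (D h)) = N * measure M A"
proof -
  have int: "integrable M (indicator (D h) :: _ \<Rightarrow> real)" if "h \<in> R" for h
    using X[OF that] by (simp add: integrable_indicator_iff P.P.emeasure_eq_measure)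
  have "(\<Sum>h\<in>R. measure M (D h)) = (\<Sum>h\<in>R. integral\<^sup>L M (indicator (D h)))"
    by (rule sum.cong[OF refl]) (use X sets.sets_into_space in \<open>simp add: Int_absorb2\<close>)
  also have "\<dots> = integral\<^sup>L M (\<lambda>g. \<Sum>h\<in>R. indicator (D h) g)"
    by (rule Bochner_Integration.integral_sum[symmetric]) (rule int)
  also have "\<dots> = integral\<^sup>L M (\<lambda>g. real N * indicator A g)"
  proof (rule Bochner_Integration.integral_cong[OF refl])
    fix g
    have "(\<Sum>h\<in>R. indicator (D h) g :: real) = card {h \<in> R. g \<in> D h}"
      using fin by (simp add: indicator_def Int_def)
    also have "\<dots> = real N * indicator A g"
    proof (cases "g \<in> A")
      case True
      then show ?thesis using N by simp
    next
      case False
      then have e: "{h \<in> R. g \<in> D h} = {}" using sub by blast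
      have "card {h \<in> R. g \<in> D h} = 0" unfolding e by simp
      then show ?thesis using False by simp
    qed
    finally show "(\<Sum>h\<in>R. indicator (D h) g) = real N * indicator A g" .
  qed
  also have "\<dots> = N * measure M A"
    using A sets.sets_into_space[OF A] by (simp add: Int_absorb2)
  finally show ?thesis .
qed

lemma determined_sec:
  assumes w: "set w \<subseteq> Lt" and B: "level_set j B" and N: "length v + j \<le> N"
  shows "determined N (\<lambda>g. sec g w v \<in> B)"
proof -
  have *: "sec g' w v \<in> B" if g: "g \<in> space M" "g' \<in> space M" "agree N g g'" "sec g w v \<in> B" for g g'
  proof -
    have "sec g' w v u = sec g w v u" if "length u \<le> j" for u
      using sec_agree[OF g(1-3) w, of v u] N that by simp
    then have "sec g' w v \<in> cyl (sec g w v) j"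
      using sec_W[OF g(2) w] by (simp add: cyl_def)
    then show ?thesis using B g(4) by (auto simp: level_set_def)
  qed
  show ?thesis unfolding determined_def using * agree_sym by blast
qed

lemma determined_mono: "determined n Q \<Longrightarrow> n \<le> N \<Longrightarrow> determined N Q"
  unfolding determined_def using agree_mono by blast

lemma determined_conj: "determined n P \<Longrightarrow> determined n Q \<Longrightarrow> determined n (\<lambda>g. P g \<and> Q g)"
  unfolding determined_def by blast

lemma determined_atom: "g0 \<in> space M \<Longrightarrow> determined n (agree n g0)"
  unfolding determined_def using agree_trans agree_sym by blast

text \<open>Multiplying the label of one edge by a Haar element \<open>h\<close> preserves the measure and the action on
  level \<open>n\<close>; a loop crossing that edge exactly once is thereby randomised uniformly, while loops
  avoiding it do not change. Only finitely many \<open>h\<close>, one per cylinder, are needed.\<close>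

lemma independent_sections:
  fixes v :: "nat \<Rightarrow> 'd list"
  assumes g0: "g0 \<in> space M" and fin: "finite J" and x: "x \<in> Lt"
    and k: "\<And>k. k \<in> J \<Longrightarrow> length (v k) = n \<and> set (w1 k) \<subseteq> Lt \<and> set (w2 k) \<subseteq> Lt \<and>
       y k = fold (lact g0) (w1 k) (v k) \<and> level_set (jj k) (B k)"
    and inj: "inj_on y J"
    and av: "\<And>j k. j \<in> J \<Longrightarrow> k \<in> J \<Longrightarrow> avoids (lact g0) x (y j) (w1 k) (v k) \<and>
       avoids (lact g0) x (y j) (w2 k) (lact g0 x (y k))"
  shows "measure M {g \<in> atom n g0. \<forall>k\<in>J. sec g (w1 k @ x # w2 k) (v k) \<in> B k} =
    measure M (atom n g0) * (\<Prod>k\<in>J. measure \<mu> (B k))"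
  using fin k inj av
proof (induction J rule: finite_induct)
  case empty
  then show ?case by simp
next
  case (insert k J)
  note K = insert.prems(1) and inj = insert.prems(2) and av = insert.prems(3)
  let ?w = "\<lambda>k. w1 k @ x # w2 k"
  let ?P = "\<lambda>g. agree n g0 g \<and> (\<forall>k\<in>J. sec g (?w k) (v k) \<in> B k)"
  let ?A = "{g \<in> space M. ?P g}"
  have IH: "measure M ?A = measure M (atom n g0) * (\<Prod>k\<in>J. measure \<mu> (B k))"
  proof -
    have "?A = {g \<in> atom n g0. \<forall>k\<in>J. sec g (?w k) (v k) \<in> B k}" by (auto simp: atom_def)
    then show ?thesis using insert.IH K inj av by (simp add: inj_on_def)
  qed
  have kk: "length (v k) = n" "set (w1 k) \<subseteq> Lt" "set (w2 k) \<subseteq> Lt" "y k = fold (lact g0) (w1 k) (v k)"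
    "level_set (jj k) (B k)" using K[of k] by auto
  have wL: "set (?w k') \<subseteq> Lt" if "k' \<in> insert k J" for k' using K[OF that] x by auto
  \<comment> \<open>A depth that determines the events of all loops in \<open>insert k J\<close> at
    once.\<close>
  define N where "N = n + jj k + (\<Sum>k\<in>J. jj k)"
  have detk: "determined N (\<lambda>g. sec g (?w k) (v k) \<in> B k)"
    by (rule determined_sec[OF wL kk(5)]) (simp_all add: N_def kk(1))
  have detJ: "determined N (\<lambda>g. sec g (?w k') (v k') \<in> B k')" if k': "k' \<in> J" for k'
  proof (rule determined_sec[OF wL])
    show "level_set (jj k') (B k')" using K k' by auto
    have "jj k' \<le> (\<Sum>k\<in>J. jj k)" by (rule member_le_sum) (use k' insert.hyps in auto)
    then show "length (v k') + jj k' \<le> N" using K[of k'] k' by (simp add: N_def)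
  qed (use k' in auto)
  have detA: "determined N ?P"
  proof (rule determined_conj)
    show "determined N (agree n g0)" by (rule determined_mono[OF determined_atom[OF g0]]) (simp add: N_def)
    show "determined N (\<lambda>g. \<forall>k\<in>J. sec g (?w k) (v k) \<in> B k)"
      using detJ unfolding determined_def by blast
  qed
  have A: "?A \<in> sets M" by (rule determined_sets[OF detA])
  define i where "i = fst x"
  define y0 where "y0 = edge_src g0 x (y k)"
  have i: "i < m" using x by (simp add: i_def Lt_def)
  have ly: "length (y k') = n" if "k' \<in> insert k J" for k'
    using K[OF that] length_fold[OF g0, of "w1 k'" "v k'"] by simp
  have ly0: "length y0 = n" using ly[of k] length_lact[OF g0 x, of "y k"] by (simp add: y0_def edge_src_def)
  \<comment> \<open>The walks were described for \<open>g0\<close>, but they are the same for every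
    \<open>g\<close> in its atom.\<close>
  have transfer: "fold (lact g) (w1 k') (v k') = y k'" "lact g x (y k') = lact g0 x (y k')"
      "avoids (lact g) x (y k) (w1 k') (v k')" "avoids (lact g) x (y k) (w2 k') (lact g0 x (y k'))"
    if g: "g \<in> space M" "agree n g0 g" and k': "k' \<in> insert k J" for g k'
  proof -
    have p: "length (v k') \<le> n" "set (w1 k') \<subseteq> Lt" "set (w2 k') \<subseteq> Lt" "y k' = fold (lact g0) (w1 k') (v k')"
      using K[OF k'] by auto
    have l: "length (lact g0 x (y k')) \<le> n" using length_lact[OF g0 x, of "y k'"] ly[OF k'] by simp
    show "fold (lact g) (w1 k') (v k') = y k'" using fold_agree[OF g0 g p(2,1)] p(4) by simp
    show "lact g x (y k') = lact g0 x (y k')" using lact_agree[OF g0 g x, of "y k'"] ly[OF k'] by simp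
    show "avoids (lact g) x (y k) (w1 k') (v k')"
      using avoids_agree[OF g0 g p(2,1)] av[of k k'] k' by simp
    show "avoids (lact g) x (y k) (w2 k') (lact g0 x (y k'))"
      using avoids_agree[OF g0 g p(3) l] av[of k k'] k' by simp
  qed
  have es: "edge_src g x (y k) = y0" if "g \<in> space M" "agree n g0 g" for g
    using transfer(2)[OF that, of k] by (simp add: y0_def edge_src_def)
  \<comment> \<open>The shift at the edge of loop \<open>k\<close> leaves level \<open>n\<close> and
    the sections of the other loops alone. Injectivity of \<open>y\<close> ensures that their own
    crossings use other edges.\<close>
  have shP: "?P (shift i y0 h g) \<longleftrightarrow> ?P g" if g: "g \<in> space M" and h: "h \<in> W" for g h
  proof -
    have ag: "agree n g (shift i y0 h g)" using shift_agree[OF h, of y0 g i] ly0 by simp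
    have 1: "agree n g0 (shift i y0 h g) \<longleftrightarrow> agree n g0 g"
      using ag agree_sym agree_trans by blast
    have "sec (shift i y0 h g) (?w k') (v k') = sec g (?w k') (v k')"
      if a: "agree n g0 g" and k': "k' \<in> J" for k'
    proof (rule sec_shift_avoids[OF g i h wL])
      have k'': "k' \<in> insert k J" using k' by simp
      show "length (v k') = length y0" using K[OF k''] ly0 by simp
      have "y k' \<noteq> y k" using inj k' insert.hyps by (auto simp: inj_on_def)
      then have "avoids (lact g) x (y k) (?w k') (v k')"
        using transfer[OF g a k''] by (simp add: avoids_append)
      then show "avoids (lact g) (i, True) y0 (?w k') (v k')"
        using avoids_edge_src[OF g x, of "y k"] es[OF g a] by (simp add: i_def)
    qed (use k' in simp)
    then show ?thesis using 1 by auto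
  qed
  let ?R = "reps (jj k)"
  let ?D = "\<lambda>h. {g \<in> space M. shift i y0 h g \<in> {g \<in> ?A. sec g (?w k) (v k) \<in> B k}}"
  have AB: "{g \<in> ?A. sec g (?w k) (v k) \<in> B k} \<in> sets M"
    using determined_sets[OF determined_conj[OF detA detk]] by (simp add: conj_assoc)
  have RW: "h \<in> W" if "h \<in> ?R" for h using that reps_W by blast
  have Dm: "measure M (?D h) = measure M {g \<in> ?A. sec g (?w k) (v k) \<in> B k}" if "h \<in> ?R" for h
    by (rule shift_measure[OF i RW[OF that] AB])
  have Ds: "?D h \<in> sets M" if "h \<in> ?R" for h
    using measurable_sets[OF shift_measurable[OF i RW[OF that]] AB] by (simp add: vimage_def Int_def conj_commute)
  have Dsub: "?D h \<subseteq> ?A" if "h \<in> ?R" for h using shP[OF _ RW[OF that]] by blast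
  \<comment> \<open>For fixed \<open>g\<close>, as \<open>h\<close> runs through the
    representatives, the section of loop \<open>k\<close> runs exactly once through the cylinders of
    depth \<open>jj k\<close>.\<close>
  have count: "card {h \<in> ?R. g \<in> ?D h} = card (?R \<inter> B k)" if g: "g \<in> ?A" for g
  proof -
    have gM: "g \<in> space M" and a: "agree n g0 g" using g by auto
    let ?S = "\<lambda>h. sec (shift i y0 h g) (?w k) (v k)"
    have "{h \<in> ?R. g \<in> ?D h} = {h \<in> ?R. ?S h \<in> B k}"
      using g gM shP[OF gM] shift_space[OF gM i] RW by blast
    also have "card \<dots> = card (?R \<inter> B k)"
    proof (rule card_translate[OF kk(5)])
      show "?S h \<in> W" if "h \<in> W" for h
        by (rule sec_W[OF shift_space[OF gM i that] wL]) simp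
      fix b assume b: "b \<in> W"
      have t: "y k = fold (lact g) (w1 k) (v k)" "avoids (lact g) x (y k) (w1 k) (v k)"
        "avoids (lact g) x (y k) (w2 k) (lact g x (y k))"
        using transfer[OF gM a, of k] by auto
      note cross = sec_shift_cross[OF gM _ x kk(2,3) t, unfolded es[OF gM a] i_def[symmetric]]
      have C: "sec g (w2 k) (lact g x (y k)) \<in> W" "sec g (w1 k) (v k) \<in> W"
        "section_at (lact g x) (y k) \<in> W"
        using sec_W[OF gM] kk W_section[OF lact_W[OF gM x]] by auto
      show "\<exists>b'\<in>W. \<forall>h\<in>W. ?S h \<in> cyl b (jj k) \<longleftrightarrow> h \<in> cyl b' (jj k)"
      proof (cases "snd x")
        case True
        obtain b' where b': "b' \<in> W" "\<forall>h\<in>W. sec g (w2 k) (lact g x (y k)) \<circ> section_at (lact g x) (y k) \<circ> h \<circ> sec g (w1 k) (v k) \<in> cyl b (jj k) \<longleftrightarrow> h \<in> cyl b' (jj k)"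
          using cyl_translate[OF C(2) W_comp[OF C(3,1)] b] by blast
        then show ?thesis using cross True by (intro bexI[OF _ b'(1)] ballI) simp
      next
        case False
        obtain b' where b': "b' \<in> W" "\<forall>h\<in>W. sec g (w2 k) (lact g x (y k)) \<circ> inv_into UNIV h \<circ> (section_at (lact g x) (y k) \<circ> sec g (w1 k) (v k)) \<in> cyl b (jj k) \<longleftrightarrow> h \<in> cyl b' (jj k)"
          using cyl_translate_inv[OF W_comp[OF C(2,3)] C(1) b] by blast
        then show ?thesis using cross False by (intro bexI[OF _ b'(1)] ballI) simp
      qed
    qed
    finally show ?thesis .
  qed
  \<comment> \<open>Summation over \<open>h\<close> in two ways: every \<open>?D h\<close> has the
    measure of the unshifted event, and every \<open>g\<close> in \<open>?A\<close> lies in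
    \<open>card (?R \<inter> B k)\<close> of them.\<close>
  have "card ?R * measure M {g \<in> ?A. sec g (?w k) (v k) \<in> B k} = (\<Sum>h\<in>?R. measure M (?D h))"
    using Dm by simp
  also have "\<dots> = card (?R \<inter> B k) * measure M ?A"
    by (rule sum_measure_const[OF finite_reps Ds A Dsub count])
  finally have e: "card ?R * measure M {g \<in> ?A. sec g (?w k) (v k) \<in> B k} = card (?R \<inter> B k) * measure M ?A" .
  have div: "p = q * (c / r)" if "r * p = c * q" "r \<noteq> 0" for p q r c :: real
    using that by (simp add: field_simps)
  have "measure M {g \<in> ?A. sec g (?w k) (v k) \<in> B k} = measure M ?A * measure \<mu> (B k)"
    unfolding measure_level_set[OF kk(5)] by (rule div[OF e]) (use card_reps_pos[of "jj k"] in simp)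
  moreover have "{g \<in> ?A. sec g (?w k) (v k) \<in> B k} =
    {g \<in> atom n g0. \<forall>k\<in>insert k J. sec g (?w k) (v k) \<in> B k}" by (auto simp: atom_def)
  ultimately show ?case using IH insert.hyps by (simp add: mult.assoc mult.commute)
qed

end

section \<open>Almost sure freeness on deep levels\<close>

lemma avoidsI:
  assumes "\<And>p l s. w = p @ l # s \<Longrightarrow> \<not> (l = x \<and> fold la p u = y) \<and> \<not> (l = inv_letter x \<and> la l (fold la p u) = y)"
  shows "avoids la x y w u"
  using assms
proof (induction w arbitrary: u)
  case (Cons l w)
  have 1: "\<not> (l = x \<and> u = y) \<and> \<not> (l = inv_letter x \<and> la l u = y)"
    using Cons.prems[of "[]" l w] by simp
  have "avoids la x y w (la l u)"
  proof (rule Cons.IH)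
    fix p l' s assume "w = p @ l' # s"
    then show "\<not> (l' = x \<and> fold la p (la l u) = y) \<and> \<not> (l' = inv_letter x \<and> la l' (fold la p (la l u)) = y)"
      using Cons.prems[of "l # p" l' s] by simp
  qed
  then show ?case using 1 by simp
qed simp

text \<open>In the union \<open>F a\<close> may be replaced by \<open>F a - F b\<close>, so the
  union bound gains the overlap of these two sets.\<close>

lemma (in finite_measure) measure_UN_le_diff:
  fixes F :: "'i::finite \<Rightarrow> 'a set"
  assumes F: "\<And>i. F i \<in> sets M" and ab: "a \<noteq> b"
  shows "measure M (\<Union>i. F i) \<le> (\<Sum>i\<in>UNIV. measure M (F i)) - measure M (F a \<inter> F b)"
proof -
  have "(\<Union>i. F i) = (F a - F b) \<union> (\<Union>i\<in>UNIV - {a}. F i)" using ab by auto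
  then have "measure M (\<Union>i. F i) \<le> measure M (F a - F b) + measure M (\<Union>i\<in>UNIV - {a}. F i)"
    using measure_Un_le[of "F a - F b" M "\<Union>i\<in>UNIV - {a}. F i"] F by simp
  also have "measure M (F a - F b) = measure M (F a) - measure M (F a \<inter> F b)"
    by (rule finite_measure_Diff') (rule F)+
  also have "measure M (\<Union>i\<in>UNIV - {a}. F i) \<le> (\<Sum>i\<in>UNIV - {a}. measure M (F i))"
    by (rule finite_measure_subadditive_finite) (use F in auto)
  finally show ?thesis by (simp add: sum.remove[of UNIV a])
qed

text \<open>As long as the sequence stays at or above \<open>\<epsilon>\<close>, each step lowers it
  by at least \<open>p * \<epsilon>\<^sup>2\<close>, which cannot go on for ever.\<close>

lemma quadratic_decay:
  fixes q :: "nat \<Rightarrow> real"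
  assumes q: "q 0 \<le> 1" "\<And>j. q (Suc j) \<le> q j - p * (q j)\<^sup>2" and p: "0 < p" and e: "0 < \<epsilon>"
  shows "\<exists>j. q j < \<epsilon>"
proof (rule ccontr)
  assume "\<not> (\<exists>j. q j < \<epsilon>)"
  then have ge: "\<epsilon> \<le> q j" for j by (simp add: not_less)
  have pe: "0 < p * \<epsilon>\<^sup>2" using p e by simp
  have b: "q n \<le> 1 - n * (p * \<epsilon>\<^sup>2)" for n
  proof (induction n)
    case (Suc n)
    have "\<epsilon>\<^sup>2 \<le> (q n)\<^sup>2" using ge[of n] e by (intro power_mono) simp_all
    then have "p * \<epsilon>\<^sup>2 \<le> p * (q n)\<^sup>2" using p by simp
    then show ?case using q(2)[of n] Suc by (simp add: algebra_simps)
  qed (use q in simp)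
  obtain n :: nat where "1 / (p * \<epsilon>\<^sup>2) < n" using reals_Archimedean2 by blast
  then have "1 < n * (p * \<epsilon>\<^sup>2)" using pe by (simp add: field_simps)
  then show False using b[of n] ge[of n] e by simp
qed

context tree_group
begin

definition fix_set :: "nat \<Rightarrow> ('d list \<Rightarrow> 'd list) set" where
  "fix_set j = {g \<in> W. \<exists>v. length v = j \<and> g v = v}"

end

context random_action
begin

text \<open>\<open>Q\<close> is a finite disjoint union of atoms, and on each of them the
  conditional probability of \<open>S\<close> is \<open>p\<close>.\<close>

lemma measure_total:
  assumes Q: "determined n Q" and S: "determined N S"
    and eq: "\<And>g. g \<in> space M \<Longrightarrow> Q g \<Longrightarrow> measure M {g' \<in> atom n g. S g'} = measure M (atom n g) * p"
  shows "measure M {g \<in> space M. Q g \<and> S g} = measure M {g \<in> space M. Q g} * p"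
proof -
  let ?A = "{A \<in> atom n ` space M. A \<subseteq> {g \<in> space M. Q g}}"
  have fin: "finite ?A" using finite_atoms by simp
  have disj: "disjoint_family_on (\<lambda>A. A) ?A"
    unfolding disjoint_family_on_def using disjoint_atoms by blast
  have U: "{g \<in> space M. Q g} = (\<Union>A\<in>?A. A)" using determined_UN[OF Q] by simp
  have SM: "{g \<in> space M. S g} \<in> sets M" by (rule determined_sets[OF S])
  have Am: "A \<in> sets M" if "A \<in> ?A" for A using that atom_sets by blast
  have ASm: "{g \<in> A. S g} \<in> sets M" if "A \<in> ?A" for A
  proof -
    have "{g \<in> A. S g} = A \<inter> {g \<in> space M. S g}" using that by blast
    then show ?thesis using sets.Int[OF Am[OF that] SM] by (simp only:)
  qed
  have each: "measure M {g \<in> A. S g} = measure M A * p" if A: "A \<in> ?A" for A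
  proof -
    obtain g where g: "g \<in> space M" "A = atom n g" using A by blast
    have "g \<in> A" using g agree_refl by (simp add: atom_def)
    then have "Q g" using A by blast
    then show ?thesis using eq[OF g(1)] g(2) by simp
  qed
  have disj': "disjoint_family_on (\<lambda>A. {g \<in> A. S g}) ?A"
    using disj unfolding disjoint_family_on_def by blast
  have "{g \<in> space M. Q g \<and> S g} = (\<Union>A\<in>?A. {g \<in> A. S g})" using U by blast
  also have "measure M \<dots> = (\<Sum>A\<in>?A. measure M {g \<in> A. S g})"
    by (rule P.P.finite_measure_finite_Union[OF fin _ disj']) (use ASm in blast)
  also have "\<dots> = (\<Sum>A\<in>?A. measure M A) * p"
    unfolding sum_distrib_right by (rule sum.cong[OF refl each])
  also have "(\<Sum>A\<in>?A. measure M A) = measure M (\<Union>A\<in>?A. A)"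
    by (rule P.P.finite_measure_finite_Union[OF fin _ disj, symmetric]) (use Am in blast)
  finally show ?thesis unfolding U[symmetric] .
qed

lemma level_set_fix_set: "level_set j (fix_set j)"
  unfolding level_set_def
proof
  show "\<forall>g\<in>fix_set j. cyl g j \<subseteq> fix_set j"
  proof (intro ballI subsetI)
    fix g h assume "g \<in> fix_set j" and h: "h \<in> cyl g j"
    then obtain v where v: "length v = j" "g v = v" by (auto simp: fix_set_def)
    have "h v = v" using h v by (simp add: cyl_def)
    then show "h \<in> fix_set j" using h v(1) unfolding cyl_def fix_set_def by blast
  qed
qed (simp add: fix_set_def)

definition free_at :: "nat \<Rightarrow> letter list \<Rightarrow> (nat \<Rightarrow> 'd list \<Rightarrow> 'd list) \<Rightarrow> bool" where
  "free_at n w g \<longleftrightarrow> (\<forall>v. length v = n \<longrightarrow> fold (lact g) w v \<noteq> v)"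

text \<open>Prefixes of a fixed vertex are fixed.\<close>

lemma free_at_mono:
  assumes g: "g \<in> space M" and w: "set w \<subseteq> Lt" and f: "free_at n w g" and le: "n \<le> k"
  shows "free_at k w g"
  unfolding free_at_def
proof (intro allI impI notI)
  fix v :: "'d list" assume v: "length v = k" "fold (lact g) w v = v"
  have t: "fold (lact g) w \<in> tree_aut" by (rule W_tree[OF fold_W[OF g w]])
  have "fold (lact g) w (take n v) = take (length (take n v)) (fold (lact g) w (take n v @ drop n v))"
    by (rule tree_aut_take[OF t, symmetric])
  also have "\<dots> = take n v" using v le by simp
  finally show False using f v(1) le by (simp add: free_at_def)
qed

lemma determined_free_at: "set w \<subseteq> Lt \<Longrightarrow> determined n (free_at n w)"
  unfolding determined_def free_at_def
proof (intro ballI impI)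
  fix g g' assume w: "set w \<subseteq> Lt" and g: "g \<in> space M" "g' \<in> space M" "agree n g g'"
  have "fold (lact g) w v = fold (lact g') w v" if "length v = n" for v
    by (rule fold_agree[OF g w]) (simp add: that)
  then show "(\<forall>v. length v = n \<longrightarrow> fold (lact g) w v \<noteq> v) = (\<forall>v. length v = n \<longrightarrow> fold (lact g') w v \<noteq> v)"
    by simp
qed

text \<open>A fixed vertex splits into a fixed prefix on level \<open>n\<close> and a remainder that
  is fixed by the section there.\<close>

lemma not_free_at_sec:
  assumes g: "g \<in> space M" and w: "set w \<subseteq> Lt" and nf: "\<not> free_at (n + j) w g"
  shows "\<exists>v. length v = n \<and> fold (lact g) w v = v \<and> sec g w v \<in> fix_set j"
proof -
  obtain z where z: "length z = n + j" "fold (lact g) w z = z" using nf by (auto simp: free_at_def)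
  let ?v = "take n z" and ?u = "drop n z"
  have t: "fold (lact g) w \<in> tree_aut" by (rule W_tree[OF fold_W[OF g w]])
  have a: "fold (lact g) w (?v @ ?u) = fold (lact g) w ?v @ sec g w ?v ?u"
    unfolding sec_def by (rule tree_aut_append[OF t])
  have l: "length (fold (lact g) w ?v) = length ?v" by (rule length_fold[OF g w])
  have "fold (lact g) w ?v @ sec g w ?v ?u = ?v @ ?u" using a z(2) by simp
  then have "fold (lact g) w ?v = ?v" "sec g w ?v ?u = ?u" using append_eq_append_conv[OF disjI1[OF l]] by blast+
  moreover have "length ?u = j" "length ?v = n" using z(1) by simp_all
  ultimately show ?thesis using sec_W[OF g w, of ?v] unfolding fix_set_def by blast
qed

text \<open>Induction on the length; a word that is not cyclically reduced is conjugate to a shorter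
  one. For the others, once the proper subwords are free on level \<open>n\<close>, the closed walk
  along \<open>w\<close> from a fixed vertex crosses its first edge only once, so
  \<open>independent_sections\<close> applies with a single loop.\<close>

lemma AE_eventually_free:
  assumes q0: "\<And>\<epsilon>. 0 < \<epsilon> \<Longrightarrow> \<exists>j. measure \<mu> (fix_set j) < \<epsilon>"
  shows "reduced_word w \<Longrightarrow> w \<noteq> [] \<Longrightarrow> set w \<subseteq> Lt \<Longrightarrow> AE g in M. \<exists>n. free_at n w g"
proof (induction "length w" arbitrary: w rule: less_induct)
  case less
  note w = less.prems
  show ?case
  proof (cases "reduced_word (w @ w)")
    case False
    then have h: "hd w = inv_letter (last w)" using w by (auto simp: reduced_append_iff)
    obtain l w1 where w1: "w = l # w1" using w by (cases w) auto
    have "w1 \<noteq> []" using h w1 by auto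
    then obtain w2 l2 where w2: "w1 = w2 @ [l2]" by (cases w1 rule: rev_cases) auto
    have weq: "w = l # w2 @ [inv_letter l]" using h w1 w2 by simp
    have "w2 \<noteq> []" using w(1) weq by (auto simp: reduced_Cons_iff)
    moreover have "reduced_word w2" using w(1) weq by (auto simp: reduced_Cons_iff reduced_append_iff)
    moreover have L: "set w2 \<subseteq> Lt" "l \<in> Lt" using w(3) weq by auto
    ultimately have "AE g in M. \<exists>n. free_at n w2 g" using less.hyps[of w2] weq by simp
    then show ?thesis
    proof (rule AE_mp, intro AE_I2 impI)
      fix g assume g: "g \<in> space M" and "\<exists>n. free_at n w2 g"
      then obtain n where n: "free_at n w2 g" by blast
      interpret letter_action Lt "lact g" by (rule letter_action_lact[OF g])
      \<comment> \<open>The letter \<open>l\<close> carries vertices fixed by \<open>w\<close> to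
        vertices fixed by \<open>w2\<close>.\<close>
      have "free_at n w g"
        unfolding free_at_def
      proof (intro allI impI notI)
        fix v :: "'d list" assume v: "length v = n" "fold (lact g) w v = v"
        let ?u = "lact g l v"
        have "lact g (inv_letter l) (fold (lact g) w2 ?u) = v" using v(2) weq by simp
        then have "fold (lact g) w2 ?u = ?u" using za_inv'[OF L(2)] by metis
        moreover have "length ?u = n" using length_lact[OF g L(2)] v(1) by simp
        ultimately show False using n by (simp add: free_at_def)
      qed
      then show "\<exists>n. free_at n w g" by blast
    qed
  next
    case True
    define Sub where "Sub = {u. u \<noteq> [] \<and> u \<noteq> w \<and> (\<exists>p s. w = p @ u @ s)}"
    have Sub: "reduced_word u" "u \<noteq> []" "set u \<subseteq> Lt" "length u < length w" if u: "u \<in> Sub" for u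
    proof -
      obtain p s where ps: "w = p @ u @ s" "u \<noteq> []" "u \<noteq> w" using u by (auto simp: Sub_def)
      show "reduced_word u" "set u \<subseteq> Lt" using w ps by (auto simp: reduced_append_iff)
      show "u \<noteq> []" by (rule ps)
      have "p \<noteq> [] \<or> s \<noteq> []" using ps by auto
      then show "length u < length w" using ps by auto
    qed
    have finS: "finite Sub"
    proof (rule finite_subset)
      show "Sub \<subseteq> {u. set u \<subseteq> set w \<and> length u \<le> length w}" by (auto simp: Sub_def)
      show "finite {u. set u \<subseteq> set w \<and> length u \<le> length w}" by (rule finite_lists_length_le) simp
    qed
    define Gd where "Gd n g \<longleftrightarrow> (\<forall>u\<in>Sub. free_at n u g)" for n g
    have detG: "determined n (Gd n)" for n
      using determined_free_at[OF Sub(3), of _ n] unfolding determined_def Gd_def by blast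
    have "AE g in M. \<forall>u\<in>Sub. \<exists>n. free_at n u g"
      by (rule AE_finite_allI[OF finS]) (use less.hyps Sub in blast)
    then have AEG: "AE g in M. \<exists>n. Gd n g"
    proof (rule AE_mp, intro AE_I2 impI)
      fix g assume g: "g \<in> space M" and "\<forall>u\<in>Sub. \<exists>n. free_at n u g"
      then obtain nn where nn: "\<And>u. u \<in> Sub \<Longrightarrow> free_at (nn u) u g" by metis
      let ?n = "Max (insert 0 (nn ` Sub))"
      have "free_at ?n u g" if u: "u \<in> Sub" for u
        by (rule free_at_mono[OF g Sub(3)[OF u] nn[OF u]]) (use finS u in simp)
      then show "\<exists>n. Gd n g" unfolding Gd_def by blast
    qed
    have bound: "measure M {g \<in> space M. (Gd n g \<and> fold (lact g) w v = v) \<and> sec g w v \<in> fix_set j} \<le> measure \<mu> (fix_set j)"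
      if v: "length v = n" for n j v
    proof -
      have dfix: "determined n (\<lambda>g. fold (lact g) w v = v)"
        unfolding determined_def using fold_agree[of _ _ n w v] w(3) v by simp
      have "measure M {g \<in> space M. (Gd n g \<and> fold (lact g) w v = v) \<and> sec g w v \<in> fix_set j} =
        measure M {g \<in> space M. Gd n g \<and> fold (lact g) w v = v} * measure \<mu> (fix_set j)"
      proof (rule measure_total[OF determined_conj[OF detG dfix] determined_sec[OF w(3) level_set_fix_set order.refl]])
        fix g assume g: "g \<in> space M" and Q: "Gd n g \<and> fold (lact g) w v = v"
        define x where "x = hd w"
        have wx: "w = x # tl w" using w(2) by (simp add: x_def)
        have xL: "x \<in> Lt" using w(3) wx by (metis list.set_intros(1) subsetD)
        have tL: "set (tl w) \<subseteq> Lt" using w(3) wx by (metis list.set_intros(2) subset_iff)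
        have nfree: "fold (lact g) u v \<noteq> v" if "u \<in> Sub" for u
          using Q that v by (auto simp: Gd_def free_at_def)
        \<comment> \<open>A second crossing of the first edge in the same direction makes a proper
          prefix of \<open>w\<close> fix \<open>v\<close>. So does one in the opposite direction,
          unless it is the last step, and then the first and last letters of \<open>w\<close> would
          be inverse to each other.\<close>
        have av: "avoids (lact g) x v (tl w) (lact g x v)"
        proof (rule avoidsI)
          fix p l s assume t: "tl w = p @ l # s"
          have w': "w = x # p @ l # s" using wx t by simp
          have "x # p \<in> Sub" unfolding Sub_def
            using w' by (auto intro: exI[of _ "[]"])
          then have 1: "fold (lact g) p (lact g x v) \<noteq> v" using nfree by fastforce
          have 2: "lact g l (fold (lact g) p (lact g x v)) \<noteq> v" if l: "l = inv_letter x"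
          proof (cases "s = []")
            case True
            then have "hd w = x" "last w = inv_letter x" using w' l by simp_all
            then show ?thesis using \<open>reduced_word (w @ w)\<close> w(2) by (simp add: reduced_append_iff)
          next
            case False
            then have "x # p @ [l] \<in> Sub" unfolding Sub_def
              using w' by (auto intro: exI[of _ "[]"])
            then show ?thesis using nfree by fastforce
          qed
          show "\<not> (l = x \<and> fold (lact g) p (lact g x v) = v) \<and>
            \<not> (l = inv_letter x \<and> lact g l (fold (lact g) p (lact g x v)) = v)" using 1 2 by blast
        qed
        have "measure M {g' \<in> atom n g. \<forall>k\<in>{0::nat}. sec g' ([] @ x # tl w) v \<in> fix_set j} =
          measure M (atom n g) * (\<Prod>k\<in>{0::nat}. measure \<mu> (fix_set j))"
          by (rule independent_sections[where v = "\<lambda>_. v" and ?w1.0 = "\<lambda>_. []" and ?w2.0 = "\<lambda>_. tl w"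
                and y = "\<lambda>_. v" and jj = "\<lambda>_. j", OF g _ xL])
            (use v tL av level_set_fix_set in auto)
        then show "measure M {g' \<in> atom n g. sec g' w v \<in> fix_set j} = measure M (atom n g) * measure \<mu> (fix_set j)"
          using wx by simp
      qed
      also have "\<dots> \<le> 1 * measure \<mu> (fix_set j)" by (intro mult_right_mono) simp_all
      finally show ?thesis by simp
    qed
    \<comment> \<open>A union bound over the finitely many vertices of level \<open>n\<close>, after
      which \<open>j\<close> is chosen large.\<close>
    have null: "AE g in M. \<not> (Gd n g \<and> (\<forall>j. \<not> free_at (n + j) w g))" for n
    proof -
      let ?N = "\<lambda>j. {g \<in> space M. Gd n g \<and> \<not> free_at (n + j) w g}"
      let ?V = "{v :: 'd list. length v = n}"
      have finV: "finite ?V" by (rule finite_subset[OF _ finite_words_length[of n]]) auto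
      let ?E = "\<lambda>j v. {g \<in> space M. (Gd n g \<and> fold (lact g) w v = v) \<and> sec g w v \<in> fix_set j}"
      have detE: "determined (n + j) (\<lambda>g. (Gd n g \<and> fold (lact g) w v = v) \<and> sec g w v \<in> fix_set j)" if "v \<in> ?V" for j v
      proof (intro determined_conj)
        show "determined (n + j) (Gd n)" by (rule determined_mono[OF detG]) simp
        show "determined (n + j) (\<lambda>g. fold (lact g) w v = v)"
          unfolding determined_def using fold_agree[of _ _ "n + j" w v] w(3) that by simp
        show "determined (n + j) (\<lambda>g. sec g w v \<in> fix_set j)"
          by (rule determined_sec[OF w(3) level_set_fix_set]) (use that in simp)
      qed
      have detN: "determined (n + j) (\<lambda>g. Gd n g \<and> \<not> free_at (n + j) w g)" for j
        using determined_mono[OF detG le_add1[of n j]] determined_free_at[OF w(3), of "n + j"]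
        unfolding determined_def by blast
      have Nb: "measure M (?N j) \<le> card ?V * measure \<mu> (fix_set j)" for j
      proof -
        have "?N j \<subseteq> (\<Union>v\<in>?V. ?E j v)" using not_free_at_sec[OF _ w(3), of _ n j] by blast
        then have "measure M (?N j) \<le> measure M (\<Union>v\<in>?V. ?E j v)"
          by (rule P.P.finite_measure_mono) (rule sets.finite_UN[OF finV determined_sets[OF detE]])
        also have "\<dots> \<le> (\<Sum>v\<in>?V. measure M (?E j v))"
          by (rule P.P.finite_measure_subadditive_finite[OF finV]) (use determined_sets[OF detE] in blast)
        also have "\<dots> \<le> (\<Sum>v\<in>?V. measure \<mu> (fix_set j))" by (rule sum_mono) (use bound in simp)
        finally show ?thesis by simp
      qed
      let ?I = "{g \<in> space M. Gd n g \<and> (\<forall>j. \<not> free_at (n + j) w g)}"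
      have IM: "?I \<in> sets M"
      proof -
        have "?I = (\<Inter>j. ?N j)" by blast
        moreover have "(\<Inter>j. ?N j) \<in> sets M" by (rule sets.countable_INT') (use determined_sets[OF detN] in auto)
        ultimately show ?thesis by simp
      qed
      have small: "measure M ?I \<le> 0 + e" if e: "0 < e" for e
      proof -
        have cV: "0 \<le> real (card ?V)" by simp
        obtain j where j: "measure \<mu> (fix_set j) < e / (card ?V + 1)" using q0[of "e / (card ?V + 1)"] e by auto
        have "measure M ?I \<le> measure M (?N j)"
          by (rule P.P.finite_measure_mono) (use determined_sets[OF detN] in auto)
        also have "\<dots> \<le> card ?V * measure \<mu> (fix_set j)" by (rule Nb)
        also have "\<dots> \<le> card ?V * (e / (card ?V + 1))" using j by (intro mult_left_mono) simp_all
        also have "\<dots> \<le> 0 + e" using e cV by (simp add: field_simps)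
        finally show ?thesis .
      qed
      have "measure M ?I \<le> 0" by (rule field_le_epsilon[OF small])
      then have "measure M ?I = 0" using measure_nonneg[of M ?I] by linarith
      then have "emeasure M ?I = 0" by (simp add: P.P.emeasure_eq_measure)
      then show ?thesis using IM by (intro AE_I[where N = ?I]) auto
    qed
    have "AE g in M. \<forall>n. \<not> (Gd n g \<and> (\<forall>j. \<not> free_at (n + j) w g))"
      using null by (simp add: AE_all_countable)
    then show ?thesis using AEG
    proof eventually_elim
      case (elim g)
      then obtain n where "Gd n g" by blast
      then show ?case using elim(1) by blast
    qed
  qed
qed

end

section \<open>Fixed vertices of a single Haar element\<close>

context haar_tree
begin

text \<open>The rooted automorphism of \<open>h\<close>: it permutes the subtrees below the root and
  has trivial sections there.\<close>

definition rooted :: "('d \<Rightarrow> 'd) \<Rightarrow> 'd list \<Rightarrow> 'd list" where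
  "rooted h w = (case w of [] \<Rightarrow> [] | a # u \<Rightarrow> h a # u)"

lemma rooted_simps [simp]: "rooted h [] = []" "rooted h (a # u) = h a # u"
  by (simp_all add: rooted_def)

lemma H_bij: "h \<in> H \<Longrightarrow> bij h"
  using subgroup.mem_carrier[OF H_sub] by (auto simp: BijGroup_def Bij_def)

lemma rooted_W:
  assumes h: "h \<in> H"
  shows "rooted h \<in> W"
proof -
  have b: "bij h" by (rule H_bij[OF h])
  have "bij (rooted h)"
  proof (rule bijI)
    show "inj (rooted h)"
    proof (rule injI)
      fix v w assume "rooted h v = rooted h w"
      then show "v = w" using bij_is_inj[OF b] by (cases v; cases w) (auto dest: injD)
    qed
    have "\<exists>v. w = rooted h v" for w
    proof (cases w)
      case Nil
      then show ?thesis by (intro exI[of _ "[]"]) simp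
    next
      case (Cons a u)
      then show ?thesis using bij_is_surj[OF b] by (intro exI[of _ "inv_into UNIV h a # u"]) (simp add: surj_f_inv_f)
    qed
    then show "surj (rooted h)" unfolding surj_def by blast
  qed
  moreover have "is_child (rooted h v) (rooted h w) \<longleftrightarrow> is_child v w" for v w
  proof (cases v)
    case Nil
    then show ?thesis by (cases w) (auto simp: is_child_def)
  next
    case (Cons a u)
    then show ?thesis using bij_is_inj[OF b] by (cases w) (auto simp: is_child_def dest: injD)
  qed
  ultimately have t: "rooted h \<in> tree_aut" by (simp add: tree_aut_def)
  have "root_perm (section_at (rooted h) v) \<in> H" for v
  proof (cases v)
    case Nil
    then have "root_perm (section_at (rooted h) v) = h" by (auto simp: root_perm_def section_at_def)
    then show ?thesis using h by simp
  next
    case (Cons a u)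
    then have "root_perm (section_at (rooted h) v) = id" by (auto simp: root_perm_def section_at_def)
    then show ?thesis using id_H by simp
  qed
  then show ?thesis using t by (simp add: W_set_def)
qed

lemma level_one: "g \<in> W \<Longrightarrow> \<exists>b. g [a] = [b]"
proof -
  assume g: "g \<in> W"
  have "length (g [a]) = Suc 0" using tree_aut_length[OF W_tree[OF g], of "[a]"] by simp
  then show ?thesis by (auto simp: length_Suc_conv)
qed

text \<open>The events \<open>g [b] = [a]\<close>, for varying \<open>b\<close>, partition
  \<open>W\<close>. By transitivity, left translations by rooted automorphisms carry them to one
  another, so they are equally likely.\<close>

lemma measure_fix_letter:
  assumes trans: "\<forall>x y. \<exists>h\<in>H. h x = y"
  shows "measure \<mu> {g \<in> W. g [a] = [a]} = 1 / CARD('d)"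
proof -
  interpret prob_space \<mu> by (rule prob_mu)
  let ?E = "\<lambda>b. {g \<in> W. g [b] = [a]}"
  have E: "?E b \<in> sets \<mu>" for b
  proof -
    have "?E b = (\<Union>h\<in>reps 1 \<inter> ?E b. cyl h 1)"
    proof
      show "?E b \<subseteq> (\<Union>h\<in>reps 1 \<inter> ?E b. cyl h 1)"
      proof
        fix g assume g: "g \<in> ?E b"
        then obtain h where h: "h \<in> reps 1" "h \<in> cyl g 1" using ex1_rep[of g 1] by blast
        have "g \<in> cyl h 1" using cyl_self[of g 1] cyl_eq[OF h(2)] g by simp
        moreover have "h \<in> ?E b" using h(2) g by (simp add: cyl_def)
        ultimately show "g \<in> (\<Union>h\<in>reps 1 \<inter> ?E b. cyl h 1)" using h(1) by blast
      qed
      show "(\<Union>h\<in>reps 1 \<inter> ?E b. cyl h 1) \<subseteq> ?E b" by (auto simp: cyl_def)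
    qed
    moreover have "(\<Union>h\<in>reps 1 \<inter> ?E b. cyl h 1) \<in> sets \<mu>"
      by (rule sets.finite_UN) (use finite_reps cyl_sets in auto)
    ultimately show ?thesis by simp
  qed
  have same: "measure \<mu> (?E b) = measure \<mu> (?E a)" for b
  proof -
    obtain h where h: "h \<in> H" "h b = a" using trans by blast
    have k: "rooted h \<in> W" by (rule rooted_W[OF h(1)])
    have "(\<lambda>g. g \<circ> rooted h) -` ?E b \<inter> W = ?E a"
      using W_comp[OF k] h(2) by auto
    then show ?thesis using left_mult_emeasure[OF k E[of b]] by (simp add: measure_def)
  qed
  have disj: "disjoint_family_on ?E UNIV"
    unfolding disjoint_family_on_def
  proof (intro ballI impI equals0I)
    fix b c g assume "b \<noteq> c" "g \<in> ?E b \<inter> ?E c"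
    then show False using tree_aut_inj[OF W_tree, of g "[b]" "[c]"] by auto
  qed
  have "W \<subseteq> (\<Union>b. ?E b)"
  proof
    fix g assume g: "g \<in> W"
    obtain b where "inv_into UNIV g [a] = [b]" using level_one[OF W_inv[OF g]] by blast
    then have "g [b] = [a]" using tree_aut_f_inv[OF W_tree[OF g], of "[a]"] by simp
    then show "g \<in> (\<Union>b. ?E b)" using g by blast
  qed
  then have "(\<Union>b. ?E b) = space \<mu>" using space_mu by blast
  then have "1 = measure \<mu> (\<Union>b. ?E b)" using prob_space by simp
  also have "\<dots> = (\<Sum>b\<in>UNIV. measure \<mu> (?E b))"
    by (rule finite_measure_finite_Union[OF finite _ disj]) (use E in blast)
  also have "\<dots> = (\<Sum>b\<in>(UNIV :: 'd set). measure \<mu> (?E a))" by (rule sum.cong[OF refl same])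
  also have "\<dots> = CARD('d) * measure \<mu> (?E a)" by simp
  finally show ?thesis by (simp add: field_simps)
qed


text \<open>The vertices fixed by a Haar element form a critical Galton-Watson process: the expected number
  of fixed children is 1 by transitivity, and the identity at the root makes it non-degenerate.\<close>

lemma fix_set_measure_small:
  assumes trans: "\<forall>x y. \<exists>h\<in>H. h x = y" and c: "c1 \<noteq> (c2 :: 'd)" and e: "0 < \<epsilon>"
  shows "\<exists>j. measure \<mu> (fix_set j) < \<epsilon>"
proof -
  \<comment> \<open>One Haar element is a random action of the free group on one generator, so the
    results on sections apply to it.\<close>
  interpret R: random_action H \<mu> 1 ..
  let ?x = "(0, True) :: letter"
  have xL: "?x \<in> R.Lt" unfolding R.Lt_def by simp
  have lx: "lact g ?x = g 0" for g :: "nat \<Rightarrow> 'd list \<Rightarrow> 'd list" by (simp add: lact_def)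
  have push: "measure R.M {g \<in> space R.M. g 0 \<in> A} = measure \<mu> A" if A: "A \<in> sets \<mu>" for A
  proof -
    have 0: "(0::nat) \<in> {..<1}" by simp
    have "measure \<mu> A = measure (distr R.M \<mu> (\<lambda>g. g 0)) A" by (simp only: R.P.PiM_component[OF 0])
    also have "\<dots> = measure R.M ((\<lambda>g. g 0) -` A \<inter> space R.M)"
      by (rule measure_distr[OF measurable_component_singleton[OF 0] A])
    also have "(\<lambda>g. g 0) -` A \<inter> space R.M = {g \<in> space R.M. g 0 \<in> A}" by blast
    finally show ?thesis ..
  qed
  let ?q = "\<lambda>j. measure \<mu> (fix_set j)"
  let ?S = "\<lambda>j a g. R.sec g [?x] [a] \<in> fix_set j"
  \<comment> \<open>The child \<open>a\<close> of the root is fixed and has a fixed descendant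
    \<open>j\<close> levels below it.\<close>
  define F where "F j a = {g \<in> space R.M. g 0 [a] = [a] \<and> ?S j a g}" for j a
  have detQ: "R.determined 1 (\<lambda>g. g 0 [a] = [a])" for a
    unfolding R.determined_def R.agree_def by simp
  have detS: "R.determined (1 + j) (?S j a)" for j a
    by (rule R.determined_sec[OF _ R.level_set_fix_set]) (use xL in simp_all)
  have FM: "F j a \<in> sets R.M" for j a
    unfolding F_def
    by (rule R.determined_sets[OF R.determined_conj[OF R.determined_mono[OF detQ] detS]]) simp
  have fixQ: "{g \<in> W. g [a] = [a]} \<in> sets \<mu>" for a
  proof (rule R.level_set_sets[of 1])
    show "R.level_set 1 {g \<in> W. g [a] = [a]}"
      unfolding R.level_set_def cyl_def by auto
  qed
  have mF: "measure R.M (F j a) = 1 / CARD('d) * ?q j" for j a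
  proof -
    have "measure R.M (F j a) = measure R.M {g \<in> space R.M. g 0 [a] = [a]} * ?q j"
      unfolding F_def
    proof (rule R.measure_total[OF detQ detS])
      fix g assume g: "g \<in> space R.M" "g 0 [a] = [a]"
      have "measure R.M {g' \<in> R.atom 1 g. \<forall>k\<in>{0::nat}. R.sec g' ([] @ ?x # []) [a] \<in> fix_set j} =
          measure R.M (R.atom 1 g) * (\<Prod>k\<in>{0::nat}. measure \<mu> (fix_set j))"
        by (rule R.independent_sections[where v = "\<lambda>_. [a]" and ?w1.0 = "\<lambda>_. []" and ?w2.0 = "\<lambda>_. []"
              and y = "\<lambda>_. [a]" and jj = "\<lambda>_. j", OF g(1) _ xL])
          (use R.level_set_fix_set in auto)
      then show "measure R.M {g' \<in> R.atom 1 g. ?S j a g'} = measure R.M (R.atom 1 g) * ?q j" by simp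
    qed
    also have "{g \<in> space R.M. g 0 [a] = [a]} = {g \<in> space R.M. g 0 \<in> {g \<in> W. g [a] = [a]}}"
      using R.space_W[of _ 0] by auto
    also have "measure R.M \<dots> = 1 / CARD('d)" using push[OF fixQ] measure_fix_letter[OF trans] by simp
    finally show ?thesis .
  qed
  \<comment> \<open>On the atom of the identity both \<open>c1\<close> and \<open>c2\<close> are
    fixed and their sections are independent; this yields the quadratic term.\<close>
  define gi where "gi = (\<lambda>i\<in>{..<1::nat}. id :: 'd list \<Rightarrow> 'd list)"
  have gi: "gi \<in> space R.M" unfolding R.space_M gi_def using W_id by simp
  define p where "p = measure R.M (R.atom 1 gi)"
  have "R.atom 1 gi = {g \<in> space R.M. g 0 \<in> cyl id 1}"
    unfolding R.atom_def R.agree_def cyl_def gi_def using R.space_W[of _ 0] by auto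
  then have "p = 1 / card (reps 1)" using push[OF cyl_sets[OF W_id]] measure_cyl[OF W_id] by (simp add: p_def)
  then have p: "0 < p" using card_reps_pos[of 1] by simp
  have both: "p * (?q j)\<^sup>2 \<le> measure R.M (F j c1 \<inter> F j c2)" for j
  proof -
    let ?v = "\<lambda>k::nat. if k = 0 then [c1] else [c2]"
    have "measure R.M {g \<in> R.atom 1 gi. \<forall>k\<in>{0::nat, 1}. R.sec g ([] @ ?x # []) (?v k) \<in> fix_set j} =
          measure R.M (R.atom 1 gi) * (\<Prod>k\<in>{0::nat, 1}. measure \<mu> (fix_set j))"
      by (rule R.independent_sections[where v = ?v and ?w1.0 = "\<lambda>_. []" and ?w2.0 = "\<lambda>_. []"
            and y = ?v and jj = "\<lambda>_. j", OF gi _ xL])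
        (use R.level_set_fix_set c in \<open>auto simp: inj_on_def\<close>)
    then have "p * (?q j)\<^sup>2 = measure R.M {g \<in> R.atom 1 gi. \<forall>k\<in>{0::nat, 1}. R.sec g ([] @ ?x # []) (?v k) \<in> fix_set j}"
      by (simp add: p_def power2_eq_square)
    also have "\<dots> \<le> measure R.M (F j c1 \<inter> F j c2)"
    proof (rule R.P.P.finite_measure_mono)
      show "F j c1 \<inter> F j c2 \<in> sets R.M" using FM by blast
      show "{g \<in> R.atom 1 gi. \<forall>k\<in>{0::nat, 1}. R.sec g ([] @ ?x # []) (?v k) \<in> fix_set j} \<subseteq> F j c1 \<inter> F j c2"
        unfolding F_def R.atom_def R.agree_def gi_def by auto
    qed
    finally show ?thesis .
  qed
  \<comment> \<open>The union bound over the children adds up to \<open>?q j\<close>, since each is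
    fixed with probability \<open>1 / CARD('d)\<close>. The overlap for \<open>c1\<close> and
    \<open>c2\<close> supplies the decrease.\<close>
  have rec: "?q (Suc j) \<le> ?q j - p * (?q j)\<^sup>2" for j
  proof -
    have "?q (Suc j) = measure R.M {g \<in> space R.M. g 0 \<in> fix_set (Suc j)}"
      by (rule push[symmetric, OF R.level_set_sets[OF R.level_set_fix_set]])
    also have "\<dots> \<le> measure R.M (\<Union>a. F j a)"
    proof (rule R.P.P.finite_measure_mono)
      show "(\<Union>a. F j a) \<in> sets R.M" by (rule sets.finite_UN) (rule finite, rule FM)
      show "{g \<in> space R.M. g 0 \<in> fix_set (Suc j)} \<subseteq> (\<Union>a. F j a)"
      proof
        fix g assume g: "g \<in> {g \<in> space R.M. g 0 \<in> fix_set (Suc j)}"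
        then have gM: "g \<in> space R.M" by blast
        have "\<not> R.free_at (1 + j) [?x] g" using g by (auto simp: R.free_at_def fix_set_def lx)
        then obtain v where v: "length v = 1" "fold (lact g) [?x] v = v" "R.sec g [?x] v \<in> fix_set j"
          using R.not_free_at_sec[OF gM, of "[?x]" 1 j] xL by auto
        obtain a where a: "v = [a]" using v(1) by (auto simp: length_Suc_conv)
        have "g \<in> F j a" unfolding F_def using gM v a lx[of g] by simp
        then show "g \<in> (\<Union>a. F j a)" by (rule UN_I[OF UNIV_I])
      qed
    qed
    also have "\<dots> \<le> (\<Sum>a\<in>UNIV. measure R.M (F j a)) - measure R.M (F j c1 \<inter> F j c2)"
      by (rule R.P.P.measure_UN_le_diff[OF FM c])
    also have "(\<Sum>a\<in>UNIV. measure R.M (F j a)) = ?q j" by (simp only: mF) simp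
    finally show ?thesis using both[of j] by linarith
  qed
  have "?q 0 \<le> 1" by (rule R.P.M.prob_le_1)
  from quadratic_decay[of ?q, OF this rec p e] show ?thesis .
qed

end

section \<open>Orbits of a non-cyclic subgroup\<close>

text \<open>Trivial on sets containing words that are not reduced, so that letters act invertibly on all sets.\<close>

definition coset_act :: "letter \<Rightarrow> letter list set \<Rightarrow> letter list set" where
  "coset_act l C = (if \<forall>u\<in>C. reduced_word u then (\<lambda>u. nf (u @ [l])) ` C else C)"

lemma nf_snoc_inv:
  assumes "reduced_word u"
  shows "nf (nf (u @ [l]) @ [inv_letter l]) = u"
proof -
  have "nf (nf (u @ [l]) @ [inv_letter l]) = nf (nf (u @ [l]) @ nf [inv_letter l])"
    using nf_reduced[of "[inv_letter l]"] by (simp add: reduced_word_def)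
  also have "\<dots> = nf (u @ [l] @ [inv_letter l])" by (simp only: nf_append_nf append_assoc)
  also have "\<dots> = u" using nf_reduced[OF assms] by (simp add: nf_def)
  finally show ?thesis .
qed

lemma letter_action_coset: "letter_action {l :: letter. fst l < m} coset_act"
proof
  fix l :: letter and C assume "l \<in> {l. fst l < m}"
  then show "inv_letter l \<in> {l. fst l < m}" by simp
  show "coset_act (inv_letter l) (coset_act l C) = C"
  proof (cases "\<forall>u\<in>C. reduced_word u")
    case True
    then have 1: "coset_act l C = (\<lambda>u. nf (u @ [l])) ` C" unfolding coset_act_def by (rule if_P)
    then have "coset_act (inv_letter l) (coset_act l C) = (\<lambda>u. nf (nf (u @ [l]) @ [inv_letter l])) ` C"
      by (simp add: coset_act_def image_image)
    also have "\<dots> = (\<lambda>u. u) ` C" by (rule image_cong) (use True nf_snoc_inv in auto)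
    finally show ?thesis by simp
  next
    case False
    then show ?thesis by (simp only: coset_act_def if_False)
  qed
qed

lemma fold_coset_act:
  "\<forall>u\<in>C. reduced_word u \<Longrightarrow> fold coset_act w C = (\<lambda>u. nf (u @ w)) ` C"
proof (induction w arbitrary: C)
  case Nil
  have "(\<lambda>u. nf (u @ [])) ` C = (\<lambda>u. u) ` C" by (rule image_cong) (use Nil nf_reduced in auto)
  then show ?case by simp
next
  case (Cons l w)
  have 1: "coset_act l C = (\<lambda>u. nf (u @ [l])) ` C" unfolding coset_act_def by (rule if_P) (rule Cons.prems)
  have 2: "nf (nf (u @ [l]) @ w) = nf (u @ l # w)" for u
    using nf_append_nf[of "u @ [l]" w] nf_append_nf[of "nf (u @ [l])" w] nf_reduced[OF reduced_nf, of "u @ [l]"] by simp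
  have "fold coset_act w (coset_act l C) = (\<lambda>u. nf (u @ w)) ` coset_act l C"
    by (rule Cons.IH) (simp add: 1)
  also have "\<dots> = (\<lambda>u. nf (u @ l # w)) ` C" by (simp add: 1 image_image 2)
  finally show ?case by simp
qed

section \<open>Criteria for independence and measurability\<close>

context random_action
begin

lemma level_set_cyls: "A \<in> cyls \<Longrightarrow> \<exists>j. level_set j A"
proof -
  assume "A \<in> cyls"
  then consider "A = {}" | b j where "b \<in> W" "A = cyl b j" by (auto simp: cyls_def)
  then show ?thesis
  proof cases
    case 1
    then show ?thesis by (auto simp: level_set_def)
  next
    case 2
    then have "level_set j A" unfolding level_set_def using cyl_W cyl_eq by blast
    then show ?thesis ..
  qed
qed

text \<open>Cylinders form an intersection-stable generator, so the product formula on them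
  suffices: singletons \<open>J\<close> give the laws, and \<open>J = {..<K}\<close> gives
  independence.\<close>

lemma independent_haar:
  fixes K :: nat
  assumes E: "E \<in> sets M" "emeasure M E \<noteq> 0"
    and rv: "\<And>k. k < K \<Longrightarrow> \<xi> k \<in> measurable M \<mu>"
    and eq: "\<And>J A. J \<subseteq> {..<K} \<Longrightarrow> (\<And>k. k \<in> J \<Longrightarrow> A k \<in> cyls) \<Longrightarrow>
      measure M {g \<in> E. \<forall>k\<in>J. \<xi> k g \<in> A k} = measure M E * (\<Prod>k\<in>J. measure \<mu> (A k))"
  shows "prob_space.indep_vars (uniform_measure M E) (\<lambda>_. \<mu>) \<xi> {..<K} \<and>
    (\<forall>k<K. distr (uniform_measure M E) \<mu> (\<xi> k) = \<mu>)"
proof -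
  let ?U = "uniform_measure M E"
  have fin: "emeasure M E \<noteq> \<infinity>" by simp
  interpret U: prob_space ?U by (rule prob_space_uniform_measure[OF E(2) fin])
  have E0: "measure M E \<noteq> 0" using E(2) by (simp add: P.P.emeasure_eq_measure)
  have rvU: "\<xi> k \<in> measurable ?U \<mu>" if "k < K" for k
    using rv[OF that] by (simp cong: measurable_cong_sets)
  have cylM: "A \<in> sets \<mu>" if "A \<in> cyls" for A using that unfolding sets_mu by (rule sigma_sets.Basic)
  have pr: "measure ?U {g \<in> space M. \<forall>k\<in>J. \<xi> k g \<in> A k} = (\<Prod>k\<in>J. measure \<mu> (A k))"
    if J: "J \<subseteq> {..<K}" and A: "\<And>k. k \<in> J \<Longrightarrow> A k \<in> cyls" for J A
  proof -
    have finJ: "finite J" by (rule finite_subset[OF J finite_lessThan])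
    have S: "{g \<in> space M. \<forall>k\<in>J. \<xi> k g \<in> A k} \<in> sets M"
    proof (rule sets.sets_Collect_finite_All[OF _ finJ])
      fix k assume k: "k \<in> J"
      have "\<xi> k -` A k \<inter> space M \<in> sets M" by (rule measurable_sets[OF rv cylM[OF A[OF k]]]) (use J k in blast)+
      moreover have "\<xi> k -` A k \<inter> space M = {g \<in> space M. \<xi> k g \<in> A k}" by blast
      ultimately show "{g \<in> space M. \<xi> k g \<in> A k} \<in> sets M" by simp
    qed
    have "E \<inter> {g \<in> space M. \<forall>k\<in>J. \<xi> k g \<in> A k} = {g \<in> E. \<forall>k\<in>J. \<xi> k g \<in> A k}"
      using sets.sets_into_space[OF E(1)] by blast
    then have "measure ?U {g \<in> space M. \<forall>k\<in>J. \<xi> k g \<in> A k} = measure M {g \<in> E. \<forall>k\<in>J. \<xi> k g \<in> A k} / measure M E"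
      using measure_uniform_measure[OF E(2) fin S] by simp
    then show ?thesis using eq[OF J A] E0 by simp
  qed
  have one: "measure ?U (\<xi> k -` A \<inter> space ?U) = measure \<mu> A" if k: "k < K" and A: "A \<in> cyls" for k A
  proof -
    have "\<xi> k -` A \<inter> space ?U = {g \<in> space M. \<forall>k'\<in>{k}. \<xi> k' g \<in> A}" by auto
    then show ?thesis using pr[of "{k}" "\<lambda>_. A"] k A by simp
  qed
  have indep: "U.indep_vars (\<lambda>_. \<mu>) \<xi> {..<K}"
  proof (cases "K = 0")
    \<comment> \<open>\<open>indep_vars_finite\<close> speaks of non-empty index sets only.\<close>
    case True
    then show ?thesis by (simp add: U.indep_vars_def U.indep_sets_def)
  next
    case False
    have "U.indep_vars (\<lambda>_. \<mu>) \<xi> {..<K} \<longleftrightarrow> (\<forall>A\<in>(\<Pi> i\<in>{..<K}. cyls).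
      U.prob (\<Inter>j\<in>{..<K}. \<xi> j -` A j \<inter> space ?U) = (\<Prod>j\<in>{..<K}. U.prob (\<xi> j -` A j \<inter> space ?U)))"
    proof (rule U.indep_vars_finite)
      show "{..<K} \<noteq> {}" using False by auto
      show "sets \<mu> = sigma_sets (space \<mu>) cyls" by (simp only: sets_mu space_mu)
      show "Int_stable cyls" by (rule Int_stable_cyls)
      show "space \<mu> \<in> cyls" unfolding space_mu by (rule W_cyls)
      show "cyls \<subseteq> Pow (space \<mu>)" unfolding space_mu by (rule cyls_Pow)
      show "\<xi> i \<in> measurable ?U \<mu>" if "i \<in> {..<K}" for i using rvU that by simp
    qed simp
    moreover have "U.prob (\<Inter>j\<in>{..<K}. \<xi> j -` A j \<inter> space ?U) = (\<Prod>j\<in>{..<K}. U.prob (\<xi> j -` A j \<inter> space ?U))"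
      if A: "A \<in> (\<Pi> i\<in>{..<K}. cyls)" for A
    proof -
      have Ac: "A k \<in> cyls" if "k \<in> {..<K}" for k using A that by blast
      have "(\<Inter>j\<in>{..<K}. \<xi> j -` A j \<inter> space ?U) = {g \<in> space M. \<forall>k\<in>{..<K}. \<xi> k g \<in> A k}"
        using False by auto
      then have "U.prob (\<Inter>j\<in>{..<K}. \<xi> j -` A j \<inter> space ?U) = (\<Prod>k\<in>{..<K}. measure \<mu> (A k))"
        using pr[OF subset_refl Ac] by simp
      also have "\<dots> = (\<Prod>j\<in>{..<K}. U.prob (\<xi> j -` A j \<inter> space ?U))"
        by (rule prod.cong[OF refl]) (use one Ac in simp)
      finally show ?thesis .
    qed
    ultimately show ?thesis by blast
  qed
  have "distr ?U \<mu> (\<xi> k) = \<mu>" if k: "k < K" for k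
  proof (rule measure_eqI_generator_eq[where E = cyls and \<Omega> = W and A = "\<lambda>_. W"])
    interpret D: prob_space "distr ?U \<mu> (\<xi> k)" by (rule U.prob_space_distr[OF rvU[OF k]])
    show "Int_stable cyls" "cyls \<subseteq> Pow W" by (rule Int_stable_cyls, rule cyls_Pow)
    show "sets (distr ?U \<mu> (\<xi> k)) = sigma_sets W cyls" "sets \<mu> = sigma_sets W cyls" by (simp_all add: sets_mu)
    show "range (\<lambda>_::nat. W) \<subseteq> cyls" using W_cyls by blast
    show "(\<Union>i::nat. W) = W" by simp
    show "emeasure (distr ?U \<mu> (\<xi> k)) W \<noteq> \<infinity>" by simp
    fix A assume A: "A \<in> cyls"
    have "emeasure (distr ?U \<mu> (\<xi> k)) A = emeasure ?U (\<xi> k -` A \<inter> space ?U)"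
      by (rule emeasure_distr[OF rvU[OF k] cylM[OF A]])
    also have "\<dots> = ennreal (measure \<mu> A)"
      unfolding U.emeasure_eq_measure one[OF k A] ..
    also have "\<dots> = emeasure \<mu> A" by (rule P.M.emeasure_eq_measure[symmetric])
    finally show "emeasure (distr ?U \<mu> (\<xi> k)) A = emeasure \<mu> A" .
  qed
  then show ?thesis using indep by blast
qed

text \<open>Where \<open>N g = n\<close>, the event depends on level \<open>n + e\<close> only, and
  \<open>N\<close> takes countably many values.\<close>

lemma sec_measurable:
  fixes N :: "_ \<Rightarrow> nat"
  assumes N: "\<And>n. {g \<in> space M. N g = n} \<in> sets M"
    and F: "\<And>n g g'. g \<in> space M \<Longrightarrow> g' \<in> space M \<Longrightarrow> N g = n \<Longrightarrow> N g' = n \<Longrightarrow> agree (n + e) g g' \<Longrightarrow>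
      (F g \<in> S) = (F g' \<in> S)"
  shows "F -` S \<inter> space M \<in> sets M"
proof -
  \<comment> \<open>Saturation under \<open>agree (n + e)\<close> makes the event determined; where
    \<open>N g = n\<close> it adds nothing.\<close>
  let ?Q = "\<lambda>n g. \<exists>g'\<in>space M. N g' = n \<and> agree (n + e) g g' \<and> F g' \<in> S"
  have det: "determined (n + e) (?Q n)" for n
    unfolding determined_def using agree_sym agree_trans by blast
  have "F -` S \<inter> space M = (\<Union>n. {g \<in> space M. N g = n} \<inter> {g \<in> space M. ?Q n g})"
  proof
    show "F -` S \<inter> space M \<subseteq> (\<Union>n. {g \<in> space M. N g = n} \<inter> {g \<in> space M. ?Q n g})"
    proof
      fix g assume g: "g \<in> F -` S \<inter> space M"
      then have "?Q (N g) g" using agree_refl by blast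
      then show "g \<in> (\<Union>n. {g \<in> space M. N g = n} \<inter> {g \<in> space M. ?Q n g})" using g by blast
    qed
    show "(\<Union>n. {g \<in> space M. N g = n} \<inter> {g \<in> space M. ?Q n g}) \<subseteq> F -` S \<inter> space M"
    proof
      fix g assume "g \<in> (\<Union>n. {g \<in> space M. N g = n} \<inter> {g \<in> space M. ?Q n g})"
      then obtain n g' where "g \<in> space M" "N g = n" "g' \<in> space M" "N g' = n" "agree (n + e) g g'" "F g' \<in> S"
        by blast
      then show "g \<in> F -` S \<inter> space M" using F[of g g' n] by blast
    qed
  qed
  moreover have "(\<Union>n. {g \<in> space M. N g = n} \<inter> {g \<in> space M. ?Q n g}) \<in> sets M"
    by (rule sets.countable_UN) (use N determined_sets[OF det] in blast)
  ultimately show ?thesis by simp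
qed

end

lemma (in random_action) Lt_iff: "set w \<subseteq> Lt \<longleftrightarrow> fst ` set w \<subseteq> {..<m}"
  by (auto simp: Lt_def)

section \<open>Subgroups and their orbits on levels\<close>

locale random_subgroup = random_action H \<mu> m
  for H :: "('d::finite \<Rightarrow> 'd) set" and \<mu> :: "('d list \<Rightarrow> 'd list) measure" and m :: nat +
  fixes \<Delta> :: "letter list set" and K :: nat
  assumes sub: "subgroup \<Delta> (free_group m)"
begin

lemma \<Delta>_word: "w \<in> \<Delta> \<Longrightarrow> reduced_word w \<and> set w \<subseteq> Lt"
  using subgroup.subset[OF sub] by (auto simp: free_group_simps Lt_def)

lemma \<Delta>_Nil: "[] \<in> \<Delta>"
  using subgroup.one_closed[OF sub] by (simp add: free_group_simps)

lemma \<Delta>_append: "u \<in> \<Delta> \<Longrightarrow> v \<in> \<Delta> \<Longrightarrow> nf (u @ v) \<in> \<Delta>"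
  using subgroup.m_closed[OF sub, of u v] \<Delta>_word[of v] by (simp add: free_group_simps nf_append nf_reduced)

lemma \<Delta>_inv: "u \<in> \<Delta> \<Longrightarrow> inv_word u \<in> \<Delta>"
  using subgroup.m_inv_closed[OF sub, of u] inv_free_group[of u m] subgroup.subset[OF sub] by auto

lemma fold_nf_lact: "g \<in> space M \<Longrightarrow> set w \<subseteq> Lt \<Longrightarrow> fold (lact g) (nf w) v = fold (lact g) w v"
  by (rule letter_action.fold_nf[OF letter_action_lact])

text \<open>Right multiplication by an element of a subgroup permutes the subgroup. This makes
  \<open>{\<Delta>} \<times> Z\<close> invariant under \<open>a\<close> and
  \<open>b\<close>.\<close>

lemma fold_coset_\<Delta>:
  assumes w: "w \<in> \<Delta>"
  shows "fold coset_act w \<Delta> = \<Delta>"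
proof -
  have "fold coset_act w \<Delta> = (\<lambda>u. nf (u @ w)) ` \<Delta>" by (rule fold_coset_act) (use \<Delta>_word in blast)
  also have "\<dots> = \<Delta>"
  proof
    show "(\<lambda>u. nf (u @ w)) ` \<Delta> \<subseteq> \<Delta>" using \<Delta>_append w by blast
    show "\<Delta> \<subseteq> (\<lambda>u. nf (u @ w)) ` \<Delta>"
    proof
      fix u assume u: "u \<in> \<Delta>"
      have "nf (nf (u @ inv_word w) @ w) = nf (nf (u @ inv_word w) @ nf w)"
        using nf_reduced \<Delta>_word[OF w] by simp
      also have "\<dots> = nf (u @ inv_word w @ w)" by (simp only: nf_append_nf append_assoc)
      also have "\<dots> = foldr push_letter u (foldr push_letter (inv_word w) (foldr push_letter w []))"
        by (simp add: nf_def)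
      also have "\<dots> = foldr push_letter u []" by (simp only: foldr_push_inv_word[OF reduced_Nil])
      also have "\<dots> = u" using nf_reduced \<Delta>_word[OF u] by (simp add: nf_def)
      finally show "u \<in> (\<lambda>u. nf (u @ w)) ` \<Delta>"
        using \<Delta>_append[OF u \<Delta>_inv[OF w]] by (intro image_eqI[of _ _ "nf (u @ inv_word w)"]) simp_all
    qed
  qed
  finally show ?thesis .
qed

abbreviation D where "D \<equiv> (free_group m)\<lparr>carrier := \<Delta>\<rparr>"

lemma orbits_eq:
  assumes g: "g \<in> space M"
  shows "orbits D (tree_level n) (free_hom G g) = {{fold (lact g) w v | w. w \<in> \<Delta>} | v. length v = n}"
proof -
  have "{free_hom G g w v | w. w \<in> \<Delta>} = {fold (lact g) w v | w. w \<in> \<Delta>}" for v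
    using free_hom_fold[OF g] \<Delta>_word by (metis (no_types, opaque_lifting))
  then show ?thesis by (simp add: orbits_def orbit_def tree_level_def)
qed

text \<open>The unreduced factorisation is kept next to the group element \<open>\<alpha> k\<close>,
  because the crossing of the private edge is read off from it. All conditions concern the action on
  level \<open>n\<close> only.\<close>

definition loops :: "(nat \<Rightarrow> 'd list \<Rightarrow> 'd list) \<Rightarrow> nat \<Rightarrow> 'd list set \<Rightarrow> 'd list \<Rightarrow> (nat \<Rightarrow> letter list) \<Rightarrow> letter \<Rightarrow>
    (nat \<Rightarrow> letter list) \<Rightarrow> (nat \<Rightarrow> letter list) \<Rightarrow> bool" where
  "loops g n Z v \<alpha> x w1 w2 \<longleftrightarrow> v \<in> Z \<and> length v = n \<and> x \<in> Lt \<and>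
    (\<forall>k<K. set (w1 k) \<subseteq> Lt \<and> set (w2 k) \<subseteq> Lt \<and> \<alpha> k = nf (w1 k @ x # w2 k) \<and> \<alpha> k \<in> \<Delta> \<and>
      fold (lact g) (w1 k @ x # w2 k) v = v) \<and>
    inj_on (\<lambda>k. fold (lact g) (w1 k) v) {..<K} \<and>
    (\<forall>j<K. \<forall>k<K. avoids (lact g) x (fold (lact g) (w1 j) v) (w1 k) v \<and>
       avoids (lact g) x (fold (lact g) (w1 j) v) (w2 k) (lact g x (fold (lact g) (w1 k) v)))"

lemma loops_agree:
  assumes g: "g \<in> space M" "g' \<in> space M" "agree n g g'" and l: "loops g n Z v \<alpha> x w1 w2"
  shows "loops g' n Z v \<alpha> x w1 w2"
proof -
  have v: "length v \<le> n" and x: "x \<in> Lt" using l by (auto simp: loops_def)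
  have wL: "set (w1 k) \<subseteq> Lt" "set (w2 k) \<subseteq> Lt" if "k < K" for k using l that by (auto simp: loops_def)
  have f1: "fold (lact g') (w1 k) v = fold (lact g) (w1 k) v" if "k < K" for k
    by (rule fold_agree[OF g wL(1)[OF that] v, symmetric])
  have f2: "fold (lact g') (w1 k @ x # w2 k) v = fold (lact g) (w1 k @ x # w2 k) v" if "k < K" for k
    by (rule fold_agree[OF g _ v, symmetric]) (use wL that x in auto)
  have len: "length (fold (lact g) (w1 k) v) \<le> n" if "k < K" for k
    using length_fold[OF g(1) wL(1)[OF that], of v] v by simp
  have lx: "lact g' x (fold (lact g) (w1 k) v) = lact g x (fold (lact g) (w1 k) v)" if "k < K" for k
    by (rule lact_agree[OF g x len[OF that], symmetric])
  have len': "length (lact g x (fold (lact g) (w1 k) v)) \<le> n" if "k < K" for k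
    using length_lact[OF g(1) x] len[OF that] by simp
  have inj: "inj_on (\<lambda>k. fold (lact g') (w1 k) v) {..<K}"
    using inj_on_cong[of "{..<K}" "\<lambda>k. fold (lact g') (w1 k) v" "\<lambda>k. fold (lact g) (w1 k) v"] f1 l
    by (simp add: loops_def)
  have a1: "avoids (lact g') x y (w1 k) v = avoids (lact g) x y (w1 k) v" if "k < K" for k y
    by (rule avoids_agree[OF g wL(1)[OF that] v, symmetric])
  have a2: "avoids (lact g') x y (w2 k) (lact g x (fold (lact g) (w1 k) v)) =
     avoids (lact g) x y (w2 k) (lact g x (fold (lact g) (w1 k) v))" if "k < K" for k y
    by (rule avoids_agree[OF g wL(2)[OF that] len'[OF that], symmetric])
  show ?thesis
    using l inj unfolding loops_def by (simp only: f1 f2 lx a1 a2 simp_thms cong: conj_cong imp_cong) 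
qed

end

text \<open>The constants of \<open>fibred_action\<close> for a fixed pair \<open>a\<close>,
  \<open>b\<close>. The last summand of \<open>R\<close> covers the products of powers of
  \<open>a\<close> and of \<open>b\<close> or its inverse with exponents up to \<open>Q\<close>. No
  constant involves the random action, the level or the orbit.\<close>

locale noncyclic_subgroup = random_subgroup +
  fixes f c b a :: "letter list" and \<rho> P B M0 Mc r0 V Q R :: nat
  assumes a_def: "a = f @ c @ inv_word f"
    and \<rho>_def: "\<rho> = length a + length b"
    and P_def: "P = card (words_upto Lt \<rho>)"
    and B_def: "B = 2 * K * P"
    and M0_def: "M0 = (length a * B) * (length b * B)"
    and Mc_def: "Mc = P * (M0 + \<rho> * B)"
    and r0_def: "r0 = (Mc + 2) * length c + length f + 2"
    and V_def: "V = length f * B + (B + K) * card (words_upto Lt r0)"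
    and Q_def: "Q = Mc + P * (V + \<rho> * B)"
    and R_def: "R = r0 + 2 + Q * (length a + length b)"
    and a\<Delta>: "a \<in> \<Delta>" and b\<Delta>: "b \<in> \<Delta>" and c: "c \<noteq> []" "reduced_word (c @ c)"
    and no_common: "\<And>i j. i \<noteq> 0 \<or> j \<noteq> 0 \<Longrightarrow> nf (word_pow i a @ word_pow j b) \<noteq> [] \<and>
       nf (word_pow i a @ word_pow j (inv_word b)) \<noteq> []"
begin

lemma finite_Lt: "finite Lt"
proof -
  have "Lt = {..<m} \<times> UNIV" by (auto simp: Lt_def)
  then show ?thesis by simp
qed

definition good :: "nat \<Rightarrow> (nat \<Rightarrow> 'a list \<Rightarrow> 'a list) \<Rightarrow> bool" where
  "good n g \<longleftrightarrow> (\<forall>w. reduced_word w \<and> w \<noteq> [] \<and> set w \<subseteq> Lt \<and> length w \<le> R \<longrightarrow> free_at n w g)"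

lemma determined_good: "determined n (good n)"
  using determined_free_at unfolding determined_def good_def by blast

text \<open>\<open>good\<close> supplies both freeness conditions of \<open>fibred_action\<close>:
  \<open>girth\<close> directly, and \<open>indep\<close> through the reduced forms of
  \<open>word_pow i a\<close> followed by a power of \<open>b\<close> or of its inverse, which
  \<open>no_common\<close> shows to be non-empty.\<close>

lemma loops_exist:
  assumes g: "g \<in> space M" and good: "good n g" and v0: "length v0 = n"
    and Z: "Z = {fold (lact g) w v0 | w. w \<in> \<Delta>}"
  shows "\<exists>v \<alpha> x w1 w2. loops g n Z v \<alpha> x w1 w2"
proof -
  \<comment> \<open>The coset component records membership in \<open>\<Delta>\<close>, the vertex
    component records the position on the level.\<close>
  let ?za = "\<lambda>l (C, v). (coset_act l C, lact g l v)"
  \<comment> \<open>All letters have to preserve \<open>?Y\<close>, so it is the whole level; the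
    orbit \<open>Z\<close> enters through \<open>?B0\<close>.\<close>
  let ?Y = "{v :: 'a list. length v = n}" and ?B0 = "{\<Delta>} \<times> Z"
  have letter_za: "letter_action Lt ?za"
  proof
    fix l z assume l: "l \<in> Lt"
    then show "inv_letter l \<in> Lt" by (simp add: Lt_def)
    show "?za (inv_letter l) (?za l z) = z"
      using letter_action.za_inv[OF letter_action_coset[of m], of l] letter_action.za_inv[OF letter_action_lact[OF g] l] l
      by (cases z) (simp add: Lt_def)
  qed
  have fold_za: "fold ?za w (C, v) = (fold coset_act w C, fold (lact g) w v)" for w C v
    by (induction w arbitrary: C v) simp_all
  have ZY: "Z \<subseteq> ?Y" using Z length_fold[OF g] \<Delta>_word v0 by auto
  have Zclosed: "fold (lact g) d v \<in> Z" if d: "d \<in> \<Delta>" and v: "v \<in> Z" for d v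
  proof -
    obtain w where w: "w \<in> \<Delta>" "v = fold (lact g) w v0" using v Z by blast
    have "fold (lact g) d v = fold (lact g) (w @ d) v0" using w by simp
    also have "\<dots> = fold (lact g) (nf (w @ d)) v0"
      by (rule fold_nf_lact[OF g, symmetric]) (use \<Delta>_word w d in auto)
    finally show ?thesis using \<Delta>_append[OF w(1) d] Z by blast
  qed
  have girth: "fold (lact g) w y \<noteq> y"
    if "y \<in> ?Y" "reduced_word w" "w \<noteq> []" "set w \<subseteq> Lt" "length w \<le> R" for w y
    using good that by (auto simp: good_def free_at_def)
  have aL: "set a \<subseteq> Lt" and bL: "set b \<subseteq> Lt" and ra: "reduced_word a" using \<Delta>_word a\<Delta> b\<Delta> by blast+
  interpret la: letter_action Lt "lact g" by (rule letter_action_lact[OF g])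
  have nofix: "fold (lact g) u y \<noteq> y"
    if y: "y \<in> ?Y" and u: "nf u \<noteq> []" "set u \<subseteq> Lt" "length u \<le> R" for u y
  proof -
    have "fold (lact g) (nf u) y \<noteq> y"
    proof (rule girth[OF y reduced_nf u(1)])
      show "set (nf u) \<subseteq> Lt" using set_nf[of u] u(2) unfolding Lt_iff by blast
      show "length (nf u) \<le> R" using length_nf[of u] u(3) by simp
    qed
    then show ?thesis using fold_nf_lact[OF g u(2)] by simp
  qed
  have ind: "(fold (lact g) a ^^ i) y \<noteq> (fold (lact g) b ^^ j) y \<and> (fold (lact g) b ^^ j) ((fold (lact g) a ^^ i) y) \<noteq> y"
    if y: "y \<in> ?Y" and ij: "i \<le> Q" "j \<le> Q" "i \<noteq> 0 \<or> j \<noteq> 0" for y i j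
  proof -
    have pL: "set (word_pow i a) \<subseteq> Lt" "set (word_pow j b) \<subseteq> Lt" using set_word_pow aL bL by blast+
    have len: "i * length a + j * length b \<le> R"
    proof -
      have "i * length a \<le> Q * length a" "j * length b \<le> Q * length b" using ij by simp_all
      then show ?thesis unfolding R_def add_mult_distrib2 by linarith
    qed
    have 1: "fold (lact g) (word_pow i a @ word_pow j b) y \<noteq> y"
      by (rule nofix[OF y]) (use no_common[OF ij(3)] pL len in simp_all)
    have 2: "fold (lact g) (word_pow i a @ word_pow j (inv_word b)) y \<noteq> y"
      by (rule nofix[OF y]) (use no_common[OF ij(3)] pL len la.set_inv_word[OF pL(2)] in \<open>simp_all add: inv_word_pow[symmetric]\<close>)
    have "fold (lact g) (word_pow i a) y \<noteq> fold (lact g) (word_pow j b) y"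
    proof
      assume e: "fold (lact g) (word_pow i a) y = fold (lact g) (word_pow j b) y"
      have "fold (lact g) (inv_word (word_pow j b)) (fold (lact g) (word_pow i a) y) = y"
        unfolding e by (rule la.fold_inv_word[OF pL(2)])
      then show False using 2 by (simp add: inv_word_pow)
    qed
    then show ?thesis using 1 by (simp add: fold_word_pow)
  qed
  have finY: "finite ?Y" by (rule finite_subset[OF _ finite_words_length[of n]]) auto
  have finZ: "finite Z" by (rule finite_subset[OF ZY finY])
  have "fold (lact g) [] v0 \<in> Z" using Z \<Delta>_Nil by blast
  then have Zne: "Z \<noteq> {}" by blast
  interpret fa: fibred_action Lt ?za "lact g" snd ?Y ?B0 f c b K R Q P \<rho> B M0 Mc r0 V a
  proof (intro fibred_action.intro letter_za la.letter_action_axioms fibred_action_axioms.intro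
      a_def \<rho>_def P_def B_def M0_def Mc_def r0_def V_def finite_Lt girth)
    show "l \<in> Lt \<Longrightarrow> snd (?za l z) = lact g l (snd z)" for l z by (cases z) simp
    show "l \<in> Lt \<Longrightarrow> y \<in> ?Y \<Longrightarrow> lact g l y \<in> ?Y" for l y using length_lact[OF g] by simp
    show "y \<in> ?Y \<Longrightarrow> i \<le> Q \<Longrightarrow> j \<le> Q \<Longrightarrow> i \<noteq> 0 \<or> j \<noteq> 0 \<Longrightarrow> (fold (lact g) a ^^ i) y \<noteq> (fold (lact g) b ^^ j) y \<and>
      (fold (lact g) b ^^ j) ((fold (lact g) a ^^ i) y) \<noteq> y" for y i j by (rule ind)
    show "finite ?B0" using finZ by simp
    show "?B0 \<noteq> {}" using Zne by simp
    show "inj_on snd ?B0" by (auto simp: inj_on_def)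
    show "snd ` ?B0 \<subseteq> ?Y" using ZY by auto
    show "fold ?za a ` ?B0 \<subseteq> ?B0" using fold_coset_\<Delta>[OF a\<Delta>] Zclosed[OF a\<Delta>] by (auto simp: fold_za)
    show "fold ?za b ` ?B0 \<subseteq> ?B0" using fold_coset_\<Delta>[OF b\<Delta>] Zclosed[OF b\<Delta>] by (auto simp: fold_za)
    show "set f \<subseteq> Lt" "set c \<subseteq> Lt" "set b \<subseteq> Lt" using aL bL by (auto simp: a_def)
    show "c \<noteq> []" "reduced_word (c @ c)" by (rule c)+
    show "reduced_word (f @ c)" using ra c(1) by (auto simp: a_def reduced_append_iff)
    show "Mc + P * (V + \<rho> * B) \<le> Q" by (simp add: Q_def)
    show "r0 + 2 \<le> R" by (simp add: R_def)
  qed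
  obtain z0 x ys w1 w2 where z0: "z0 \<in> ?B0" and x: "x \<in> Lt" and inj: "inj_on ys {..<K}"
    and w: "\<forall>k<K. set (w1 k) \<subseteq> Lt \<and> set (w2 k) \<subseteq> Lt \<and> fold ?za (w1 k @ x # w2 k) z0 = z0 \<and>
       ys k = fold (lact g) (w1 k) (snd z0) \<and>
       (\<forall>j<K. avoids (lact g) x (ys j) (w1 k) (snd z0) \<and> avoids (lact g) x (ys j) (w2 k) (lact g x (ys k)))"
    using fa.independent_loops by (elim bexE exE conjE) (rule that, assumption+)
  obtain v where v: "z0 = (\<Delta>, v)" "v \<in> Z" using z0 by blast
  note w = w[THEN spec, THEN mp]
  have ys: "ys k = fold (lact g) (w1 k) v" if "k < K" for k using w[OF that] v(1) by simp
  have closed: "nf (w1 k @ x # w2 k) \<in> \<Delta>" "fold (lact g) (w1 k @ x # w2 k) v = v" if k: "k < K" for k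
  proof -
    let ?w = "w1 k @ x # w2 k"
    have "(fold coset_act ?w \<Delta>, fold (lact g) ?w v) = (\<Delta>, v)"
      using w[OF k] unfolding v(1) fold_za by (elim conjE)
    then have e: "fold coset_act ?w \<Delta> = \<Delta>" "fold (lact g) ?w v = v" by blast+
    show "fold (lact g) ?w v = v" by (rule e(2))
    have "fold coset_act ?w \<Delta> = (\<lambda>u. nf (u @ ?w)) ` \<Delta>" by (rule fold_coset_act) (use \<Delta>_word in blast)
    then have "(\<lambda>u. nf (u @ ?w)) ` \<Delta> = \<Delta>" using e(1) by simp
    \<comment> \<open>A word that fixes the coset \<open>\<Delta>\<close> represents the image of
      the identity, hence an element of \<open>\<Delta>\<close>.\<close>
    then have "nf ([] @ ?w) \<in> \<Delta>" using \<Delta>_Nil by blast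
    then show "nf ?w \<in> \<Delta>" by simp
  qed
  have inj': "inj_on (\<lambda>k. fold (lact g) (w1 k) v) {..<K}"
    using inj inj_on_cong[of "{..<K}" ys "\<lambda>k. fold (lact g) (w1 k) v"] ys by simp
  have av: "avoids (lact g) x (fold (lact g) (w1 j) v) (w1 k) v \<and>
       avoids (lact g) x (fold (lact g) (w1 j) v) (w2 k) (lact g x (fold (lact g) (w1 k) v))"
    if "j < K" "k < K" for j k
  proof -
    have "\<forall>j<K. avoids (lact g) x (ys j) (w1 k) (snd z0) \<and> avoids (lact g) x (ys j) (w2 k) (lact g x (ys k))"
      using w[OF that(2)] by (elim conjE)
    from this[THEN spec, THEN mp, OF that(1)] show ?thesis
      unfolding ys[OF that(1)] ys[OF that(2)] v(1) snd_conv .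
  qed
  have wL: "set (w1 k) \<subseteq> Lt" "set (w2 k) \<subseteq> Lt" if "k < K" for k
    by (rule w[OF that, THEN conjunct1], rule w[OF that, THEN conjunct2, THEN conjunct1])
  have "loops g n Z v (\<lambda>k. nf (w1 k @ x # w2 k)) x w1 w2"
    unfolding loops_def
    apply (intro conjI allI impI v(2) x inj')
    subgoal using v(2) ZY by blast
    subgoal by (erule wL(1))
    subgoal by (erule wL(2))
    subgoal by (rule refl)
    subgoal by (erule closed(1))
    subgoal by (erule closed(2))
    subgoal by (drule (1) av) (erule conjunct1)
    subgoal by (drule (1) av) (erule conjunct2)
    done
  then show ?thesis by blast
qed

text \<open>The value 0 is reserved for the absence of a good positive level.\<close>

definition N :: "(nat \<Rightarrow> 'a list \<Rightarrow> 'a list) \<Rightarrow> nat" where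
  "N g = (if \<exists>n>0. good n g then (LEAST n. 0 < n \<and> good n g) else 0)"

lemma N_pos: assumes "\<exists>n>0. good n g" shows "0 < N g" "good (N g) g"
proof -
  have "0 < (LEAST n. 0 < n \<and> good n g) \<and> good (LEAST n. 0 < n \<and> good n g) g"
    by (rule LeastI_ex) (rule assms)
  then show "0 < N g" "good (N g) g" using assms by (simp_all add: N_def)
qed

lemma N_eq_iff:
  assumes n: "0 < n"
  shows "N g = n \<longleftrightarrow> good n g \<and> (\<forall>k. 0 < k \<and> k < n \<longrightarrow> \<not> good k g)"
proof
  assume e: "N g = n"
  have ex: "\<exists>n>0. good n g"
  proof (rule ccontr)
    assume "\<not> (\<exists>n>0. good n g)"
    then have "N g = 0" unfolding N_def by (rule if_not_P)
    then show False using e n by simp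
  qed
  have L: "n = (LEAST n. 0 < n \<and> good n g)" using e ex by (simp add: N_def)
  have "\<not> good k g" if "0 < k" "k < n" for k
    using not_less_Least[of k "\<lambda>n. 0 < n \<and> good n g"] that L by blast
  then show "good n g \<and> (\<forall>k. 0 < k \<and> k < n \<longrightarrow> \<not> good k g)" using N_pos(2)[OF ex] e by blast
next
  assume a: "good n g \<and> (\<forall>k. 0 < k \<and> k < n \<longrightarrow> \<not> good k g)"
  have "(LEAST n. 0 < n \<and> good n g) = n"
  proof (rule Least_equality)
    show "0 < n \<and> good n g" using a n by blast
    fix k assume "0 < k \<and> good k g"
    then show "n \<le> k" using a by (meson not_le_imp_less)
  qed
  moreover have "\<exists>n>0. good n g" using a n by blast
  ultimately show "N g = n" by (simp add: N_def)
qed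

text \<open>\<open>N\<close> is a stopping time for the filtration by levels: whether
  \<open>N g = n\<close> is decided by \<open>good\<close> on the levels up to
  \<open>n\<close>.\<close>

lemma determined_N:
  assumes n: "0 < n"
  shows "determined n (\<lambda>g. N g = n)"
  unfolding N_eq_iff[OF n] determined_def
proof (intro ballI impI)
  fix g g' assume g: "g \<in> space M" "g' \<in> space M" "agree n g g'"
  have "good k g = good k g'" if "k \<le> n" for k
    using determined_good[of k] g(1,2) agree_mono[OF g(3) that] unfolding determined_def by blast
  then show "(good n g \<and> (\<forall>k. 0 < k \<and> k < n \<longrightarrow> \<not> good k g)) = (good n g' \<and> (\<forall>k. 0 < k \<and> k < n \<longrightarrow> \<not> good k g'))"
    by (metis less_imp_le_nat order.refl)
qed

lemma N_sets: "{g \<in> space M. N g = n} \<in> sets M"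
proof (cases "n = 0")
  case False
  then show ?thesis using determined_sets[OF determined_N] by simp
next
  case True
  have "{g \<in> space M. N g = n} = space M - (\<Union>k. {g \<in> space M. good (Suc k) g})"
  proof -
    have "N g = 0 \<longleftrightarrow> \<not> (\<exists>k. good (Suc k) g)" for g
    proof (cases "\<exists>n>0. good n g")
      case T: True
      then obtain n where "0 < n" "good n g" by (elim exE conjE)
      then have "good (Suc (n - 1)) g" by simp
      then have "\<exists>k. good (Suc k) g" by (rule exI)
      then show ?thesis using N_pos(1)[OF T] by simp
    next
      case F: False
      have "\<not> good (Suc k) g" for k
      proof
        assume "good (Suc k) g"
        then have "\<exists>n>0. good n g" by (intro exI[of _ "Suc k"] conjI) simp_all
        then show False using F by (rule notE[rotated])
      qed
      moreover have "N g = 0" unfolding N_def by (rule if_not_P[OF F])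
      ultimately show ?thesis by simp
    qed
    then show ?thesis unfolding True by blast
  qed
  moreover have "(\<Union>k. {g \<in> space M. good (Suc k) g}) \<in> sets M"
  proof (rule sets.countable_UN, rule subsetI)
    fix S assume "S \<in> range (\<lambda>k. {g \<in> space M. good (Suc k) g})"
    then obtain k where S: "S = {g \<in> space M. good (Suc k) g}" by (rule rangeE)
    show "S \<in> sets M" unfolding S by (rule determined_sets[OF determined_good])
  qed
  ultimately show ?thesis by simp
qed

text \<open>Finitely many words are concerned and freeness passes to deeper levels, so the largest
  of their levels serves for all.\<close>

lemma AE_good:
  assumes q0: "\<And>\<epsilon>. 0 < \<epsilon> \<Longrightarrow> \<exists>j. measure \<mu> (fix_set j) < \<epsilon>"
  shows "AE g in M. \<exists>n>0. good n g"
proof -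
  let ?W = "{w \<in> words_upto Lt R. reduced_word w \<and> w \<noteq> []}"
  have fin: "finite ?W" using finite_words_upto[OF finite_Lt] by simp
  have "AE g in M. \<forall>w\<in>?W. \<exists>n. free_at n w g"
  proof (rule AE_finite_allI[OF fin])
    fix w assume "w \<in> ?W"
    then show "AE g in M. \<exists>n. free_at n w g"
      using AE_eventually_free[OF q0, of w] by (simp add: words_upto_def)
  qed
  then show ?thesis
  proof (rule AE_mp, intro AE_I2 impI)
    fix g assume g: "g \<in> space M" and "\<forall>w\<in>?W. \<exists>n. free_at n w g"
    from this(2) have "\<exists>nn. \<forall>w\<in>?W. free_at (nn w) w g" by (intro bchoice)
    then obtain nn where nn: "\<And>w. w \<in> ?W \<Longrightarrow> free_at (nn w) w g" by (elim exE) (drule meta_spec, erule meta_mp, erule bspec)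
    let ?n = "Max (insert 1 (nn ` ?W))"
    have "free_at ?n w g" if w: "w \<in> ?W" for w
    proof (rule free_at_mono[OF g _ nn[OF w]])
      show "set w \<subseteq> Lt" using w by (simp add: words_upto_def)
      show "nn w \<le> ?n" by (rule Max_ge) (use fin w in simp_all)
    qed
    then have "good ?n g" by (simp add: good_def words_upto_def)
    moreover have "1 \<le> ?n" by (rule Max_ge) (use fin in simp_all)
    ultimately show "\<exists>n>0. good n g" by (intro exI[of _ ?n] conjI) simp_all
  qed
qed

text \<open>Passing to the atom of \<open>g\<close> makes the choice in \<open>dat\<close> depend on the action on level \<open>N g\<close> only.\<close>

definition admissible :: "'a list set \<Rightarrow> (nat \<Rightarrow> 'a list \<Rightarrow> 'a list) \<Rightarrow> 'a list \<times> (nat \<Rightarrow> letter list) \<Rightarrow> bool" where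
  "admissible Z g d \<longleftrightarrow> (\<exists>g'\<in>atom (N g) g. \<exists>x w1 w2. loops g' (N g) Z (fst d) (snd d) x w1 w2)"

definition dat :: "'a list set \<Rightarrow> (nat \<Rightarrow> 'a list \<Rightarrow> 'a list) \<Rightarrow> 'a list \<times> (nat \<Rightarrow> letter list)" where
  "dat Z g = (if \<exists>d. admissible Z g d then (SOME d. admissible Z g d) else ([], \<lambda>_. []))"

lemma dat_eq:
  assumes "N g = N g'" "agree (N g) g g'"
  shows "dat Z g = dat Z g'"
proof -
  have "atom (N g) g = atom (N g') g'"
  proof -
    have "agree (N g) g h \<longleftrightarrow> agree (N g) g' h" for h
      using agree_trans[OF assms(2), of h] agree_trans[OF agree_sym[OF assms(2)], of h] by argo
    then show ?thesis unfolding atom_def assms(1)[symmetric] by simp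
  qed
  then have "admissible Z g d = admissible Z g' d" for d
    unfolding admissible_def by (simp only: assms(1))
  then have "admissible Z g = admissible Z g'" by (rule ext)
  then show ?thesis by (simp add: dat_def)
qed

lemma dat_admissible: "admissible Z g d \<Longrightarrow> admissible Z g (dat Z g)"
  unfolding dat_def by (subst if_P, rule exI, assumption, rule someI)

lemma admissible_loops:
  assumes g: "g \<in> space M" and d: "admissible Z g d"
  shows "\<exists>x w1 w2. loops g (N g) Z (fst d) (snd d) x w1 w2"
proof -
  obtain g' x w1 w2 where g': "g' \<in> atom (N g) g" and l: "loops g' (N g) Z (fst d) (snd d) x w1 w2"
    using d unfolding admissible_def by (elim bexE exE)
  have "g' \<in> space M" "agree (N g) g' g" using g' agree_sym by (auto simp: atom_def)
  then show ?thesis using loops_agree[OF _ g _ l] by blast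
qed

text \<open>Measurability is asked for every \<open>Z\<close>, orbit or not; for the others
  \<open>dat\<close> may fall back on its default, which consists of empty words.\<close>

lemma dat_word:
  assumes g: "g \<in> space M" and k: "k < K"
  shows "set (snd (dat Z g) k) \<subseteq> Lt"
proof (cases "\<exists>d. admissible Z g d")
  case True
  then have "admissible Z g (dat Z g)" using dat_admissible by blast
  then obtain x w1 w2 where "loops g (N g) Z (fst (dat Z g)) (snd (dat Z g)) x w1 w2"
    using admissible_loops[OF g] by blast
  then have "snd (dat Z g) k \<in> \<Delta>" using k unfolding loops_def by blast
  then show ?thesis using \<Delta>_word by blast
next
  case False
  then show ?thesis by (simp add: dat_def)
qed

lemma dat_loops:
  assumes g: "g \<in> space M" and N: "0 < N g" and Z: "Z \<in> orbits D (tree_level (N g)) (free_hom G g)"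
  shows "\<exists>x w1 w2. loops g (N g) Z (fst (dat Z g)) (snd (dat Z g)) x w1 w2"
proof -
  obtain v0 where v0: "length v0 = N g" "Z = {fold (lact g) w v0 | w. w \<in> \<Delta>}"
    using Z unfolding orbits_eq[OF g] by blast
  have "\<exists>n>0. good n g"
  proof (rule ccontr)
    assume "\<not> (\<exists>n>0. good n g)"
    then have "N g = 0" unfolding N_def by (rule if_not_P)
    then show False using N by simp
  qed
  then have "good (N g) g" by (rule N_pos(2))
  then obtain v \<alpha> x w1 w2 where "loops g (N g) Z v \<alpha> x w1 w2"
    using loops_exist[OF g _ v0] by blast
  then have "admissible Z g (v, \<alpha>)"
    unfolding admissible_def using g agree_refl
    by (intro bexI[of _ g] exI[of _ x] exI[of _ w1] exI[of _ w2]) (simp_all add: atom_def)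
  then show ?thesis using admissible_loops[OF g dat_admissible] by blast
qed

definition xi :: "'a list set \<Rightarrow> nat \<Rightarrow> (nat \<Rightarrow> 'a list \<Rightarrow> 'a list) \<Rightarrow> 'a list \<Rightarrow> 'a list" where
  "xi Z k g = section_at (free_hom G g (snd (dat Z g) k)) (fst (dat Z g))"

lemma xi_sec:
  assumes "g \<in> space M" "k < K"
  shows "xi Z k g = sec g (snd (dat Z g) k) (fst (dat Z g))"
  by (simp add: xi_def sec_def free_hom_fold[OF assms(1) dat_word[OF assms]])

lemma length_dat: assumes "g \<in> space M" shows "length (fst (dat Z g)) \<le> N g"
proof (cases "\<exists>d. admissible Z g d")
  case True
  then have "admissible Z g (dat Z g)" using dat_admissible by blast
  then obtain x w1 w2 where "loops g (N g) Z (fst (dat Z g)) (snd (dat Z g)) x w1 w2"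
    using admissible_loops[OF assms] by blast
  then show ?thesis by (simp add: loops_def)
next
  case False
  then show ?thesis by (simp add: dat_def)
qed

lemma xi_agree:
  assumes g: "g \<in> space M" "g' \<in> space M" and N: "N g = n" "N g' = n" and k: "k < K"
    and a: "agree (n + j) g g'" and C: "level_set j C"
  shows "xi Z k g \<in> C \<longleftrightarrow> xi Z k g' \<in> C"
proof -
  have "agree n g g'" by (rule agree_mono[OF a]) simp
  then have d: "dat Z g' = dat Z g" using dat_eq[of g g' Z] N by simp
  have "determined (n + j) (\<lambda>g'. sec g' (snd (dat Z g) k) (fst (dat Z g)) \<in> C)"
    by (rule determined_sec[OF dat_word[OF g(1) k] C]) (use length_dat[OF g(1), of Z] N in simp)
  from this[unfolded determined_def, THEN bspec[OF _ g(1)], THEN bspec[OF _ g(2)], THEN mp, OF a]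
  show ?thesis unfolding xi_sec[OF g(1) k] xi_sec[OF g(2) k] d .
qed

lemma xi_measurable:
  assumes k: "k < K"
  shows "xi Z k \<in> measurable M \<mu>"
proof (rule measurable_sigma_sets[OF sets_mu cyls_Pow])
  show "xi Z k \<in> space M \<rightarrow> W"
  proof (rule Pi_I)
    fix g assume g: "g \<in> space M"
    show "xi Z k g \<in> W" unfolding xi_sec[OF g k] by (rule sec_W[OF g dat_word[OF g k]])
  qed
  fix A assume "A \<in> cyls"
  from level_set_cyls[OF this] obtain j where "level_set j A" by (rule exE)
  then show "xi Z k -` A \<inter> space M \<in> sets M"
    by (intro sec_measurable[where e = j, OF N_sets]) (rule xi_agree[OF _ _ _ _ k])
qed

lemma dat_measurable: "(\<lambda>g. h (dat Z g)) \<in> measurable M (count_space UNIV)"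
proof (rule measurableI)
  fix A
  show "(\<lambda>g. h (dat Z g)) -` A \<inter> space M \<in> sets M"
  proof (rule sec_measurable[where e = 0, OF N_sets])
    fix n g g' assume "N g = n" "N g' = n" "agree (n + 0) g g'"
    then show "(h (dat Z g) \<in> A) = (h (dat Z g') \<in> A)" using dat_eq[of g g' Z] by simp
  qed
qed simp

lemma N_measurable: "N \<in> measurable M (count_space UNIV)"
proof (rule measurableI)
  fix A
  show "N -` A \<inter> space M \<in> sets M" by (rule sec_measurable[where e = 0, OF N_sets]) simp
qed simp

text \<open>\<open>E\<close> is a union of atoms of level \<open>n\<close>. On each atom
  \<open>dat Z\<close> is constant and \<open>independent_sections\<close> gives the product
  formula; \<open>measure_total\<close> then combines the atoms.\<close>

lemma xi_independent:
  assumes n: "0 < n" and Z: "Z \<in> \<O>"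
    and E: "E = {g \<in> space M. N g = n \<and> orbits D (tree_level n) (free_hom G g) = \<O>}"
    and pos: "emeasure M E \<noteq> 0"
  shows "prob_space.indep_vars (uniform_measure M E) (\<lambda>_. \<mu>) (xi Z) {..<K} \<and>
    (\<forall>k<K. distr (uniform_measure M E) \<mu> (xi Z k) = \<mu>)"
proof (rule independent_haar[OF _ pos xi_measurable])
  let ?Q = "\<lambda>g. N g = n \<and> orbits D (tree_level n) (free_hom G g) = \<O>"
  have detO: "determined n (\<lambda>g. orbits D (tree_level n) (free_hom G g) = \<O>)"
    unfolding determined_def
  proof (intro ballI impI)
    fix g g' assume g: "g \<in> space M" "g' \<in> space M" "agree n g g'"
    have "{fold (lact g) w v | w. w \<in> \<Delta>} = {fold (lact g') w v | w. w \<in> \<Delta>}" if "length v = n" for v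
    proof -
      have "fold (lact g) w v = fold (lact g') w v" if "w \<in> \<Delta>" for w
        by (rule fold_agree[OF g]) (use \<Delta>_word[OF that] \<open>length v = n\<close> in auto)
      then show ?thesis by (intro Collect_cong ex_cong1) auto
    qed
    then have "(Z' \<in> {{fold (lact g) w v | w. w \<in> \<Delta>} | v. length v = n}) =
        (Z' \<in> {{fold (lact g') w v | w. w \<in> \<Delta>} | v. length v = n})" for Z'
      unfolding mem_Collect_eq by (intro ex_cong1 rev_conj_cong) simp_all
    then have "orbits D (tree_level n) (free_hom G g) = orbits D (tree_level n) (free_hom G g')"
      unfolding orbits_eq[OF g(1)] orbits_eq[OF g(2)] by (simp only: set_eq_iff simp_thms)
    then show "(orbits D (tree_level n) (free_hom G g) = \<O>) = (orbits D (tree_level n) (free_hom G g') = \<O>)"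
      by simp
  qed
  have detQ: "determined n ?Q" by (rule determined_conj[OF determined_N[OF n] detO])
  show "E \<in> sets M" unfolding E by (rule determined_sets[OF detQ])
  fix J :: "nat set" and A assume J: "J \<subseteq> {..<K}" and A: "\<And>k. k \<in> J \<Longrightarrow> A k \<in> cyls"
  have "\<forall>k. \<exists>j. k \<in> J \<longrightarrow> level_set j (A k)" using level_set_cyls[OF A] by blast
  then have "\<exists>jj. \<forall>k. k \<in> J \<longrightarrow> level_set (jj k) (A k)" by (rule choice)
  then obtain jj where jj: "\<And>k. k \<in> J \<Longrightarrow> level_set (jj k) (A k)" by (elim exE) blast
  have finJ: "finite J" by (rule finite_subset[OF J finite_lessThan])
  \<comment> \<open>\<open>?S\<close> repeats \<open>?Q\<close>, because the sections are determined
    by a fixed level only where \<open>N g = n\<close>.\<close>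
  let ?S = "\<lambda>g. ?Q g \<and> (\<forall>k\<in>J. xi Z k g \<in> A k)"
  define N' where "N' = n + (\<Sum>k\<in>J. jj k)"
  have jN: "n + jj k \<le> N'" if "k \<in> J" for k
    unfolding N'_def using member_le_sum[of k J jj] that finJ by simp
  have detS: "determined N' ?S"
    unfolding determined_def
  proof (intro ballI impI)
    fix g g' assume g: "g \<in> space M" "g' \<in> space M" "agree N' g g'"
    have "agree n g g'" by (rule agree_mono[OF g(3)]) (simp add: N'_def)
    then have 1: "?Q g = ?Q g'" using detQ g(1,2) unfolding determined_def by blast
    have "xi Z k g \<in> A k \<longleftrightarrow> xi Z k g' \<in> A k" if k: "k \<in> J" and q: "?Q g" for k
    proof -
      have NN: "N g = n" "N g' = n" using q 1 by blast+
      have kK: "k < K" using k J by blast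
      show ?thesis by (rule xi_agree[OF g(1,2) NN kK agree_mono[OF g(3) jN[OF k]] jj[OF k]])
    qed
    then show "?S g = ?S g'" using 1 by blast
  qed
  have "measure M {g \<in> space M. ?Q g \<and> ?S g} = measure M {g \<in> space M. ?Q g} * (\<Prod>k\<in>J. measure \<mu> (A k))"
  proof (rule measure_total[OF detQ detS])
    fix g0 assume g0: "g0 \<in> space M" and Q: "?Q g0"
    have N0: "0 < N g0" "N g0 = n" using Q n by simp_all
    have "Z \<in> orbits D (tree_level (N g0)) (free_hom G g0)" using Q Z by simp
    then obtain x w1 w2 where l: "loops g0 n Z (fst (dat Z g0)) (snd (dat Z g0)) x w1 w2"
      using dat_loops[OF g0 N0(1)] N0(2) by blast
    let ?v = "fst (dat Z g0)"
    have wL: "set (w1 k) \<subseteq> Lt" "set (w2 k) \<subseteq> Lt" "snd (dat Z g0) k = nf (w1 k @ x # w2 k)" if "k \<in> J" for k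
      using l that J by (auto simp: loops_def)
    have x: "x \<in> Lt" and lv: "length ?v = n" using l by (auto simp: loops_def)
    \<comment> \<open>On the atom the random data are those of \<open>g0\<close>, and the reduced
      word acts like its factorisation.\<close>
    have "{g' \<in> atom n g0. ?S g'} = {g' \<in> atom n g0. \<forall>k\<in>J. sec g' (w1 k @ x # w2 k) ?v \<in> A k}"
    proof -
      have "?S g' \<longleftrightarrow> (\<forall>k\<in>J. sec g' (w1 k @ x # w2 k) ?v \<in> A k)" if g': "g' \<in> atom n g0" for g'
      proof -
        have g'M: "g' \<in> space M" and ag: "agree n g0 g'" using g' by (auto simp: atom_def)
        have Q': "?Q g'" using detQ g0 g'M ag Q unfolding determined_def by blast
        have d: "dat Z g' = dat Z g0" using dat_eq[of g0 g' Z] Q' N0(2) ag by simp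
        have "xi Z k g' = sec g' (w1 k @ x # w2 k) ?v" if k: "k \<in> J" for k
        proof -
          have kK: "k < K" using k J by blast
          have "fold (lact g') (nf (w1 k @ x # w2 k)) = fold (lact g') (w1 k @ x # w2 k)"
            by (rule ext, rule fold_nf_lact[OF g'M]) (use wL(1,2)[OF k] x in simp)
          then show ?thesis unfolding xi_sec[OF g'M kK] d wL(3)[OF k] sec_def by simp
        qed
        then show ?thesis using Q' by simp
      qed
      then show ?thesis by blast
    qed
    also have "measure M \<dots> = measure M (atom n g0) * (\<Prod>k\<in>J. measure \<mu> (A k))"
    proof (rule independent_sections[where v = "\<lambda>_. ?v" and y = "\<lambda>k. fold (lact g0) (w1 k) ?v" and jj = jj, OF g0 finJ x])
      show "length ?v = n \<and> set (w1 k) \<subseteq> Lt \<and> set (w2 k) \<subseteq> Lt \<and>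
        fold (lact g0) (w1 k) ?v = fold (lact g0) (w1 k) ?v \<and> level_set (jj k) (A k)" if "k \<in> J" for k
        using lv wL[OF that] jj[OF that] by blast
      have "inj_on (\<lambda>k. fold (lact g0) (w1 k) ?v) {..<K}" using l by (simp add: loops_def)
      then show "inj_on (\<lambda>k. fold (lact g0) (w1 k) ?v) J" by (rule inj_on_subset[OF _ J])
      show "avoids (lact g0) x (fold (lact g0) (w1 j) ?v) (w1 k) ?v \<and>
        avoids (lact g0) x (fold (lact g0) (w1 j) ?v) (w2 k) (lact g0 x (fold (lact g0) (w1 k) ?v))"
        if "j \<in> J" "k \<in> J" for j k
      proof -
        have "j < K" "k < K" using that J by auto
        then show ?thesis using l unfolding loops_def by blast
      qed
    qed
    finally show "measure M {g' \<in> atom n g0. ?S g'} = measure M (atom n g0) * (\<Prod>k\<in>J. measure \<mu> (A k))" .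
  qed
  moreover have "{g \<in> space M. ?Q g \<and> ?S g} = {g \<in> E. \<forall>k\<in>J. xi Z k g \<in> A k}" unfolding E by blast
  moreover have "{g \<in> space M. ?Q g} = E" unfolding E ..
  ultimately show "measure M {g \<in> E. \<forall>k\<in>J. xi Z k g \<in> A k} = measure M E * (\<Prod>k\<in>J. measure \<mu> (A k))"
    by simp
qed

lemma AE_loops:
  assumes q0: "\<And>\<epsilon>. 0 < \<epsilon> \<Longrightarrow> \<exists>j. measure \<mu> (fix_set j) < \<epsilon>"
  shows "AE g in M. 0 < N g \<and> (\<forall>Z\<in>orbits D (tree_level (N g)) (free_hom G g).
    fst (dat Z g) \<in> Z \<and> (\<forall>k<K. snd (dat Z g) k \<in> stabilizer D (free_hom G g) (fst (dat Z g))))"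
proof -
  have "AE g in M. \<exists>n>0. good n g" by (rule AE_good) (rule q0)
  then show ?thesis
proof (rule AE_mp, intro AE_I2 impI)
  fix g assume g: "g \<in> space M" and ex: "\<exists>n>0. good n g"
  have N: "0 < N g" by (rule N_pos(1)[OF ex])
  have "fst (dat Z g) \<in> Z \<and> (\<forall>k<K. snd (dat Z g) k \<in> stabilizer D (free_hom G g) (fst (dat Z g)))"
    if Z: "Z \<in> orbits D (tree_level (N g)) (free_hom G g)" for Z
  proof -
    obtain x w1 w2 where l: "loops g (N g) Z (fst (dat Z g)) (snd (dat Z g)) x w1 w2"
      using dat_loops[OF g N Z] by blast
    have "snd (dat Z g) k \<in> stabilizer D (free_hom G g) (fst (dat Z g))" if k: "k < K" for k
    proof -
      have w: "set (w1 k @ x # w2 k) \<subseteq> Lt" "snd (dat Z g) k = nf (w1 k @ x # w2 k)" "snd (dat Z g) k \<in> \<Delta>"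
        "fold (lact g) (w1 k @ x # w2 k) (fst (dat Z g)) = fst (dat Z g)"
        using l k by (auto simp: loops_def)
      have "free_hom G g (snd (dat Z g) k) (fst (dat Z g)) = fold (lact g) (nf (w1 k @ x # w2 k)) (fst (dat Z g))"
        unfolding w(2)[symmetric] free_hom_fold[OF g dat_word[OF g k]] ..
      also have "\<dots> = fst (dat Z g)" unfolding fold_nf_lact[OF g w(1)] by (rule w(4))
      finally show ?thesis using w(3) by (simp add: stabilizer_def)
    qed
    moreover have "fst (dat Z g) \<in> Z" using l by (simp add: loops_def)
    ultimately show ?thesis by blast
  qed
  then show "0 < N g \<and> (\<forall>Z\<in>orbits D (tree_level (N g)) (free_hom G g).
    fst (dat Z g) \<in> Z \<and> (\<forall>k<K. snd (dat Z g) k \<in> stabilizer D (free_hom G g) (fst (dat Z g))))"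
    using N by blast
qed
qed

end

context random_subgroup
begin

text \<open>For \<open>d = 1\<close> no level is acted on freely, but \<open>W(H)\<close> is trivial and level 0 will do.\<close>

lemma trivial_W:
  assumes triv: "\<And>x y :: 'd. x = y"
  shows "W = {id}"
proof
  show "W \<subseteq> {id}"
  proof
    fix g assume g: "g \<in> W"
    have "g w = w" for w
    proof (rule nth_equalityI)
      show "length (g w) = length w" by (rule tree_aut_length[OF W_tree[OF g]])
      show "g w ! i = w ! i" for i by (rule triv)
    qed
    then show "g \<in> {id}" by auto
  qed
  show "{id} \<subseteq> W" using W_id by simp
qed

text \<open>The only cylinders are the empty set and \<open>W\<close>, so both sides of the product
  formula are 0 or \<open>measure M E\<close>.\<close>

lemma trivial_independent:
  assumes triv: "\<And>x y :: 'd. x = y" and E: "E \<in> sets M" and pos: "emeasure M E \<noteq> 0"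
  shows "prob_space.indep_vars (uniform_measure M E) (\<lambda>_. \<mu>) (\<lambda>k g. id) {..<K} \<and>
    (\<forall>k<K. distr (uniform_measure M E) \<mu> (\<lambda>g. id) = \<mu>)"
proof (rule independent_haar[OF E pos])
  have W1: "W = {id}" by (rule trivial_W[OF triv])
  show "(\<lambda>g. id) \<in> measurable M \<mu>" by (rule measurable_const) (simp add: space_mu W_id)
  fix J :: "nat set" and A assume J: "J \<subseteq> {..<K}" and A: "\<And>k. k \<in> J \<Longrightarrow> A k \<in> cyls"
  have finJ: "finite J" by (rule finite_subset[OF J finite_lessThan])
  have A2: "A k = {} \<or> A k = W" if "k \<in> J" for k
    using A[OF that] cyls_Pow unfolding W1 by (metis PowD subsetD subset_singletonD)
  show "measure M {g \<in> E. \<forall>k\<in>J. id \<in> A k} = measure M E * (\<Prod>k\<in>J. measure \<mu> (A k))"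
  proof (cases "\<exists>k\<in>J. A k = {}")
    case True
    then obtain k where k: "k \<in> J" "A k = {}" by blast
    have "(\<Prod>k\<in>J. measure \<mu> (A k)) = 0"
      by (rule prod_zero[OF finJ], rule bexI[OF _ k(1)]) (simp add: k(2))
    moreover have empty: "{g \<in> E. \<forall>k\<in>J. id \<in> A k} = {}" using k by auto
    ultimately show ?thesis unfolding empty by simp
  next
    case False
    then have AW: "A k = W" if "k \<in> J" for k using A2 that by blast
    have "measure \<mu> W = 1" using P.M.prob_space space_mu by simp
    then have "(\<Prod>k\<in>J. measure \<mu> (A k)) = 1" by (intro prod.neutral) (simp add: AW)
    moreover have "{g \<in> E. \<forall>k\<in>J. id \<in> A k} = E" using AW W_id by auto
    ultimately show ?thesis by simp
  qed
qed

lemma orbit_root: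
  assumes g: "g \<in> space M"
  shows "orbits D (tree_level 0) (free_hom G g) = {{[]}}"
proof -
  have "{fold (lact g) w [] | w. w \<in> \<Delta>} = {[]}"
  proof
    show "{fold (lact g) w [] | w. w \<in> \<Delta>} \<subseteq> {[]}"
      using length_fold[OF g, of _ "[]"] \<Delta>_word by auto
    have "fold (lact g) [] [] \<in> {fold (lact g) w [] | w. w \<in> \<Delta>}" using \<Delta>_Nil by blast
    then show "{[]} \<subseteq> {fold (lact g) w [] | w. w \<in> \<Delta>}" by simp
  qed
  then show ?thesis unfolding orbits_eq[OF g] by auto
qed

end

theorem theorem3p1:
  fixes H :: "('d::finite \<Rightarrow> 'd) set"
    and \<mu> :: "('d list \<Rightarrow> 'd list) measure"
    and m K :: nat
    and \<Delta> :: "letter list set"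
  defines "F \<equiv> free_group m"
    and "\<phi> \<equiv> free_hom (W_group H)"
    and "M \<equiv> PiM {..<m} (\<lambda>_. \<mu>)"
  assumes H_sub: "subgroup H (BijGroup (UNIV :: 'd set))"
    and H_trans: "\<forall>x y. \<exists>h\<in>H. h x = y"
    and haar: "haar_prob (W_group H) (W_topology H) \<mu>"
    and \<Delta>_sub: "subgroup \<Delta> F"
    and \<Delta>_noncyc: "\<not> cyclic_group (F\<lparr>carrier := \<Delta>\<rparr>)"
  shows "\<exists>(N :: (nat \<Rightarrow> 'd list \<Rightarrow> 'd list) \<Rightarrow> nat)
          (v :: 'd list set \<Rightarrow> (nat \<Rightarrow> 'd list \<Rightarrow> 'd list) \<Rightarrow> 'd list)
          (\<alpha> :: 'd list set \<Rightarrow> nat \<Rightarrow> (nat \<Rightarrow> 'd list \<Rightarrow> 'd list) \<Rightarrow> letter list).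
      N \<in> measurable M (count_space UNIV) \<and>
      (\<forall>Z. v Z \<in> measurable M (count_space UNIV)) \<and>
      (\<forall>Z. \<forall>k<K. \<alpha> Z k \<in> measurable M (count_space UNIV)) \<and>
      (AE g in M. \<forall>Z \<in> orbits (F\<lparr>carrier := \<Delta>\<rparr>) (tree_level (N g)) (\<phi> g).
          v Z g \<in> Z \<and>
          (\<forall>k<K. \<alpha> Z k g \<in> stabilizer (F\<lparr>carrier := \<Delta>\<rparr>) (\<phi> g) (v Z g))) \<and>
      (\<forall>n \<O>. let
            E = {g \<in> space M. N g = n \<and>
                   orbits (F\<lparr>carrier := \<Delta>\<rparr>) (tree_level n) (\<phi> g) = \<O>};
            P = uniform_measure M E
          in emeasure M E \<noteq> 0 \<longrightarrow>
            (\<forall>Z\<in>\<O>. let \<xi> = (\<lambda>k g. section_at (\<phi> g (\<alpha> Z k g)) (v Z g)) in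
               prob_space.indep_vars P (\<lambda>_. \<mu>) \<xi> {..<K} \<and>
               (\<forall>k<K. distr P \<mu> (\<xi> k) = \<mu>)))"
proof -
  interpret S: random_subgroup H \<mu> m \<Delta> K
    by (intro random_subgroup.intro random_action.intro haar_tree.intro tree_group.intro haar_tree_axioms.intro
        random_subgroup_axioms.intro H_sub haar \<Delta>_sub[unfolded F_def])
  show ?thesis
  proof (cases "\<exists>c1 c2 :: 'd. c1 \<noteq> c2")
    case False
    then have triv: "\<And>x y :: 'd. x = y" by blast
    have id: "\<phi> g [] = id" for g by (simp add: \<phi>_def free_hom_Nil)
    have st: "[] \<in> stabilizer (F\<lparr>carrier := \<Delta>\<rparr>) (\<phi> g) []" for g
      using S.\<Delta>_Nil id by (simp add: stabilizer_def)
    have AE: "AE g in M. \<forall>Z \<in> orbits (F\<lparr>carrier := \<Delta>\<rparr>) (tree_level 0) (\<phi> g).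
        [] \<in> Z \<and> (\<forall>k<K. [] \<in> stabilizer (F\<lparr>carrier := \<Delta>\<rparr>) (\<phi> g) [])"
    proof (intro AE_I2 ballI conjI allI impI st)
      fix g Z assume g: "g \<in> space M" and Z: "Z \<in> orbits (F\<lparr>carrier := \<Delta>\<rparr>) (tree_level 0) (\<phi> g)"
      then show "[] \<in> Z" using S.orbit_root[of g] by (simp add: F_def \<phi>_def M_def)
    qed
    have indep: "prob_space.indep_vars (uniform_measure M E) (\<lambda>_. \<mu>) (\<lambda>k g. section_at (\<phi> g []) []) {..<K} \<and>
        (\<forall>k<K. distr (uniform_measure M E) \<mu> (\<lambda>g. section_at (\<phi> g []) []) = \<mu>)"
      if pos: "emeasure M E \<noteq> 0" for E
    proof -
      \<comment> \<open>\<open>emeasure\<close> vanishes on non-measurable sets, so the assumption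
        \<open>pos\<close> includes measurability.\<close>
      have "E \<in> sets M" using pos emeasure_notin_sets by blast
      then show ?thesis using S.trivial_independent[OF triv, of E] pos by (simp add: M_def id)
    qed
    show ?thesis
      unfolding Let_def
      by (rule exI[of _ "\<lambda>_. 0"], rule exI[of _ "\<lambda>_ _. []"], rule exI[of _ "\<lambda>_ _ _. []"])
        (intro conjI allI impI ballI AE measurable_const;
          (erule indep[THEN conjunct1] | erule indep[THEN conjunct2, THEN spec, THEN mp] | simp))
  next
    case True
    then obtain c1 c2 :: 'd where c12: "c1 \<noteq> c2" by blast
    obtain f c b where fcb: "f @ c @ inv_word f \<in> \<Delta>" "c \<noteq> []" "reduced_word (c @ c)" "b \<in> \<Delta>"
      "\<And>i j. i \<noteq> 0 \<or> j \<noteq> 0 \<Longrightarrow> nf (word_pow i (f @ c @ inv_word f) @ word_pow j b) \<noteq> [] \<and>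
       nf (word_pow i (f @ c @ inv_word f) @ word_pow j (inv_word b)) \<noteq> []"
      using noncyclic_words[OF \<Delta>_sub[unfolded F_def] \<Delta>_noncyc[unfolded F_def]] by metis
    define a where "a = f @ c @ inv_word f"
    define \<rho> where "\<rho> = length a + length b"
    define P where "P = card (words_upto S.Lt \<rho>)"
    define B where "B = 2 * K * P"
    define M0 where "M0 = (length a * B) * (length b * B)"
    define Mc where "Mc = P * (M0 + \<rho> * B)"
    define r0 where "r0 = (Mc + 2) * length c + length f + 2"
    define V where "V = length f * B + (B + K) * card (words_upto S.Lt r0)"
    define Q where "Q = Mc + P * (V + \<rho> * B)"
    define R where "R = r0 + 2 + Q * (length a + length b)"
    interpret L: noncyclic_subgroup H \<mu> m \<Delta> K f c b a \<rho> P B M0 Mc r0 V Q R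
      by (intro noncyclic_subgroup.intro S.random_subgroup_axioms noncyclic_subgroup_axioms.intro
          a_def \<rho>_def P_def B_def M0_def Mc_def r0_def V_def Q_def R_def)
        ((unfold a_def)?; (rule fcb | erule fcb))+
    have q0: "\<exists>j. measure \<mu> (S.fix_set j) < \<epsilon>" if "0 < \<epsilon>" for \<epsilon>
      by (rule S.fix_set_measure_small[OF H_trans c12 that])
    have AE: "AE g in M. 0 < L.N g \<and> (\<forall>Z\<in>orbits (F\<lparr>carrier := \<Delta>\<rparr>) (tree_level (L.N g)) (\<phi> g).
        fst (L.dat Z g) \<in> Z \<and> (\<forall>k<K. snd (L.dat Z g) k \<in> stabilizer (F\<lparr>carrier := \<Delta>\<rparr>) (\<phi> g) (fst (L.dat Z g))))"
      unfolding F_def \<phi>_def M_def by (rule L.AE_loops[OF q0])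
    have xi: "(\<lambda>k g. section_at (\<phi> g (snd (L.dat Z g) k)) (fst (L.dat Z g))) = L.xi Z" for Z
      by (intro ext) (simp add: L.xi_def \<phi>_def)
    have indep: "prob_space.indep_vars (uniform_measure M E) (\<lambda>_. \<mu>) (L.xi Z) {..<K} \<and>
        (\<forall>k<K. distr (uniform_measure M E) \<mu> (L.xi Z k) = \<mu>)"
      if E: "E = {g \<in> space M. L.N g = n \<and> orbits (F\<lparr>carrier := \<Delta>\<rparr>) (tree_level n) (\<phi> g) = \<O>}"
        and pos: "emeasure M E \<noteq> 0" and Z: "Z \<in> \<O>" for E n \<O> Z
    proof -
      \<comment> \<open>By \<open>AE\<close> the default value 0 of \<open>L.N\<close> is taken on a
        null set only, and \<open>E\<close> is not null.\<close>
      have "n \<noteq> 0"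
      proof
        assume "n = 0"
        have EM: "E \<in> sets M" using pos emeasure_notin_sets by blast
        have "AE g in M. g \<notin> E" using AE by eventually_elim (simp add: E \<open>n = 0\<close>)
        then have "emeasure M E = 0" using AE_iff_measurable[of E M "\<lambda>g. g \<notin> E"] EM sets.sets_into_space[OF EM] by auto
        then show False using pos by simp
      qed
      then show ?thesis
        using L.xi_independent[OF _ Z E[unfolded F_def \<phi>_def M_def] pos[unfolded M_def]] by (simp add: M_def)
    qed
    have main: "let E = {g \<in> space M. L.N g = n \<and> orbits (F\<lparr>carrier := \<Delta>\<rparr>) (tree_level n) (\<phi> g) = \<O>};
            P = uniform_measure M E
          in emeasure M E \<noteq> 0 \<longrightarrow>
            (\<forall>Z\<in>\<O>. let \<xi> = (\<lambda>k g. section_at (\<phi> g (snd (L.dat Z g) k)) (fst (L.dat Z g))) in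
               prob_space.indep_vars P (\<lambda>_. \<mu>) \<xi> {..<K} \<and>
               (\<forall>k<K. distr P \<mu> (\<xi> k) = \<mu>))" for n \<O>
      unfolding Let_def xi by (intro impI ballI) (rule indep[OF refl])
    have AE': "AE g in M. \<forall>Z\<in>orbits (F\<lparr>carrier := \<Delta>\<rparr>) (tree_level (L.N g)) (\<phi> g).
        fst (L.dat Z g) \<in> Z \<and> (\<forall>k<K. snd (L.dat Z g) k \<in> stabilizer (F\<lparr>carrier := \<Delta>\<rparr>) (\<phi> g) (fst (L.dat Z g)))"
      using AE by eventually_elim (erule conjunct2)
    show ?thesis
      apply (rule exI[of _ L.N], rule exI[of _ "\<lambda>Z g. fst (L.dat Z g)"],
          rule exI[of _ "\<lambda>Z k g. snd (L.dat Z g) k"])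
      apply (intro conjI allI impI)
      subgoal unfolding M_def by (rule L.N_measurable)
      subgoal unfolding M_def by (rule L.dat_measurable)
      subgoal unfolding M_def by (rule L.dat_measurable)
      subgoal by (rule AE')
      subgoal by (rule main)
      done
  qed
qed

end
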